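(* For a positive integer $n$ and partitions $\lambda,\mu,\nu$ each satisfying $|\rho|+\ell(\rho)\le n$ (for $\rho=\lambda,\mu,\nu$), let $k_{\lambda\mu}^{\nu}(n)\in\mathbb Z[\xi]$ be the structure constants of the center $\mathcal Z(\mathcal H_n)$ of the Iwahori--Hecke algebra $\mathcal H_n$ of $S_n$ with respect to the Geck--Rouquier basis, i.e. $$\Gamma_\lambda(n)\,\Gamma_\mu(n)=\sum_{\nu} k_{\lambda\mu}^{\nu}(n)\,\Gamma_\nu(n),$$ where the sum is over partitions $\nu$ with $|\nu|+\ell(\nu)\le n$. Then: (1) For any $n$, $k_{\lambda\mu}^{\nu}(n)$ is a polynomial in $\xi$ with non-negative integral coefficients. Moreover, $k_{\lambda\mu}^{\nu}(n)$ is an even (respectively, odd) polynomial in $\xi$ if and only if $|\lambda|+|\mu|-|\nu|$ is even (respectively, odd). (2) $k_{\lambda\mu}^{\nu}(n)=0$ unless $|\nu|\le|\lambda|+|\mu|$. (3) If $|\nu|=|\lambda|+|\mu|$, then $k_{\lambda\mu}^{\nu}(n)$ is independent of $n$.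
   Context: Let $\xi$ be an indeterminate. The Iwahori--Hecke algebra $\mathcal H_n$ is the unital $\mathbb Z[\xi]$-algebra generated by $T_1,\dots,T_{n-1}$ subject to $T_iT_{i+1}T_i=T_{i+1}T_iT_{i+1}$, $T_iT_j=T_jT_i$ for $|i-j|>1$, and $T_i^2=1+\xi T_i$. For $w\in S_n$ with reduced expression $w=s_{i_1}\cdots s_{i_r}$ in the simple transpositions $s_i=(i,i+1)$, set $T_w=T_{i_1}\cdots T_{i_r}$; the length of $w$ is $r$. The $T_w$ ($w\in S_n$) form a $\mathbb Z[\xi]$-basis of $\mathcal H_n$, and setting $\xi=0$ (with $T_w\mapsto w$) gives $\mathbb ZS_n$. For a partition $\lambda$, $|\lambda|$ is the sum of its parts and $\ell(\lambda)$ the number of nonzero parts. If $w\in S_n$ has cycle type $(\rho_1,\dots,\rho_t,1,\dots,1)$ with all $\rho_i>1$, its modified cycle type is the partition $(\rho_1-1,\dots,\rho_t-1)$. For a partition $\lambda$ with $|\lambda|+\ell(\lambda)\le n$, $C_\lambda(n)$ denotes the conjugacy class of all elements of $S_n$ of modified cycle type $\lambda$, and $c_\lambda(n)=\sum_{w\in C_\lambda(n)}w$ its class sum. The Geck--Rouquier class elements $\Gamma_\lambda(n)$, for $|\lambda|+\ell(\lambda)\le n$, form a $\mathbb Z[\xi]$-basis of the center $\mathcal Z(\mathcal H_n)$ (known, due to Geck--Rouquier). It is known that $\Gamma_\lambda(n)$ is the unique element of $\mathcal Z(\mathcal H_n)$ such that (i) $\Gamma_\lambda(n)$ specializes at $\xi=0$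 to $c_\lambda(n)$; and (ii) in the expansion of $\Gamma_\lambda(n)-\sum_{w\in C_\lambda(n)}T_w$ in the basis $\{T_w\}$, the coefficient of $T_w$ is zero whenever $w$ is an element of minimal length in its conjugacy class. In (3), "independent of $n$" refers, for fixed $\lambda,\mu,\nu$, to all $n$ with $n\ge |\rho|+\ell(\rho)$ for $\rho=\lambda,\mu,\nu$. A polynomial in $\xi$ is even (resp. odd) if only even (resp. odd) powers of $\xi$ occur in it.
   Formalization: The parity equivalence in (1) is stated only for nonzero structure constants, since the zero polynomial is both even and odd: for n=2, λ=μ=∅, ν=(1), k=0 is even although |λ|+|μ|-|ν|=-1 is odd. *)

theory Defs
  imports
    "HOL-Combinatorics.Permutations"
    "HOL-Combinatorics.Orbits"
    "HOL-Computational_Algebra.Polynomial"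
    "HOL-Library.Poly_Mapping"
    "HOL-Library.Multiset"
    "HOL-Algebra.QuotRing"
begin

section \<open>The symmetric group\<close>

text \<open>
  \<open>S\<^sub>n\<close> consists of the permutations of \<open>{1..n}\<close>, seen as functions on \<^typ>\<open>nat\<close> fixing
  everything else; its product is composition.
\<close>

definition Sym :: "nat \<Rightarrow> (nat \<Rightarrow> nat) set" where
  "Sym n = {w. w permutes {1..n}}"

definition word_perm :: "nat list \<Rightarrow> nat \<Rightarrow> nat" where
  "word_perm is = foldr (\<lambda>i w. Transposition.transpose i (Suc i) \<circ> w) is id"

definition expresses :: "nat \<Rightarrow> nat list \<Rightarrow> (nat \<Rightarrow> nat) \<Rightarrow> bool" where
  "expresses n is w \<longleftrightarrow> set is \<subseteq> {1..<n} \<and> word_perm is = w"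

definition perm_length :: "nat \<Rightarrow> (nat \<Rightarrow> nat) \<Rightarrow> nat" where
  "perm_length n w = (LEAST r. \<exists>is. expresses n is w \<and> length is = r)"

definition reduced_expression :: "nat \<Rightarrow> nat list \<Rightarrow> (nat \<Rightarrow> nat) \<Rightarrow> bool" where
  "reduced_expression n is w \<longleftrightarrow> expresses n is w \<and> length is = perm_length n w"

definition conj_class :: "nat \<Rightarrow> (nat \<Rightarrow> nat) \<Rightarrow> (nat \<Rightarrow> nat) set" where
  "conj_class n w = {g \<circ> w \<circ> inv_into UNIV g | g. g \<in> Sym n}"

definition min_length_in_class :: "nat \<Rightarrow> (nat \<Rightarrow> nat) \<Rightarrow> bool" where
  "min_length_in_class n w \<longleftrightarrow> (\<forall>v\<in>conj_class n w. perm_length n w \<le> perm_length n v)"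


section \<open>Partitions and conjugacy classes\<close>

text \<open>
  A partition is the multiset of its nonzero parts, so \<open>|\<lambda>|\<close> is \<open>\<Sum>\<^sub># lam\<close> and
  \<open>\<ell>(\<lambda>)\<close> is \<open>size lam\<close>.
\<close>

type_synonym ptn = "nat multiset"

text \<open>The partitions with \<open>|\<lambda>| + \<ell>(\<lambda>) \<le> n\<close>, which index the conjugacy classes of \<open>S\<^sub>n\<close>.\<close>

definition ptns :: "nat \<Rightarrow> ptn set" where
  "ptns n = {lam. 0 \<notin># lam \<and> \<Sum>\<^sub># lam + size lam \<le> n}"

definition cycle_type :: "nat \<Rightarrow> (nat \<Rightarrow> nat) \<Rightarrow> ptn" where
  "cycle_type n w = image_mset card (mset_set (orbit w ` {1..n}))"

definition modified_cycle_type :: "nat \<Rightarrow> (nat \<Rightarrow> nat) \<Rightarrow> ptn" where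
  "modified_cycle_type n w = image_mset (\<lambda>r. r - 1) (filter_mset (\<lambda>r. r > 1) (cycle_type n w))"

definition perm_class :: "nat \<Rightarrow> ptn \<Rightarrow> (nat \<Rightarrow> nat) set" where
  "perm_class n lam = {w \<in> Sym n. modified_cycle_type n w = lam}"

text \<open>An element of \<open>\<int>S\<^sub>n\<close> is given by its coefficient function, which is zero outside \<open>S\<^sub>n\<close>.\<close>

definition class_sum :: "nat \<Rightarrow> ptn \<Rightarrow> (nat \<Rightarrow> nat) \<Rightarrow> int" where
  "class_sum n lam = (\<lambda>w. if w \<in> perm_class n lam then 1 else 0)"


section \<open>The Iwahori--Hecke algebra\<close>

text \<open>
  With lists as the free monoid under concatenation, \<open>nat list \<Rightarrow>\<^sub>0 int poly\<close> is the free unital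
  \<open>\<int>[\<xi>]\<close>-algebra on generators indexed by \<^typ>\<open>nat\<close>.
\<close>

instantiation list :: (type) monoid_add
begin
definition zero_list :: "'a list" where "zero_list = []"
definition plus_list :: "'a list \<Rightarrow> 'a list \<Rightarrow> 'a list" where "plus_list xs ys = xs @ ys"
instance by standard (simp_all add: zero_list_def plus_list_def)
end

type_synonym free_elem = "nat list \<Rightarrow>\<^sub>0 int poly"
type_synonym hecke_elem = "free_elem set"

definition xi :: "int poly" where
  "xi = [:0, 1:]"

definition free_scalar :: "int poly \<Rightarrow> free_elem" where
  "free_scalar c = Poly_Mapping.single [] c"

definition free_gen :: "nat \<Rightarrow> free_elem" where
  "free_gen i = Poly_Mapping.single [i] 1"

definition free_alg :: "nat \<Rightarrow> free_elem ring" where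
  "free_alg n = \<lparr>carrier = {f. \<forall>u \<in> Poly_Mapping.keys f. set u \<subseteq> {1..<n}},
     mult = (*), one = 1, zero = 0, add = (+)\<rparr>"

definition hecke_relators :: "nat \<Rightarrow> free_elem set" where
  "hecke_relators n =
     {free_gen i * free_gen (i + 1) * free_gen i - free_gen (i + 1) * free_gen i * free_gen (i + 1)
       | i. i \<in> {1..<n} \<and> i + 1 \<in> {1..<n}}
   \<union> {free_gen i * free_gen j - free_gen j * free_gen i
       | i j. i \<in> {1..<n} \<and> j \<in> {1..<n} \<and> \<bar>int i - int j\<bar> > 1}
   \<union> {free_gen i * free_gen i - (1 + free_scalar xi * free_gen i) | i. i \<in> {1..<n}}"

definition hecke_ideal :: "nat \<Rightarrow> free_elem set" where
  "hecke_ideal n = Idl\<^bsub>free_alg n\<^esub> (hecke_relators n)"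

definition hecke :: "nat \<Rightarrow> hecke_elem ring" where
  "hecke n = free_alg n Quot hecke_ideal n"

text \<open>
  \<^const>\<open>genideal\<close> and \<^const>\<open>FactRing\<close> are only meaningful over a ring and for a set of
  relators inside its carrier (the ideals of HOL-Algebra are two-sided).
\<close>

lemma free_alg_mult_closed:
  assumes "x \<in> carrier (free_alg n)" "y \<in> carrier (free_alg n)"
  shows "x * y \<in> carrier (free_alg n)"
proof -
  have "set u \<subseteq> {1..<n}" if u: "u \<in> Poly_Mapping.keys (x * y)" for u
  proof -
    obtain a b where "u = a + b" "a \<in> Poly_Mapping.keys x" "b \<in> Poly_Mapping.keys y"
      using u keys_mult[of x y] by blast
    then show ?thesis
      using assms by (auto simp: free_alg_def plus_list_def)
  qed
  then show ?thesis by (simp add: free_alg_def)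
qed

lemma free_alg_add_closed:
  assumes "x \<in> carrier (free_alg n)" "y \<in> carrier (free_alg n)"
  shows "x + y \<in> carrier (free_alg n)"
  using assms Poly_Mapping.keys_add[of x y] by (fastforce simp: free_alg_def)

lemma free_alg_uminus_closed:
  assumes "x \<in> carrier (free_alg n)"
  shows "- x \<in> carrier (free_alg n)"
  using assms by (simp add: free_alg_def)

lemma free_alg_one_closed: "1 \<in> carrier (free_alg n)"
  by (simp add: free_alg_def zero_list_def)

lemma ring_free_alg: "ring (free_alg n)"
proof -
  have sel: "mult (free_alg n) = (*)" "one (free_alg n) = 1" "add (free_alg n) = (+)"
      "zero (free_alg n) = 0"
    by (simp_all add: free_alg_def)
  have zero: "0 \<in> carrier (free_alg n)"
    by (simp add: free_alg_def)
  have "\<exists>y\<in>carrier (free_alg n). y + x = 0" if "x \<in> carrier (free_alg n)" for x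
    using free_alg_uminus_closed[OF that] by (intro bexI[of _ "- x"]) simp_all
  then have "abelian_group (free_alg n)"
    by (intro abelian_groupI; unfold sel)
      (simp_all add: free_alg_add_closed zero add.assoc add.commute)
  moreover have "Group.monoid (free_alg n)"
    by (intro Group.monoidI; unfold sel)
      (simp_all add: free_alg_mult_closed free_alg_one_closed mult.assoc)
  ultimately show ?thesis
    by (intro ringI; (unfold sel)?) (simp_all add: distrib_left distrib_right)
qed

lemma hecke_relators_carrier: "hecke_relators n \<subseteq> carrier (free_alg n)"
proof -
  have gen: "free_gen i \<in> carrier (free_alg n)" if "i \<in> {1..<n}" for i
    using that by (auto simp: free_alg_def free_gen_def)
  have scal: "free_scalar c \<in> carrier (free_alg n)" for c
    by (auto simp: free_alg_def free_scalar_def)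
  have diff: "x - y \<in> carrier (free_alg n)"
    if "x \<in> carrier (free_alg n)" "y \<in> carrier (free_alg n)" for x y
    using free_alg_add_closed[OF that(1) free_alg_uminus_closed[OF that(2)]] by simp
  show ?thesis
    unfolding hecke_relators_def
    by (auto intro!: diff free_alg_mult_closed free_alg_add_closed free_alg_one_closed gen scal)
qed

lemma ideal_hecke_ideal: "ideal (hecke_ideal n) (free_alg n)"
  unfolding hecke_ideal_def
  by (rule ring.genideal_ideal[OF ring_free_alg hecke_relators_carrier])

lemma ring_hecke: "ring (hecke n)"
  unfolding hecke_def by (rule ideal.quotient_is_ring[OF ideal_hecke_ideal])

definition hecke_class :: "nat \<Rightarrow> free_elem \<Rightarrow> hecke_elem" where
  "hecke_class n f = hecke_ideal n +>\<^bsub>free_alg n\<^esub> f"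

definition hecke_gen :: "nat \<Rightarrow> nat \<Rightarrow> hecke_elem" where
  "hecke_gen n i = hecke_class n (free_gen i)"

definition hecke_smult :: "nat \<Rightarrow> int poly \<Rightarrow> hecke_elem \<Rightarrow> hecke_elem" where
  "hecke_smult n c z = hecke_class n (free_scalar c) \<otimes>\<^bsub>hecke n\<^esub> z"

text \<open>By Matsumoto's theorem, \<open>T\<^sub>w\<close> does not depend on the chosen reduced expression.\<close>

definition hecke_T :: "nat \<Rightarrow> (nat \<Rightarrow> nat) \<Rightarrow> hecke_elem" where
  "hecke_T n w = foldr (\<lambda>i z. hecke_gen n i \<otimes>\<^bsub>hecke n\<^esub> z)
     (SOME is. reduced_expression n is w) \<one>\<^bsub>hecke n\<^esub>"

text \<open>The coefficients of \<open>z\<close> in the basis \<open>(T\<^sub>w)\<close>, extended by zero outside \<open>S\<^sub>n\<close>.\<close>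

definition T_coeff :: "nat \<Rightarrow> hecke_elem \<Rightarrow> (nat \<Rightarrow> nat) \<Rightarrow> int poly" where
  "T_coeff n z = (THE a. (\<forall>w. w \<notin> Sym n \<longrightarrow> a w = 0) \<and>
     z = finsum (hecke n) (\<lambda>w. hecke_smult n (a w) (hecke_T n w)) (Sym n))"

definition specialize0 :: "nat \<Rightarrow> hecke_elem \<Rightarrow> (nat \<Rightarrow> nat) \<Rightarrow> int" where
  "specialize0 n z = (\<lambda>w. poly (T_coeff n z w) 0)"

definition hecke_center :: "nat \<Rightarrow> hecke_elem set" where
  "hecke_center n = {z \<in> carrier (hecke n).
     \<forall>y \<in> carrier (hecke n). z \<otimes>\<^bsub>hecke n\<^esub> y = y \<otimes>\<^bsub>hecke n\<^esub> z}"


section \<open>Geck--Rouquier class elements\<close>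

text \<open>
  The characterization of \<open>\<Gamma>\<^sub>\<lambda>(n)\<close> among the elements of the center: specialization to the
  class sum at \<open>\<xi> = 0\<close>, and vanishing of the coefficients of \<open>\<Gamma>\<^sub>\<lambda>(n) - \<Sum> T\<^sub>w\<close> (sum over the
  class) at all elements of minimal length in their conjugacy class.
\<close>

definition is_geck_rouquier :: "nat \<Rightarrow> ptn \<Rightarrow> hecke_elem \<Rightarrow> bool" where
  "is_geck_rouquier n lam z \<longleftrightarrow>
     z \<in> hecke_center n \<and>
     specialize0 n z = class_sum n lam \<and>
     (\<forall>w \<in> Sym n. min_length_in_class n w \<longrightarrow>
        T_coeff n (z \<ominus>\<^bsub>hecke n\<^esub> finsum (hecke n) (hecke_T n) (perm_class n lam)) w = 0)"

text \<open>
  The zero polynomial is both even and odd, so the parity of a polynomial determines the parity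
  of an integer only when the polynomial is nonzero.
\<close>

definition even_poly :: "int poly \<Rightarrow> bool" where
  "even_poly p \<longleftrightarrow> (\<forall>i. coeff p i \<noteq> 0 \<longrightarrow> even i)"

definition odd_poly :: "int poly \<Rightarrow> bool" where
  "odd_poly p \<longleftrightarrow> (\<forall>i. coeff p i \<noteq> 0 \<longrightarrow> odd i)"

end

theory Submission
  imports Defs "HOL-Combinatorics.Perm"
begin

text \<open>
  Pairing a central element with the identity coefficient gives a trace function on \<open>H\<^sub>n\<close>. Such a
  function is determined by its values on the Coxeter elements of parabolic subgroups, since every
  \<open>T\<^sub>w\<close> reduces modulo commutators to an \<open>\<nat>[\<xi>]\<close>-combination of these with controlled parity.
  Hence the class elements have positive coefficients, and \<open>k\<close> is the coefficient of
  \<open>\<Gamma>\<^sub>\<lambda> \<Gamma>\<^sub>\<mu>\<close> at a Coxeter element of type \<open>\<nu>\<close>, which gives positivity and parity.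

  For the degree bound, a polynomial of degree \<open>r\<close> in the Jucys--Murphy elements \<open>L\<^sub>i\<close> vanishes at
  Coxeter elements of length \<open>> r\<close>, because the conditional expectation onto \<open>H\<^sub>n\<^sub>-\<^sub>1\<close> lowers the degree.
  Modulo \<open>\<xi>\<close>, products of power sums in the \<open>L\<^sub>i\<close> are triangular with respect to the class elements, so
  up to a nonzero integer factor \<open>\<Gamma>\<^sub>\<lambda>\<close> is \<open>\<xi>\<close>-adically such a polynomial of degree \<open>|\<lambda>|\<close>. Passing from
  \<open>n\<close> to \<open>n + 1\<close> changes it only by terms of lower degree and multiples of \<open>L\<^sub>n\<^sub>+\<^sub>1\<close>, neither of which is
  visible in top degree; this is the stability of \<open>k\<close>.
\<close>

section \<open>The Hecke algebra of the finitary symmetric group\<close>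

hide_const (open) Perm.orbit Perm.order

text \<open>The presentation does not reveal that the T_w are linearly independent, so coefficients
  are computed in a concrete model, into which the presented algebra is shown to embed. The class
  elements enter through their centrality and their coefficients at Coxeter elements, which are 0 or
  1 because these elements have minimal length in their classes. The obstacle is the degree bound:
  no explicit formula for a class element is at hand from which its degree in the Jucys--Murphy
  elements could be read. It has to come from inverting the expansion of power sum products into
  class elements. That matrix is triangular only modulo \<xi>, and its diagonal entries are nonzero
  integers that need not be 1; hence the inverse is taken up to an integer factor and up to an
  arbitrarily high power of \<xi>. Nothing is lost, because the conclusions are equations in a
  polynomial ring over the integers, where such a factor cancels and only zero is divisible by all
  powers of \<xi>.\<close>

abbreviation tr :: "nat \<Rightarrow> nat perm" where
  "tr i \<equiv> Perm.swap i (Suc i)"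

lemma apply_tr: "apply (tr i) = Transposition.transpose i (Suc i)"
  by (simp add: swap.rep_eq)

lemma apply_mult [simp]: "apply (u * v) x = apply u (apply v x)"
  by (simp add: apply_times)

lemma apply_inverse_cancel [simp]:
  "apply (inverse w) (apply w x) = x" "apply w (apply (inverse w) x) = x"
  by (simp_all add: apply_sequence)

lemma tr_mult_self [simp]: "tr i * (tr i * w) = w" "w * tr i * tr i = w"
  by (simp_all add: mult.assoc [symmetric] del: swap_self, simp_all add: mult.assoc)

lemma apply_tr_tr [simp]: "apply (tr i) (apply (tr i) x) = x"
  by (simp add: apply_tr)

definition right_descent :: "nat perm \<Rightarrow> nat \<Rightarrow> bool" where
  "right_descent w i \<longleftrightarrow> apply w (Suc i) < apply w i"

lemma right_descent_mult_tr: "right_descent (w * tr i) i \<longleftrightarrow> \<not> right_descent w i"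
proof -
  have "apply w i \<noteq> apply w (Suc i)"
    by (simp add: apply_inj)
  then show ?thesis
    by (auto simp: right_descent_def)
qed

section \<open>The regular representation on coefficient functions\<close>

type_synonym perm_module = "nat perm \<Rightarrow>\<^sub>0 int poly"

text \<open>Left multiplication by T_i, read on coefficient functions: T_i T_w is the basis element
  of s_i w, plus \<xi> T_w when s_i is a left descent of w. Left descents of \<open>w\<close> are
  right descents of \<open>inverse w\<close>.\<close>

lift_definition left_op :: "nat \<Rightarrow> perm_module \<Rightarrow> perm_module" is
  "\<lambda>i v w. v (tr i * w) + (if right_descent (inverse w) i then xi * v w else 0)"
proof -
  fix i and v :: "nat perm \<Rightarrow> int poly"
  assume fin: "finite {w. v w \<noteq> 0}"
  have "{w. v (tr i * w) + (if right_descent (inverse w) i then xi * v w else 0) \<noteq> 0}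
     \<subseteq> (\<lambda>w. tr i * w) ` {w. v w \<noteq> 0} \<union> {w. v w \<noteq> 0}"
  proof
    fix w
    assume "w \<in> {w. v (tr i * w) + (if right_descent (inverse w) i then xi * v w else 0) \<noteq> 0}"
    then have "v (tr i * w) \<noteq> 0 \<or> v w \<noteq> 0"
      by (auto split: if_splits)
    then show "w \<in> (\<lambda>w. tr i * w) ` {w. v w \<noteq> 0} \<union> {w. v w \<noteq> 0}"
      by (auto intro: image_eqI [of _ _ "tr i * w"])
  qed
  then show "finite {w. v (tr i * w) + (if right_descent (inverse w) i then xi * v w else 0) \<noteq> 0}"
    by (rule finite_subset) (simp add: fin)
qed

lift_definition right_op :: "nat \<Rightarrow> perm_module \<Rightarrow> perm_module" is
  "\<lambda>i v w. v (w * tr i) + (if right_descent w i then xi * v w else 0)"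
proof -
  fix i and v :: "nat perm \<Rightarrow> int poly"
  assume fin: "finite {w. v w \<noteq> 0}"
  have "{w. v (w * tr i) + (if right_descent w i then xi * v w else 0) \<noteq> 0}
     \<subseteq> (\<lambda>w. w * tr i) ` {w. v w \<noteq> 0} \<union> {w. v w \<noteq> 0}"
  proof
    fix w
    assume "w \<in> {w. v (w * tr i) + (if right_descent w i then xi * v w else 0) \<noteq> 0}"
    then have "v (w * tr i) \<noteq> 0 \<or> v w \<noteq> 0"
      by (auto split: if_splits)
    then show "w \<in> (\<lambda>w. w * tr i) ` {w. v w \<noteq> 0} \<union> {w. v w \<noteq> 0}"
      by (auto intro: image_eqI [of _ _ "w * tr i"])
  qed
  then show "finite {w. v (w * tr i) + (if right_descent w i then xi * v w else 0) \<noteq> 0}"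
    by (rule finite_subset) (simp add: fin)
qed

lift_definition vscale :: "int poly \<Rightarrow> perm_module \<Rightarrow> perm_module" is
  "\<lambda>(c :: int poly) (v :: nat perm \<Rightarrow> int poly) w. c * v w"
  by (erule finite_subset [rotated]) auto

lemmas lookup_ops = left_op.rep_eq right_op.rep_eq vscale.rep_eq lookup_add lookup_minus

text \<open>
  The two operators interfere only when \<open>s\<^sub>i w = w s\<^sub>j\<close>, and then both descent conditions flip
  simultaneously.
\<close>

lemma left_op_right_op: "left_op i (right_op j v) = right_op j (left_op i v)"
proof (rule poly_mapping_eqI)
  fix w
  let ?c = "{apply (inverse w) i, apply (inverse w) (Suc i)} = {j, Suc j}"
  have dl: "right_descent (inverse (w * tr j)) i \<longleftrightarrow> right_descent (inverse w) i \<noteq> ?c"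
  proof -
    let ?a = "apply (inverse w) i" and ?b = "apply (inverse w) (Suc i)"
    have ne: "?a \<noteq> ?b"
      by (simp add: apply_inj)
    show ?thesis
      using ne unfolding right_descent_def
      by (auto simp: apply_tr Transposition.transpose_def doubleton_eq_iff)
  qed
  have dr: "right_descent (tr i * w) j \<longleftrightarrow> right_descent w j \<noteq> ({apply w j, apply w (Suc j)} = {i, Suc i})"
  proof -
    let ?a = "apply w j" and ?b = "apply w (Suc j)"
    have ne: "?a \<noteq> ?b"
      by (simp add: apply_inj)
    show ?thesis
      using ne unfolding right_descent_def
      by (auto simp: apply_tr Transposition.transpose_def doubleton_eq_iff)
  qed
  have inv_iff: "apply (inverse w) a = b \<longleftrightarrow> apply w b = a" for a b
    by auto
  have c: "({apply w j, apply w (Suc j)} = {i, Suc i}) = ?c"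
    by (auto simp: doubleton_eq_iff inv_iff)
  show "Poly_Mapping.lookup (left_op i (right_op j v)) w = Poly_Mapping.lookup (right_op j (left_op i v)) w"
  proof (cases ?c)
    case False
    then show ?thesis
      using dl dr c by (simp add: lookup_ops mult.assoc distrib_left mult.left_commute)
  next
    case True
    have cases: "apply w j = i \<and> apply w (Suc j) = Suc i \<or> apply w j = Suc i \<and> apply w (Suc j) = i"
      using True by (auto simp: doubleton_eq_iff inv_iff)
    have eq: "tr i * w = w * tr j"
    proof (rule perm_eqI)
      fix x
      note cases
      moreover have "apply w x \<noteq> i \<and> apply w x \<noteq> Suc i" if "x \<noteq> j" "x \<noteq> Suc j"
        using that calculation by (metis apply_inj)
      ultimately show "apply (tr i * w) x = apply (w * tr j) x"
        by (cases "x = j \<or> x = Suc j") auto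
    qed
    moreover have "right_descent (inverse w) i \<longleftrightarrow> right_descent w j"
      using cases
    proof
      assume c: "apply w j = i \<and> apply w (Suc j) = Suc i"
      then have "apply (inverse w) i = j" "apply (inverse w) (Suc i) = Suc j"
        unfolding inv_iff by simp_all
      with c show ?thesis
        by (simp add: right_descent_def)
    next
      assume c: "apply w j = Suc i \<and> apply w (Suc j) = i"
      then have "apply (inverse w) (Suc i) = j" "apply (inverse w) i = Suc j"
        unfolding inv_iff by simp_all
      with c show ?thesis
        by (simp add: right_descent_def)
    qed
    moreover have "tr i * (w * tr j) = w"
      by (simp add: eq [symmetric])
    ultimately show ?thesis
      using True dl dr c eq by (simp add: lookup_ops)
  qed
qed

lemma left_op_add: "left_op i (u + v) = left_op i u + left_op i v"
  by (rule poly_mapping_eqI) (simp add: lookup_ops algebra_simps)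

lemma right_op_add: "right_op i (u + v) = right_op i u + right_op i v"
  by (rule poly_mapping_eqI) (simp add: lookup_ops algebra_simps)

lemma left_op_vscale: "left_op i (vscale c v) = vscale c (left_op i v)"
  by (rule poly_mapping_eqI) (simp add: lookup_ops algebra_simps)

lemma right_op_vscale: "right_op i (vscale c v) = vscale c (right_op i v)"
  by (rule poly_mapping_eqI) (simp add: lookup_ops algebra_simps)

lemma vscale_add: "vscale c (u + v) = vscale c u + vscale c v"
  by (rule poly_mapping_eqI) (simp add: lookup_ops algebra_simps)

lemma vscale_vscale: "vscale c (vscale d v) = vscale (c * d) v"
  by (rule poly_mapping_eqI) (simp add: lookup_ops algebra_simps)

definition right_equivariant :: "(perm_module \<Rightarrow> perm_module) \<Rightarrow> bool" where
  "right_equivariant X \<longleftrightarrow> (\<forall>u v. X (u + v) = X u + X v) \<and> (\<forall>c v. X (vscale c v) = vscale c (X v))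
     \<and> (\<forall>j v. X (right_op j v) = right_op j (X v))"

text \<open>
  The Hecke algebra of the finitary symmetric group of all natural numbers, realized as the
  commutant of the right regular operators; all \<open>H\<^sub>n\<close> are subalgebras of it.
\<close>

typedef hecke_fin = "{X :: perm_module \<Rightarrow> perm_module. right_equivariant X}"
  by (rule exI [of _ id]) (simp add: right_equivariant_def)

setup_lifting type_definition_hecke_fin

instantiation hecke_fin :: ring_1
begin

lift_definition zero_hecke_fin :: hecke_fin is "\<lambda>v. 0"
  unfolding right_equivariant_def by (simp, intro conjI allI; rule poly_mapping_eqI; simp add: lookup_ops)

lift_definition one_hecke_fin :: hecke_fin is "\<lambda>v. v"
  by (simp add: right_equivariant_def)

lift_definition plus_hecke_fin :: "hecke_fin \<Rightarrow> hecke_fin \<Rightarrow> hecke_fin" is "\<lambda>X Y v. X v + Y v"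
  by (simp add: right_equivariant_def right_op_add vscale_add)

lift_definition uminus_hecke_fin :: "hecke_fin \<Rightarrow> hecke_fin" is "\<lambda>X v. - X v"
  unfolding right_equivariant_def by (simp, intro conjI allI; rule poly_mapping_eqI; simp add: lookup_ops)

lift_definition minus_hecke_fin :: "hecke_fin \<Rightarrow> hecke_fin \<Rightarrow> hecke_fin" is "\<lambda>X Y v. X v - Y v"
  unfolding right_equivariant_def
  by (simp, intro conjI allI; rule poly_mapping_eqI; simp add: lookup_ops algebra_simps)

lift_definition times_hecke_fin :: "hecke_fin \<Rightarrow> hecke_fin \<Rightarrow> hecke_fin" is "\<lambda>X Y v. X (Y v)"
  by (simp add: right_equivariant_def)

instance
proof
  show "(0::hecke_fin) \<noteq> 1"
  proof transfer
    show "(\<lambda>v. 0) \<noteq> (\<lambda>v :: perm_module. v)"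
      by (metis lookup_single_eq lookup_zero zero_neq_one)
  qed
qed (transfer; simp add: right_equivariant_def algebra_simps fun_eq_iff; fail)+

end

lift_definition T :: "nat \<Rightarrow> hecke_fin" is left_op
  by (simp add: right_equivariant_def left_op_add left_op_vscale left_op_right_op)

lift_definition scal :: "int poly \<Rightarrow> hecke_fin" is vscale
  by (simp add: right_equivariant_def vscale_add vscale_vscale right_op_vscale mult.commute)

definition basis_vec :: "nat perm \<Rightarrow> perm_module" where
  "basis_vec w = Poly_Mapping.single w 1"

text \<open>An operator commuting with the right action is determined by its value on the vector of
  the identity; that value lists its coefficients in the basis T_w.\<close>

definition coef :: "hecke_fin \<Rightarrow> nat perm \<Rightarrow> int poly" where
  "coef x w = Poly_Mapping.lookup (Rep_hecke_fin x (basis_vec 1)) w"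

lemmas rep_hecke_fin_simps = plus_hecke_fin.rep_eq uminus_hecke_fin.rep_eq minus_hecke_fin.rep_eq times_hecke_fin.rep_eq
  zero_hecke_fin.rep_eq one_hecke_fin.rep_eq T.rep_eq scal.rep_eq

lemma scal_commute: "scal c * x = x * scal c"
  by transfer (simp add: right_equivariant_def)

lemma scal_add: "scal (a + b) = scal a + scal b"
  by (transfer, rule ext, rule poly_mapping_eqI) (simp add: lookup_ops algebra_simps)

lemma scal_mult: "scal (a * b) = scal a * scal b"
  by (transfer, rule ext, rule poly_mapping_eqI) (simp add: lookup_ops algebra_simps)

lemma scal_0 [simp]: "scal 0 = 0"
  by (transfer, rule ext, rule poly_mapping_eqI) (simp add: lookup_ops algebra_simps)

lemma scal_1 [simp]: "scal 1 = 1"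
  by (transfer, rule ext, rule poly_mapping_eqI) (simp add: lookup_ops algebra_simps)

lemma scal_minus: "scal (- a) = - scal a"
  by (transfer, rule ext, rule poly_mapping_eqI) (simp add: lookup_ops algebra_simps)

lemma coef_add [simp]: "coef (x + y) w = coef x w + coef y w"
  by (simp add: coef_def rep_hecke_fin_simps lookup_ops)

lemma coef_diff [simp]: "coef (x - y) w = coef x w - coef y w"
  by (simp add: coef_def rep_hecke_fin_simps lookup_ops)

lemma coef_uminus [simp]: "coef (- x) w = - coef x w"
  by (simp add: coef_def rep_hecke_fin_simps)

lemma coef_0 [simp]: "coef 0 w = 0"
  by (simp add: coef_def rep_hecke_fin_simps)

lemma coef_sum [simp]: "coef (\<Sum>i\<in>I. f i) w = (\<Sum>i\<in>I. coef (f i) w)"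
  by (induction I rule: infinite_finite_induct) simp_all

lemma coef_scal [simp]: "coef (scal c * x) w = c * coef x w"
  by (simp add: coef_def rep_hecke_fin_simps lookup_ops)

lemma coef_1: "coef 1 w = (if w = 1 then 1 else 0)"
  by (simp add: coef_def rep_hecke_fin_simps basis_vec_def lookup_single when_def)

lemma coef_T_mult: "coef (T i * x) w = coef x (tr i * w) + (if right_descent (inverse w) i then xi * coef x w else 0)"
  by (simp add: coef_def rep_hecke_fin_simps lookup_ops)

lemma finite_coef: "finite {w. coef x w \<noteq> 0}"
  by (simp add: coef_def)

lemma tr_mult_eq_1_iff: "tr i * w = 1 \<longleftrightarrow> w = tr i" "w * tr i = 1 \<longleftrightarrow> w = tr i"
  by (metis tr_mult_self mult.left_neutral mult.right_neutral)+

text \<open>Both operators send the vector of the identity to that of s_i. With equivariance this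
  turns right multiplication by \<open>T i\<close> into \<open>right_op i\<close> on
  coefficients.\<close>

lemma left_op_basis_vec_1: "left_op i (basis_vec 1) = right_op i (basis_vec 1)"
proof (rule poly_mapping_eqI)
  fix w
  have "(1 = tr i * w) = (1 = w * tr i)"
    using tr_mult_eq_1_iff [where i = i and w = w] by auto
  then show "Poly_Mapping.lookup (left_op i (basis_vec 1)) w = Poly_Mapping.lookup (right_op i (basis_vec 1)) w"
    by (auto simp: basis_vec_def lookup_ops lookup_single when_def right_descent_def)
qed

lemma right_equivariantD:
  "Rep_hecke_fin x (u + v) = Rep_hecke_fin x u + Rep_hecke_fin x v"
  "Rep_hecke_fin x (vscale c v) = vscale c (Rep_hecke_fin x v)"
  "Rep_hecke_fin x (right_op j v) = right_op j (Rep_hecke_fin x v)"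
  using Rep_hecke_fin [of x] by (auto simp: right_equivariant_def)

lemma coef_mult_T: "coef (x * T i) w = coef x (w * tr i) + (if right_descent w i then xi * coef x w else 0)"
  by (simp add: coef_def rep_hecke_fin_simps left_op_basis_vec_1 right_equivariantD lookup_ops)

section \<open>Inversions and descents\<close>

definition inversions :: "nat perm \<Rightarrow> (nat \<times> nat) set" where
  "inversions w = {(a, b). a < b \<and> apply w b < apply w a}"

definition inv_num :: "nat perm \<Rightarrow> nat" where
  "inv_num w = card (inversions w)"

lemma affected_tr: "affected (tr i) = {i, Suc i}"
  by (simp add: affected_swap)

lemma finite_inversions: "finite (inversions w)"
proof -
  obtain N where N: "\<forall>a\<in>affected w. a \<le> N"
    using finite_affected [of w] by (meson finite_nat_set_iff_bounded_le)
  have fixd: "apply w a = a" if "N < a" for a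
    using N that by (metis in_affected not_less)
  have "inversions w \<subseteq> {..N} \<times> {..N}"
  proof (clarsimp simp: inversions_def)
    fix a b assume ab: "a < b" "apply w b < apply w a"
    have "b \<le> N"
    proof (rule ccontr)
      assume "\<not> b \<le> N"
      then have "apply w b = b"
        by (intro fixd) simp
      then have "apply w (apply w a) = apply w a" "apply w a > a"
        using ab \<open>\<not> b \<le> N\<close> by (auto intro: fixd)
      then show False
        by (simp add: apply_inj)
    qed
    then show "a \<le> N \<and> b \<le> N"
      using ab by simp
  qed
  then show ?thesis
    by (rule finite_subset) simp
qed

text \<open>Exchanging i and i + 1 in both entries matches the inversions of \<open>w * tr i\<close>
  with those of \<open>w\<close> other than (i, i + 1).\<close>

lemma inv_num_right_descent:
  assumes "right_descent w i"
  shows "inv_num w = Suc (inv_num (w * tr i))"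
proof -
  let ?s = "apply (tr i)"
  let ?f = "\<lambda>(a, b). (?s a, ?s b)"
  have s: "?s a = (if a = i then Suc i else if a = Suc i then i else a)" for a
    by (simp add: apply_tr Transposition.transpose_def)
  have inj: "inj ?f"
    by (auto simp: inj_on_def apply_inj)
  have "?f ` inversions (w * tr i) = inversions w - {(i, Suc i)}"
  proof safe
    fix a b assume ab: "(a, b) \<in> inversions (w * tr i)"
    have "(a, b) \<noteq> (i, Suc i)"
      using ab assms by (auto simp: inversions_def right_descent_def)
    then have "?s a < ?s b"
      using ab by (auto simp: inversions_def s split: if_splits)
    then show "(?s a, ?s b) \<in> inversions w"
      using ab by (auto simp: inversions_def)
  next
    fix a b assume ab: "(a, b) \<in> inversions (w * tr i)" "?s a = i" "?s b = Suc i"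
    then show False
      by (auto simp: s inversions_def split: if_splits)
  next
    fix a b assume ab: "(a, b) \<in> inversions w" "\<not> (a, b) \<in> ?f ` inversions (w * tr i)"
    have "(?s a, ?s b) \<notin> inversions (w * tr i)"
    proof
      assume "(?s a, ?s b) \<in> inversions (w * tr i)"
      then have "?f (?s a, ?s b) \<in> ?f ` inversions (w * tr i)"
        by blast
      with ab show False
        by simp
    qed
    then have "\<not> ?s a < ?s b"
      using ab by (auto simp: inversions_def)
    then show "a = i"
      using ab by (auto simp: s inversions_def split: if_splits)
  next
    fix a b assume ab: "(a, b) \<in> inversions w" "\<not> (a, b) \<in> ?f ` inversions (w * tr i)"
    have "(?s a, ?s b) \<notin> inversions (w * tr i)"
    proof
      assume "(?s a, ?s b) \<in> inversions (w * tr i)"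
      then have "?f (?s a, ?s b) \<in> ?f ` inversions (w * tr i)"
        by blast
      with ab show False
        by simp
    qed
    then have "\<not> ?s a < ?s b"
      using ab by (auto simp: inversions_def)
    then show "b = Suc i"
      using ab by (auto simp: s inversions_def split: if_splits)
  qed
  moreover have "(i, Suc i) \<in> inversions w"
    using assms by (auto simp: inversions_def right_descent_def)
  moreover have "card (?f ` inversions (w * tr i)) = inv_num (w * tr i)"
    unfolding inv_num_def by (rule card_image) (rule inj_on_subset [OF inj], simp)
  ultimately show ?thesis
    by (metis card_Suc_Diff1 finite_inversions inv_num_def)
qed

lemma inv_num_asc:
  assumes "\<not> right_descent w i"
  shows "inv_num (w * tr i) = Suc (inv_num w)"
  using inv_num_right_descent [of "w * tr i" i] assms by (simp add: right_descent_mult_tr)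

lemma inv_num_1 [simp]: "inv_num 1 = 0"
  by (simp add: inv_num_def inversions_def less_asym cong: conj_cong)

lemma odd_inv_num_mult_tr: "odd (inv_num (w * tr i)) \<longleftrightarrow> \<not> odd (inv_num w)"
  using inv_num_asc [of w i] inv_num_right_descent [of w i] by (cases "right_descent w i") auto

section \<open>Finite symmetric groups and induction along reduced words\<close>

definition in_Sym :: "nat \<Rightarrow> nat perm \<Rightarrow> bool" where
  "in_Sym n w \<longleftrightarrow> affected w \<subseteq> {1..n}"

lemma in_Sym_1 [simp]: "in_Sym n 1"
  by (simp add: in_Sym_def)

lemma in_Sym_mult: "in_Sym n u \<Longrightarrow> in_Sym n v \<Longrightarrow> in_Sym n (u * v)"
  unfolding in_Sym_def by (rule order_trans [OF affected_times Un_least])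

lemma in_Sym_inverse [simp]: "in_Sym n (inverse w) = in_Sym n w"
  by (simp add: in_Sym_def)

lemma in_Sym_mono: "in_Sym m w \<Longrightarrow> m \<le> n \<Longrightarrow> in_Sym n w"
  by (fastforce simp: in_Sym_def)

lemma in_Sym_tr [simp]: "in_Sym n (tr i) \<longleftrightarrow> 1 \<le> i \<and> i < n"
  by (auto simp: in_Sym_def affected_tr)

lemma in_Sym_mult_tr [simp]: "1 \<le> i \<Longrightarrow> i < n \<Longrightarrow> in_Sym n (w * tr i) = in_Sym n w"
  by (metis in_Sym_mult in_Sym_tr tr_mult_self(2))

lemma in_Sym_tr_mult [simp]: "1 \<le> i \<Longrightarrow> i < n \<Longrightarrow> in_Sym n (tr i * w) = in_Sym n w"
  by (metis in_Sym_mult in_Sym_tr tr_mult_self(1))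

lemma in_Sym_apply: "in_Sym n w \<Longrightarrow> x \<in> {1..n} \<Longrightarrow> apply w x \<in> {1..n}"
  unfolding in_Sym_def by (metis apply_affected in_affected subsetD)

lemma in_Sym_fixes: "in_Sym n w \<Longrightarrow> x \<notin> {1..n} \<Longrightarrow> apply w x = x"
  unfolding in_Sym_def by (metis in_affected subsetD)

lemma in_Sym_right_descent_imp: "in_Sym n w \<Longrightarrow> right_descent w i \<Longrightarrow> 1 \<le> i \<and> i < n"
proof -
  assume w: "in_Sym n w" and d: "right_descent w i"
  show ?thesis
  proof (rule ccontr)
    assume i: "\<not> ?thesis"
    show False
    proof (cases "i = 0")
      case True
      then show ?thesis
        using d w in_Sym_fixes [of n w 0] by (simp add: right_descent_def)
    next
      case False
      then have "i \<ge> n"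
        using i by auto
      then have "apply w (Suc i) = Suc i" "apply w i \<le> i"
        using w in_Sym_fixes [of n w "Suc i"] in_Sym_fixes [of n w i] in_Sym_apply [of n w i] False
        by (auto simp: not_le) (cases "i = n"; force)
      then show False
        using d by (simp add: right_descent_def)
    qed
  qed
qed

text \<open>Without descents \<open>w\<close> is strictly increasing, and so is its inverse; both
  then lie above the identity function, which forces equality.\<close>

lemma exists_right_descent:
  assumes "w \<noteq> 1"
  shows "\<exists>i. right_descent w i"
proof (rule ccontr)
  assume "\<not> ?thesis"
  then have "apply w i < apply w (Suc i)" for i
    by (metis apply_inj right_descent_def less_linear n_not_Suc_n)
  then have mono: "strict_mono (apply w)"
    by (simp add: strict_mono_Suc_iff)
  have "apply (inverse w) x \<ge> x" for x
  proof -
    have "strict_mono (apply (inverse w))"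
      using mono by (metis apply_inverse_cancel(2) strict_mono_less strict_monoI)
    then show ?thesis
      by (rule strict_mono_imp_increasing)
  qed
  moreover have "apply w x \<ge> x" for x
    using mono by (rule strict_mono_imp_increasing)
  ultimately have "apply w x = x" for x
    by (metis apply_inverse_cancel(1) le_antisym)
  then show False
    using assms by (auto intro: perm_eqI)
qed

text \<open>Removing a right descent lowers \<open>inv_num\<close>, so the induction runs along
  reduced words, whose letters stay in the range of S_n.\<close>

lemma in_Sym_induct [consumes 1, case_names one step]:
  assumes "in_Sym n w"
    and "P 1"
    and step: "\<And>w i. in_Sym n w \<Longrightarrow> 1 \<le> i \<Longrightarrow> i < n \<Longrightarrow> \<not> right_descent w i \<Longrightarrow> P w \<Longrightarrow> P (w * tr i)"
  shows "P w"
  using assms(1)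
proof (induction "inv_num w" arbitrary: w rule: less_induct)
  case less
  show ?case
  proof (cases "w = 1")
    case True
    then show ?thesis using assms(2) by simp
  next
    case False
    then obtain i where i: "right_descent w i"
      using exists_right_descent by blast
    then have ii: "1 \<le> i" "i < n"
      using in_Sym_right_descent_imp less.prems by auto
    have "P (w * tr i)"
      using less inv_num_right_descent [OF i] ii by simp
    then have "P (w * tr i * tr i)"
      using step [of "w * tr i" i] ii less.prems i by (simp add: right_descent_mult_tr)
    then show ?thesis
      by simp
  qed
qed

lemma perm_asc_induct [case_names one step]:
  assumes "P 1"
    and step: "\<And>w i. \<not> right_descent w i \<Longrightarrow> P w \<Longrightarrow> P (w * tr i)"
  shows "P w"
proof (induction "inv_num w" arbitrary: w rule: less_induct)
  case less
  show ?case
  proof (cases "w = 1")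
    case True
    then show ?thesis using assms(1) by simp
  next
    case False
    then obtain i where i: "right_descent w i"
      using exists_right_descent by blast
    have "P (w * tr i)"
      using less inv_num_right_descent [OF i] by simp
    then have "P (w * tr i * tr i)"
      by (rule step [rotated]) (simp add: i right_descent_mult_tr)
    then show ?thesis
      by simp
  qed
qed

section \<open>The basis T_w and the defining relations\<close>

lemma right_op_basis_vec: "\<not> right_descent w i \<Longrightarrow> right_op i (basis_vec w) = basis_vec (w * tr i)"
  by (rule poly_mapping_eqI) (auto simp: basis_vec_def lookup_ops lookup_single when_def)

lemma perm_module_expand: "v = (\<Sum>w\<in>Poly_Mapping.keys v. vscale (Poly_Mapping.lookup v w) (basis_vec w))"
  by (rule poly_mapping_eqI)
    (simp add: lookup_sum lookup_ops basis_vec_def lookup_single when_def in_keys_iff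
      if_distrib [of "(*) _"] cong: if_cong)

lemma Rep_hecke_fin_sum: "Rep_hecke_fin x (\<Sum>i\<in>I. f i) = (\<Sum>i\<in>I. Rep_hecke_fin x (f i))"
proof (induction I rule: infinite_finite_induct)
  case empty
  have "Rep_hecke_fin x (0 + 0) = Rep_hecke_fin x 0 + Rep_hecke_fin x 0"
    by (rule right_equivariantD)
  then show ?case by simp
next
  case (infinite I)
  have "Rep_hecke_fin x (0 + 0) = Rep_hecke_fin x 0 + Rep_hecke_fin x 0"
    by (rule right_equivariantD)
  with infinite show ?case by simp
qed (simp add: right_equivariantD)

text \<open>Along an ascent \<open>right_op i\<close> carries one basis vector to the next, so
  agreement on the vector of the identity spreads to every basis vector.\<close>

lemma hecke_fin_eqI:
  assumes "\<And>w. coef x w = coef y w"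
  shows "x = y"
proof -
  have "Rep_hecke_fin x (basis_vec w) = Rep_hecke_fin y (basis_vec w)" for w
  proof (induction w rule: perm_asc_induct)
    case one
    show ?case
      using assms by (intro poly_mapping_eqI) (simp add: coef_def)
  next
    case (step w i)
    then show ?case
      by (metis right_equivariantD(3) right_op_basis_vec)
  qed
  then have "Rep_hecke_fin x v = Rep_hecke_fin y v" for v
    by (subst (1 2) perm_module_expand [of v]) (simp add: Rep_hecke_fin_sum right_equivariantD)
  then show ?thesis
    by (simp add: Rep_hecke_fin_inject [symmetric] fun_eq_iff)
qed

lemma exists_coef_delta: "\<exists>x. \<forall>v. coef x v = (if v = w then 1 else 0)"
proof (induction w rule: perm_asc_induct)
  case one
  show ?case
    by (rule exI [of _ 1]) (simp add: coef_1)
next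
  case (step w i)
  then obtain x where x: "\<And>v. coef x v = (if v = w then 1 else 0)"
    by blast
  have "coef (x * T i) v = (if v = w * tr i then 1 else 0)" for v
    using step(1) by (auto simp: coef_mult_T x)
  then show ?case
    by blast
qed

text \<open>Fixed by its coefficients instead of a reduced word, so independence of the word is
  built in; existence comes from multiplying along ascents, uniqueness from
  \<open>hecke_fin_eqI\<close>.\<close>

definition Tperm :: "nat perm \<Rightarrow> hecke_fin" where
  "Tperm w = (SOME x. \<forall>v. coef x v = (if v = w then 1 else 0))"

lemma coef_Tperm: "coef (Tperm w) v = (if v = w then 1 else 0)"
  using someI_ex [OF exists_coef_delta [of w]] by (simp add: Tperm_def)

lemma Tperm_1 [simp]: "Tperm 1 = 1"
  by (rule hecke_fin_eqI) (simp add: coef_Tperm coef_1)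

lemma Tperm_mult_T: "\<not> right_descent w i \<Longrightarrow> Tperm w * T i = Tperm (w * tr i)"
  by (rule hecke_fin_eqI) (auto simp: coef_mult_T coef_Tperm)

lemma T_mult_Tperm: "\<not> right_descent (inverse w) i \<Longrightarrow> T i * Tperm w = Tperm (tr i * w)"
proof (rule hecke_fin_eqI)
  fix v
  assume asc: "\<not> right_descent (inverse w) i"
  have "tr i * v = w \<longleftrightarrow> v = tr i * w"
    by auto
  then show "coef (T i * Tperm w) v = coef (Tperm (tr i * w)) v"
    using asc by (simp add: coef_T_mult coef_Tperm)
qed

lemma right_descent_1 [simp]: "\<not> right_descent 1 i"
  by (simp add: right_descent_def)

lemma T_eq_Tperm: "T i = Tperm (tr i)"
  using Tperm_mult_T [of 1 i] by simp

lemma hecke_fin_expand: "x = (\<Sum>w | coef x w \<noteq> 0. scal (coef x w) * Tperm w)"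
  by (rule hecke_fin_eqI) (simp add: coef_Tperm finite_coef if_distrib [of "(*) _"] cong: if_cong)

lemma apply_tr_eval: "apply (tr i) x = (if x = i then Suc i else if x = Suc i then i else x)"
  by (simp add: apply_tr Transposition.transpose_def)

lemma coef_T: "coef (T i) w = (if w = tr i then 1 else 0)"
  by (simp add: T_eq_Tperm coef_Tperm)

lemma tr_mult_eq_iff: "w * tr i = u \<longleftrightarrow> w = u * tr i"
  by auto

lemma T_quad: "T i * T i = 1 + scal xi * T i"
proof (rule hecke_fin_eqI)
  fix w
  have "w = tr i \<Longrightarrow> right_descent w i"
    by (simp add: right_descent_def)
  moreover have "coef (1 + scal xi * T i) w = (if w = 1 then 1 else 0) + xi * (if w = tr i then 1 else 0)"
    by (simp only: coef_add coef_scal coef_1 coef_T)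
  ultimately show "coef (T i * T i) w = coef (1 + scal xi * T i) w"
    by (auto simp: coef_mult_T [of "T i"] coef_T tr_mult_eq_iff)
qed

lemma T_braid: "T i * T (Suc i) * T i = T (Suc i) * T i * T (Suc i)"
proof -
  have "T i * T (Suc i) = Tperm (tr i * tr (Suc i))"
    unfolding T_eq_Tperm [of i] by (rule Tperm_mult_T) (simp add: right_descent_def apply_tr_eval)
  then have "T i * T (Suc i) * T i = Tperm (tr i * tr (Suc i) * tr i)"
    by (simp add: Tperm_mult_T right_descent_def apply_tr_eval)
  moreover have "T (Suc i) * T i = Tperm (tr (Suc i) * tr i)"
    unfolding T_eq_Tperm [of "Suc i"] by (rule Tperm_mult_T) (simp add: right_descent_def apply_tr_eval)
  then have "T (Suc i) * T i * T (Suc i) = Tperm (tr (Suc i) * tr i * tr (Suc i))"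
    by (simp add: Tperm_mult_T right_descent_def apply_tr_eval)
  moreover have "tr i * tr (Suc i) * tr i = tr (Suc i) * tr i * tr (Suc i)"
    by (rule perm_eqI) (simp add: apply_tr_eval)
  ultimately show ?thesis
    by simp
qed

lemma T_commute:
  assumes "Suc i < j \<or> Suc j < i"
  shows "T i * T j = T j * T i"
proof -
  have "T i * T j = Tperm (tr i * tr j)"
    unfolding T_eq_Tperm [of i] using assms by (intro Tperm_mult_T) (auto simp: right_descent_def apply_tr_eval)
  moreover have "T j * T i = Tperm (tr j * tr i)"
    unfolding T_eq_Tperm [of j] using assms by (intro Tperm_mult_T) (auto simp: right_descent_def apply_tr_eval)
  moreover have "tr i * tr j = tr j * tr i"
    using assms by (intro perm_eqI) (auto simp: apply_tr_eval)
  ultimately show ?thesis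
    by simp
qed

section \<open>The symmetrizing trace\<close>

definition tau :: "hecke_fin \<Rightarrow> int poly" where
  "tau x = coef x 1"

lemma tau_add [simp]: "tau (x + y) = tau x + tau y"
  and tau_diff [simp]: "tau (x - y) = tau x - tau y"
  and tau_0 [simp]: "tau 0 = 0"
  and tau_scal [simp]: "tau (scal c * x) = c * tau x"
  and tau_sum [simp]: "tau (\<Sum>i\<in>I. f i) = (\<Sum>i\<in>I. tau (f i))"
  by (simp_all add: tau_def)

lemma tau_T_commute: "tau (T i * x) = tau (x * T i)"
  by (simp add: tau_def coef_mult_T coef_T_mult)

text \<open>The last letter of an ascending word moves cyclically to the left of \<open>x\<close>,
  where it acts on coefficients. The outcome is that T_w and the basis element of the inverse of w
  are dual for the form \<open>tau (x * y)\<close>.\<close>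

lemma tau_mult_Tperm: "tau (x * Tperm w) = coef x (inverse w)"
proof (induction w arbitrary: x rule: perm_asc_induct)
  case one
  then show ?case by (simp add: tau_def)
next
  case (step w i)
  have "tau (x * Tperm (w * tr i)) = tau (x * Tperm w * T i)"
    using step(1) by (simp add: Tperm_mult_T mult.assoc)
  also have "\<dots> = tau (T i * x * Tperm w)"
    using tau_T_commute [of i "x * Tperm w"] by (simp add: mult.assoc)
  also have "\<dots> = coef (T i * x) (inverse w)"
    by (rule step)
  also have "\<dots> = coef x (inverse (w * tr i))"
    using step(1) by (simp add: coef_T_mult)
  finally show ?case .
qed

lemma tau_Tperm_commute: "tau (Tperm w * x) = tau (x * Tperm w)"
proof (induction w arbitrary: x rule: perm_asc_induct)
  case (step w i)
  have "tau (Tperm w * T i * x) = tau (x * (Tperm w * T i))"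
    by (metis step(2) tau_T_commute mult.assoc)
  then show ?case
    using step(1) by (simp add: Tperm_mult_T)
qed simp

lemma tau_commute: "tau (x * y) = tau (y * x)"
proof -
  have "tau (x * y) = (\<Sum>w | coef x w \<noteq> 0. coef x w * tau (Tperm w * y))"
    by (subst hecke_fin_expand [of x]) (simp add: sum_distrib_right mult.assoc)
  also have "\<dots> = (\<Sum>w | coef x w \<noteq> 0. coef x w * tau (y * Tperm w))"
    by (simp add: tau_Tperm_commute)
  also have "\<dots> = tau (y * x)"
  proof -
    have "y * (scal c * z) = scal c * (y * z)" for c z
      by (metis scal_commute mult.assoc)
    then show ?thesis
      by (subst (3) hecke_fin_expand [of x]) (simp add: sum_distrib_left)
  qed
  finally show ?thesis .
qed

section \<open>Trace functions and Coxeter elements of parabolic subgroups\<close>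

text \<open>The copy of H_n, singled out by supports instead of generators, so that membership is a
  statement about coefficients.\<close>

definition Hsub :: "nat \<Rightarrow> hecke_fin set" where
  "Hsub n = {x. \<forall>w. coef x w \<noteq> 0 \<longrightarrow> in_Sym n w}"

lemma Hsub_0 [simp]: "0 \<in> Hsub n"
  and Hsub_1 [simp]: "1 \<in> Hsub n"
  by (auto simp: Hsub_def coef_1)

lemma Hsub_add: "x \<in> Hsub n \<Longrightarrow> y \<in> Hsub n \<Longrightarrow> x + y \<in> Hsub n"
  unfolding Hsub_def by (auto, metis add.right_neutral)

lemma Hsub_uminus: "x \<in> Hsub n \<Longrightarrow> - x \<in> Hsub n"
  by (auto simp: Hsub_def)

lemma Hsub_diff: "x \<in> Hsub n \<Longrightarrow> y \<in> Hsub n \<Longrightarrow> x - y \<in> Hsub n"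
  using Hsub_add [of x n "- y"] Hsub_uminus by simp

lemma Hsub_scal: "x \<in> Hsub n \<Longrightarrow> scal c * x \<in> Hsub n"
  by (auto simp: Hsub_def)

lemma Hsub_sum: "(\<And>i. i \<in> I \<Longrightarrow> f i \<in> Hsub n) \<Longrightarrow> (\<Sum>i\<in>I. f i) \<in> Hsub n"
  by (induction I rule: infinite_finite_induct) (auto intro: Hsub_add)

lemma Hsub_Tperm: "in_Sym n w \<Longrightarrow> Tperm w \<in> Hsub n"
  by (simp add: Hsub_def coef_Tperm)

lemma Hsub_T: "1 \<le> i \<Longrightarrow> i < n \<Longrightarrow> T i \<in> Hsub n"
  unfolding T_eq_Tperm by (rule Hsub_Tperm) simp

lemma Hsub_T_mult:
  assumes "x \<in> Hsub n" "1 \<le> i" "i < n"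
  shows "T i * x \<in> Hsub n"
proof -
  have "in_Sym n w" if "coef (T i * x) w \<noteq> 0" for w
  proof -
    have "coef x (tr i * w) \<noteq> 0 \<or> coef x w \<noteq> 0"
      using that by (auto simp: coef_T_mult split: if_splits)
    then show ?thesis
      using assms by (auto simp: Hsub_def)
  qed
  then show ?thesis
    by (simp add: Hsub_def)
qed

lemma Hsub_Tperm_mult: "in_Sym n w \<Longrightarrow> y \<in> Hsub n \<Longrightarrow> Tperm w * y \<in> Hsub n"
proof (induction w arbitrary: y rule: in_Sym_induct)
  case (step w i)
  then show ?case
    by (simp add: Hsub_T_mult mult.assoc flip: Tperm_mult_T)
qed simp

lemma Hsub_mult:
  assumes "x \<in> Hsub n" "y \<in> Hsub n"
  shows "x * y \<in> Hsub n"
proof -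
  have "x * y = (\<Sum>w | coef x w \<noteq> 0. scal (coef x w) * (Tperm w * y))"
    by (subst hecke_fin_expand [of x]) (simp add: sum_distrib_right mult.assoc)
  also have "\<dots> \<in> Hsub n"
    using assms by (intro Hsub_sum Hsub_scal Hsub_Tperm_mult) (auto simp: Hsub_def)
  finally show ?thesis .
qed

lemma Hsub_mono: "x \<in> Hsub m \<Longrightarrow> m \<le> n \<Longrightarrow> x \<in> Hsub n"
  by (auto simp: Hsub_def intro: in_Sym_mono)

lemma Hsub_induct [consumes 1, case_names zero add basis]:
  assumes "x \<in> Hsub n" "P 0" "\<And>x y. P x \<Longrightarrow> P y \<Longrightarrow> P (x + y)"
    and "\<And>c w. in_Sym n w \<Longrightarrow> P (scal c * Tperm w)"
  shows "P x"
proof -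
  have "P (\<Sum>w\<in>I. scal (coef x w) * Tperm w)" if "finite I" "\<And>w. w \<in> I \<Longrightarrow> in_Sym n w" for I
    using that by (induction I rule: finite_induct) (auto intro: assms)
  from this [of "{w. coef x w \<noteq> 0}"] show ?thesis
    using assms(1) by (simp add: finite_coef Hsub_def flip: hecke_fin_expand)
qed

lemma Hsub_commute_generators:
  assumes "x \<in> Hsub n" "\<And>i. 1 \<le> i \<Longrightarrow> i < n \<Longrightarrow> T i * y = y * T i"
  shows "x * y = y * x"
  using assms(1)
proof (induction x rule: Hsub_induct)
  case (basis c w)
  have "Tperm w * y = y * Tperm w"
    using basis
  proof (induction w rule: in_Sym_induct)
    case (step w i)
    then show ?case
      by (metis Tperm_mult_T assms(2) mult.assoc)
  qed simp
  then show ?case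
    by (metis mult.assoc scal_commute)
qed (simp_all add: algebra_simps)

lemma Hsub_commute_T:
  assumes "x \<in> Hsub n" "n < j"
  shows "x * T j = T j * x"
  using assms by (intro Hsub_commute_generators [OF assms(1)] T_commute) auto

text \<open>The coefficient of x T_n at the identity is that of x at s_n, which lies outside
  S_n.\<close>

lemma tau_mult_T_eq_0: "x \<in> Hsub n \<Longrightarrow> tau (x * T n) = 0"
  by (auto simp: tau_def coef_mult_T Hsub_def)

definition central_in :: "nat \<Rightarrow> hecke_fin \<Rightarrow> bool" where
  "central_in n z \<longleftrightarrow> z \<in> Hsub n \<and> (\<forall>x\<in>Hsub n. x * z = z * x)"

lemma central_inI:
  "z \<in> Hsub n \<Longrightarrow> (\<And>i. 1 \<le> i \<Longrightarrow> i < n \<Longrightarrow> T i * z = z * T i) \<Longrightarrow> central_in n z"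
  unfolding central_in_def using Hsub_commute_generators by blast

lemma central_in_trace:
  assumes "central_in n z" "x \<in> Hsub n"
  shows "tau (z * (x * y)) = tau (z * (y * x))"
proof -
  have "tau (z * (x * y)) = tau (x * (z * y))"
    using assms by (simp add: central_in_def flip: mult.assoc)
  also have "\<dots> = tau (z * (y * x))"
    by (simp add: tau_commute [of x] mult.assoc)
  finally show ?thesis .
qed

lemma mult_scal: "y * (scal c * z) = scal c * (y * z)"
  by (metis scal_commute mult.assoc)

text \<open>
  Combinations of products of generators with coefficients in \<open>\<nat>[\<xi>]\<close>; the flag records the
  parity of the number of factors \<open>T\<^sub>i\<close> plus the exponent of \<open>\<xi>\<close>.
\<close>

inductive pos_comb :: "nat \<Rightarrow> bool \<Rightarrow> hecke_fin \<Rightarrow> bool" for n where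
  zero: "pos_comb n p 0"
| one: "pos_comb n False 1"
| T: "pos_comb n p x \<Longrightarrow> 1 \<le> i \<Longrightarrow> i < n \<Longrightarrow> pos_comb n (\<not> p) (T i * x)"
| add: "pos_comb n p x \<Longrightarrow> pos_comb n p y \<Longrightarrow> pos_comb n p (x + y)"
| xi: "pos_comb n p x \<Longrightarrow> pos_comb n (\<not> p) (scal xi * x)"

lemma pos_comb_T: "1 \<le> i \<Longrightarrow> i < n \<Longrightarrow> pos_comb n True (T i)"
  using pos_comb.T [OF pos_comb.one, of i n] by simp

lemma pos_comb_mult:
  assumes "pos_comb n p x" "pos_comb n q y"
  shows "pos_comb n (p \<noteq> q) (x * y)"
  using assms(1)
proof (induction rule: pos_comb.induct)
  case (zero p)
  then show ?case by (simp add: pos_comb.zero)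
next
  case one
  then show ?case using assms(2) by simp
next
  case (T p x i)
  then show ?case
    using pos_comb.T [of n "p \<noteq> q" "x * y" i] by (simp add: mult.assoc)
next
  case (add p x y')
  then show ?case
    using pos_comb.add by (simp add: distrib_right)
next
  case (xi p x)
  then show ?case
    using pos_comb.xi [of n "p \<noteq> q" "x * y"] by (simp add: mult.assoc)
qed

lemma pos_comb_Tperm: "in_Sym n w \<Longrightarrow> pos_comb n (odd (inv_num w)) (Tperm w)"
proof (induction w rule: in_Sym_induct)
  case one
  then show ?case using pos_comb.one by simp
next
  case (step w i)
  have "pos_comb n (odd (inv_num w) \<noteq> True) (Tperm w * T i)"
    using step by (intro pos_comb_mult pos_comb_T) auto
  then show ?case
    using step by (simp add: Tperm_mult_T odd_inv_num_mult_tr inv_num_asc)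
qed

lemma pos_comb_Hsub: "pos_comb n p x \<Longrightarrow> x \<in> Hsub n"
  by (induction rule: pos_comb.induct) (auto intro: Hsub_add Hsub_T_mult Hsub_scal)

lemma pos_comb_mono: "pos_comb m p x \<Longrightarrow> m \<le> n \<Longrightarrow> pos_comb n p x"
  by (induction rule: pos_comb.induct) (auto intro: pos_comb.intros)

text \<open>The flag \<open>p = q\<close> of a middle term is the exclusive or of \<open>p\<close>,
  \<open>q\<close> and the one additional odd factor \<open>T n\<close>.\<close>

inductive double_coset :: "nat \<Rightarrow> bool \<Rightarrow> hecke_fin \<Rightarrow> bool" for n where
  base: "pos_comb n p u \<Longrightarrow> double_coset n p u"
| mid: "1 \<le> n \<Longrightarrow> pos_comb n p v \<Longrightarrow> pos_comb n q v' \<Longrightarrow> double_coset n (p = q) (v * T n * v')"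
| add: "double_coset n p x \<Longrightarrow> double_coset n p y \<Longrightarrow> double_coset n p (x + y)"

lemma double_coset_xi: "double_coset n p x \<Longrightarrow> double_coset n (\<not> p) (scal xi * x)"
proof (induction rule: double_coset.induct)
  case (base p u)
  then show ?case
    by (intro double_coset.base pos_comb.xi)
next
  case (mid p v q v')
  then have "double_coset n ((\<not> p) = q) (scal xi * v * T n * v')"
    by (intro double_coset.mid pos_comb.xi) auto
  moreover have "((\<not> p) = q) = (\<not> (p = q))"
    by blast
  ultimately show ?case
    by (simp only: mult.assoc)
next
  case (add p x y)
  then show ?case
    by (simp add: distrib_left double_coset.add)
qed

lemma double_coset_T:
  assumes "double_coset n p x" "1 \<le> i" "i < n"
  shows "double_coset n (\<not> p) (T i * x)"
  using assms(1)
proof (induction rule: double_coset.induct)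
  case (base p u)
  then show ?case
    using assms by (intro double_coset.base pos_comb.T)
next
  case (mid p v q v')
  then have "double_coset n ((\<not> p) = q) (T i * v * T n * v')"
    using assms by (intro double_coset.mid pos_comb.T) auto
  moreover have "((\<not> p) = q) = (\<not> (p = q))"
    by blast
  ultimately show ?case
    by (simp only: mult.assoc)
next
  case (add p x y)
  then show ?case
    by (simp add: distrib_left double_coset.add)
qed

text \<open>\<open>H\<^sub>n\<^sub>+\<^sub>1 = H\<^sub>n + H\<^sub>n T\<^sub>n H\<^sub>n\<close>, with positive coefficients.\<close>

lemma pos_comb_Suc_double_coset: "pos_comb (Suc n) p x \<Longrightarrow> double_coset n p x"
proof (induction n arbitrary: p x)
  case 0
  have "pos_comb 0 p x"
    using 0 by (induction rule: pos_comb.induct) (auto intro: pos_comb.intros)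
  then show ?case
    by (rule double_coset.base)
next
  case (Suc n)
  let ?N = "Suc n"
  \<comment> \<open>The only product leaving the two shapes is \<open>T ?N\<close> times a middle
    term. Splitting \<open>v\<close> once more leaves the quadratic relation if \<open>v\<close>
    lies in H_n and the braid relation if it contains \<open>T n\<close>.\<close>
  have top: "double_coset ?N (p \<noteq> q) (T ?N * (v * T ?N * v'))"
    if "double_coset n p v" "pos_comb ?N q v'" for p q v v'
    using that
  proof (induction rule: double_coset.induct)
    case (base p u)
    then have comm: "T ?N * u = u * T ?N"
      using Hsub_commute_T pos_comb_Hsub by fastforce
    have "T ?N * (u * T ?N * v') = u * (T ?N * T ?N) * v'"
      by (simp add: comm flip: mult.assoc)
    also have "\<dots> = u * v' + scal xi * (u * T ?N * v')"
      by (simp add: T_quad distrib_left distrib_right mult.assoc mult_scal)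
    finally have *: "T ?N * (u * T ?N * v') = u * v' + scal xi * (u * T ?N * v')" .
    have u: "pos_comb ?N p u"
      using base by (auto intro: pos_comb_mono)
    have "double_coset ?N (p \<noteq> q) (u * v')"
      using u base by (intro double_coset.base pos_comb_mult)
    moreover have "double_coset ?N (\<not> (p = q)) (scal xi * (u * T ?N * v'))"
      using u base by (intro double_coset_xi double_coset.mid) auto
    ultimately show ?case
      unfolding * by (intro double_coset.add) simp_all
  next
    case (mid pa a pb b)
    have ca: "T ?N * a = a * T ?N" and cb: "b * T ?N = T ?N * b"
      using mid Hsub_commute_T pos_comb_Hsub by (metis lessI)+
    have "T ?N * (a * T n * b * T ?N * v') = T ?N * a * T n * (b * T ?N) * v'"
      by (simp add: mult.assoc)
    also have "\<dots> = a * (T ?N * T n * T ?N) * b * v'"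
      by (simp add: ca cb mult.assoc)
    also have "\<dots> = (a * T n) * T ?N * (T n * (b * v'))"
      unfolding T_braid [symmetric] by (simp only: mult.assoc)
    finally have *: "T ?N * (a * T n * b * T ?N * v') = (a * T n) * T ?N * (T n * (b * v'))" .
    have a: "pos_comb ?N pa a" and b: "pos_comb ?N pb b"
      using mid by (auto intro: pos_comb_mono [of n])
    have Tn: "pos_comb ?N True (T n)"
      using mid by (intro pos_comb_T) auto
    have "pos_comb ?N (pa \<noteq> True) (a * T n)" "pos_comb ?N (\<not> (pb \<noteq> q)) (T n * (b * v'))"
      using mid pos_comb_mult [OF a Tn] pos_comb.T [OF pos_comb_mult [OF b that(2)]] by auto
    from double_coset.mid [OF _ this] show ?case
      unfolding * by (cases pa; cases pb; cases q; simp)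
  next
    case (add p x y)
    then show ?case
      by (auto simp: distrib_left distrib_right intro: double_coset.add)
  qed
  show ?case
    using Suc.prems
  proof (induction rule: pos_comb.induct)
    case (T p x i)
    show ?case
    proof (cases "i < ?N")
      case True
      then show ?thesis
        using T by (intro double_coset_T)
    next
      case False
      then have i: "i = ?N"
        using T by simp
      show ?thesis
        using T(4) unfolding i
      proof (induction rule: double_coset.induct)
        case (base p u)
        then have "double_coset ?N (False = p) (1 * T ?N * u)"
          by (intro double_coset.mid pos_comb.one) auto
        then show ?case by simp
      next
        case (mid p v q v')
        then show ?case
          using top Suc.IH by metis
      next
        case (add p x y)
        then show ?case
          by (simp add: distrib_left double_coset.add)
      qed
    qed
  qed (auto intro: pos_comb.intros double_coset.intros double_coset_xi)
qed

section \<open>Coxeter elements of parabolic subgroups, restricted to a window of generators\<close>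

definition Tcox :: "nat set \<Rightarrow> nat \<Rightarrow> nat \<Rightarrow> hecke_fin" where
  "Tcox J m n = prod_list (map (\<lambda>i. if i \<in> J then T i else 1) [m..<n])"

lemma Tcox_empty_range [simp]: "n \<le> m \<Longrightarrow> Tcox J m n = 1"
  by (simp add: Tcox_def)

lemma Tcox_front: "m < n \<Longrightarrow> Tcox J m n = (if m \<in> J then T m else 1) * Tcox J (Suc m) n"
  by (simp add: Tcox_def upt_conv_Cons)

lemma Tcox_Suc: "m \<le> n \<Longrightarrow> Tcox J m (Suc n) = Tcox J m n * (if n \<in> J then T n else 1)"
  by (simp add: Tcox_def)

lemma Tcox_cong: "J \<inter> {m..<n} = K \<inter> {m..<n} \<Longrightarrow> Tcox J m n = Tcox K m n"
proof -
  assume eq: "J \<inter> {m..<n} = K \<inter> {m..<n}"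
  have "i \<in> J \<longleftrightarrow> i \<in> K" if "i \<in> {m..<n}" for i
    using eq that by blast
  then show ?thesis
    unfolding Tcox_def by (intro arg_cong [where f = prod_list] list.map_cong0) simp
qed

lemma Hsub_Tcox: "1 \<le> m \<Longrightarrow> Tcox J m n \<in> Hsub n"
proof (induction n)
  case (Suc n)
  then show ?case
    by (cases "m \<le> n") (auto simp: Tcox_Suc intro!: Hsub_mult Hsub_T intro: Hsub_mono [of _ n "Suc n"])
qed simp

lemma Tcox_commute:
  assumes "x \<in> Hsub m"
  shows "x * Tcox J (Suc m) n = Tcox J (Suc m) n * x"
proof (induction n)
  case (Suc n)
  show ?case
  proof (cases "Suc m \<le> n")
    case True
    then have "x * T n = T n * x"
      using assms by (intro Hsub_commute_T) auto
    with Suc True show ?thesis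
      by (auto simp: Tcox_Suc) (metis mult.assoc)
  qed auto
qed simp

text \<open>A factor in H_{m+1} splits along H_m + H_m T_m H_m. The right factor of the second piece
  commutes with the later generators and returns cyclically to the front, so T_m joins the Coxeter
  product. \<open>Q\<close> stays abstract to serve both for vanishing and for positivity with
  parity.\<close>

lemma trace_reduction:
  fixes \<phi> :: "hecke_fin \<Rightarrow> int poly" and Q :: "bool \<Rightarrow> int poly \<Rightarrow> bool"
  assumes \<phi>_add: "\<And>x y. \<phi> (x + y) = \<phi> x + \<phi> y"
    and \<phi>_xi: "\<And>x. \<phi> (scal xi * x) = xi * \<phi> x"
    and \<phi>_trace: "\<And>x y. x \<in> Hsub n \<Longrightarrow> y \<in> Hsub n \<Longrightarrow> \<phi> (x * y) = \<phi> (y * x)"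
    and Q_0: "\<And>p. Q p 0"
    and Q_add: "\<And>p a b. Q p a \<Longrightarrow> Q p b \<Longrightarrow> Q p (a + b)"
    and Q_xi: "\<And>p a. Q p a \<Longrightarrow> Q (\<not> p) (xi * a)"
    and Q_Tcox: "\<And>K. K \<subseteq> {1..<n} \<Longrightarrow> Q (odd (card K)) (\<phi> (Tcox K 1 n))"
    and x: "pos_comb n p x" and n: "1 \<le> n"
  shows "Q p (\<phi> x)"
proof -
  have \<phi>_0: "\<phi> 0 = 0"
    using \<phi>_add [of 0 0] by simp
  \<comment> \<open>The invariant: \<open>x\<close> lies in H_m and \<open>K\<close> contains only
    generators from m on. At m = n with \<open>K\<close> empty this is the claim; at m = 1 no
    generator is left in \<open>x\<close>.\<close>
  have main: "Q (p \<noteq> odd (card K)) (\<phi> (x * Tcox K m n))"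
    if "1 \<le> m" "m \<le> n" "pos_comb m p x" "K \<subseteq> {m..<n}" for m p x K
    using that
  proof (induction m arbitrary: p x K rule: dec_induct)
    case base
    from base(2) show ?case
    proof (induction rule: pos_comb.induct)
      case (add p x y)
      then show ?case
        by (simp add: distrib_right \<phi>_add Q_add)
    next
      case (xi p x)
      then show ?case
        using Q_xi [of "p \<noteq> odd (card K)"] by (simp add: mult.assoc \<phi>_xi)
    qed (use base Q_Tcox [of K] in \<open>auto simp: \<phi>_0 Q_0\<close>)
  next
    case (step m)
    have "double_coset m p x"
      using step.prems by (intro pos_comb_Suc_double_coset)
    then show ?case
    proof (induction rule: double_coset.induct)
      case (base p u)
      have "Tcox K m n = Tcox K (Suc m) n"
        using step.prems by (subst Tcox_front) auto
      moreover have "Q (p \<noteq> odd (card K)) (\<phi> (u * Tcox K m n))"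
        using step base by (intro step.IH) force+
      ultimately show ?case
        by simp
    next
      case (mid p v q v')
      have fin: "finite K" and mK: "m \<notin> K"
        using step.prems finite_subset by auto
      have v: "v \<in> Hsub n" "v' \<in> Hsub n" "v' \<in> Hsub m"
        using mid step.prems by (auto intro: Hsub_mono [of _ m n] pos_comb_Hsub)
      have "v * T m * v' * Tcox K (Suc m) n = (v * T m * Tcox K (Suc m) n) * v'"
        using Tcox_commute [OF v(3)] by (simp add: mult.assoc)
      then have "\<phi> (v * T m * v' * Tcox K (Suc m) n) = \<phi> (v' * (v * T m * Tcox K (Suc m) n))"
        using v step by (simp add: \<phi>_trace Hsub_mult Hsub_T Hsub_Tcox)
      also have "v' * (v * T m * Tcox K (Suc m) n) = (v' * v) * Tcox (insert m K) m n"
      proof -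
        have "Tcox (insert m K) (Suc m) n = Tcox K (Suc m) n"
          by (intro Tcox_cong) auto
        then have "Tcox (insert m K) m n = T m * Tcox K (Suc m) n"
          using step.prems by (subst Tcox_front) auto
        then show ?thesis
          by (simp add: mult.assoc)
      qed
      finally have *: "\<phi> (v * T m * v' * Tcox K (Suc m) n) = \<phi> ((v' * v) * Tcox (insert m K) m n)" .
      have "Q ((q \<noteq> p) \<noteq> odd (card (insert m K))) (\<phi> ((v' * v) * Tcox (insert m K) m n))"
        using step mid by (intro step.IH pos_comb_mult) force+
      then show ?case
        unfolding * using fin mK by (cases p; cases q; simp)
    next
      case (add p x y)
      then show ?case
        by (simp add: distrib_right \<phi>_add Q_add)
    qed
  qed
  show ?thesis
    using main [of n p x "{}"] x n by simp
qed

definition cox :: "nat set \<Rightarrow> nat \<Rightarrow> nat \<Rightarrow> nat perm" where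
  "cox J m n = prod_list (map (\<lambda>i. if i \<in> J then tr i else 1) [m..<n])"

lemma cox_empty_range [simp]: "n \<le> m \<Longrightarrow> cox J m n = 1"
  by (simp add: cox_def)

lemma cox_Suc: "m \<le> n \<Longrightarrow> cox J m (Suc n) = cox J m n * (if n \<in> J then tr n else 1)"
  by (simp add: cox_def)

lemma in_Sym_cox: "1 \<le> m \<Longrightarrow> in_Sym n (cox J m n)"
proof (induction n)
  case (Suc n)
  then show ?case
    by (cases "m \<le> n") (auto simp: cox_Suc intro!: in_Sym_mult intro: in_Sym_mono)
qed simp

lemma in_Sym_not_right_descent: "in_Sym n w \<Longrightarrow> \<not> right_descent w n"
  using in_Sym_right_descent_imp by blast

lemma Tperm_cox: "1 \<le> m \<Longrightarrow> Tperm (cox J m n) = Tcox J m n"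
proof (induction n)
  case (Suc n)
  then show ?case
    by (cases "m \<le> n") (auto simp: cox_Suc Tcox_Suc in_Sym_cox in_Sym_not_right_descent simp flip: Tperm_mult_T)
qed simp

lemma tau_mult_Tcox: "tau (z * Tcox J 1 n) = coef z (inverse (cox J 1 n))"
  by (simp add: tau_mult_Tperm flip: Tperm_cox)

text \<open>A central element is determined by its coefficients at the Coxeter elements of parabolic
  subgroups.\<close>

lemma central_coeff_reduction:
  fixes Q :: "bool \<Rightarrow> int poly \<Rightarrow> bool"
  assumes z: "central_in n z" and n: "1 \<le> n"
    and "\<And>p. Q p 0"
    and "\<And>p a b. Q p a \<Longrightarrow> Q p b \<Longrightarrow> Q p (a + b)"
    and "\<And>p a. Q p a \<Longrightarrow> Q (\<not> p) (xi * a)"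
    and "\<And>K. K \<subseteq> {1..<n} \<Longrightarrow> Q (odd (card K)) (tau (z * Tcox K 1 n))"
    and w: "in_Sym n w"
  shows "Q (odd (inv_num w)) (coef z (inverse w))"
proof -
  have "Q (odd (inv_num w)) (tau (z * Tperm w))"
  proof (rule trace_reduction [where \<phi> = "\<lambda>x. tau (z * x)" and n = n and Q = Q])
    fix x
    show "tau (z * (scal xi * x)) = xi * tau (z * x)"
      by (metis mult.assoc scal_commute tau_scal)
  qed (use assms in \<open>auto simp: distrib_left central_in_trace pos_comb_Tperm\<close>)
  then show ?thesis
    by (simp add: tau_mult_Tperm)
qed

lemma central_eq_0I:
  assumes z: "central_in n z" and n: "1 \<le> n"
    and Tcox: "\<And>K. K \<subseteq> {1..<n} \<Longrightarrow> tau (z * Tcox K 1 n) = 0"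
  shows "z = 0"
proof (rule hecke_fin_eqI)
  fix w
  show "coef z w = coef 0 w"
  proof (cases "in_Sym n w")
    case True
    have "coef z (inverse (inverse w)) = 0"
      by (rule central_coeff_reduction [OF z n, where Q = "\<lambda>p a. a = 0"]) (use Tcox True in auto)
    then show ?thesis by simp
  next
    case False
    then show ?thesis
      using z by (auto simp: central_in_def Hsub_def)
  qed
qed

section \<open>Jucys--Murphy elements\<close>

text \<open>The Jucys--Murphy elements: \<open>JM n\<close> is the sum of the basis elements of the
  transpositions (i, n) with 1 <= i < n, in recursive form. \<open>JM 0\<close> is a filler
  value.\<close>

primrec JM :: "nat \<Rightarrow> hecke_fin" where
  "JM 0 = 0"
| "JM (Suc n) = (if n = 0 then 0 else T n * JM n * T n + T n)"

lemmas JM_Suc = JM.simps(2)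
declare JM_Suc [simp del]

lemma JM_1 [simp]: "JM (Suc 0) = 0"
  by (simp add: JM_Suc)

lemma Hsub_JM: "JM n \<in> Hsub n"
  by (induction n) (auto simp: JM_Suc intro!: Hsub_add Hsub_mult Hsub_T intro: Hsub_mono)

lemma Hsub_power: "x \<in> Hsub n \<Longrightarrow> x ^ k \<in> Hsub n"
  by (induction k) (auto intro: Hsub_mult)

text \<open>Only the index j + 2 needs work. There the first summand of the expanded element
  commutes with \<open>T j\<close> by braid relations; the other two commute with it only in sum,
  since the \<xi> terms on both sides coincide.\<close>

lemma T_JM_commute: "1 \<le> j \<Longrightarrow> Suc j < n \<Longrightarrow> T j * JM n = JM n * T j"
proof (induction n)
  case (Suc n)
  show ?case
  proof (cases "Suc j < n")
    case True
    then have "T j * JM n = JM n * T j" "T j * T n = T n * T j"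
      using Suc T_commute by auto
    then have "T j * (T n * JM n * T n) = T n * JM n * T n * T j"
      by (metis mult.assoc)
    then show ?thesis
      using True \<open>T j * T n = T n * T j\<close> by (simp add: JM_Suc distrib_left distrib_right)
  next
    case False
    then have n: "n = Suc j"
      using Suc by simp
    let ?L = "JM j"
    have comm: "T n * ?L = ?L * T n"
      using Hsub_commute_T [OF Hsub_JM [of j]] n by simp
    have br: "T j * T n * T j = T n * T j * T n"
      using T_braid [of j] n by simp
    have L: "JM (Suc n) = T n * T j * ?L * T j * T n + T n * T j * T n + T n"
      using n Suc.prems by (simp add: JM_Suc distrib_left distrib_right mult.assoc)
    have "T j * (T n * T j * ?L * T j * T n) = (T j * T n * T j) * ?L * T j * T n"
      by (simp only: mult.assoc)
    also have "\<dots> = T n * T j * (T n * ?L) * T j * T n"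
      unfolding br by (simp only: mult.assoc)
    also have "\<dots> = T n * T j * ?L * (T n * T j * T n)"
      unfolding comm by (simp only: mult.assoc)
    also have "\<dots> = T n * T j * ?L * T j * T n * T j"
      unfolding br [symmetric] by (simp only: mult.assoc)
    finally have 1: "T j * (T n * T j * ?L * T j * T n) = T n * T j * ?L * T j * T n * T j" .
    have "T j * (T n * T j * T n) = T j * T j * T n * T j"
      unfolding br [symmetric] by (simp only: mult.assoc)
    also have "\<dots> = T n * T j + scal xi * (T j * T n * T j)"
      unfolding T_quad by (simp add: distrib_right mult.assoc)
    finally have 2: "T j * (T n * T j * T n) = T n * T j + scal xi * (T j * T n * T j)" .
    have "T n * T j * T n * T j = T j * T n * (T j * T j)"
      unfolding br [symmetric] by (simp only: mult.assoc)
    also have "\<dots> = T j * T n + scal xi * (T j * T n * T j)"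
      unfolding T_quad by (simp add: distrib_left mult_scal mult.assoc)
    finally have 3: "T n * T j * T n * T j = T j * T n + scal xi * (T j * T n * T j)" .
    show ?thesis
      unfolding L distrib_left distrib_right 1 2 3 by (simp add: add_ac)
  qed
qed simp

lemma JM_commute_Hsub: "x \<in> Hsub n \<Longrightarrow> x * JM (Suc n) = JM (Suc n) * x"
  by (rule Hsub_commute_generators) (auto intro: T_JM_commute)

lemma JM_commute: "JM i * JM j = JM j * JM i"
proof (induction i j rule: linorder_wlog)
  case (le a b)
  show ?case
  proof (cases "a = b")
    case False
    then obtain c where "b = Suc c" "a \<le> c"
      using le by (cases b) auto
    then show ?thesis
      using JM_commute_Hsub [OF Hsub_mono [OF Hsub_JM]] by simp
  qed simp
qed simp

lemma JM_JM_power: "JM i * JM j ^ a = JM j ^ a * JM i"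
  by (metis JM_commute power_commuting_commutes)

text \<open>The error in moving \<open>T n\<close> past the a-th power of \<open>JM (Suc n)\<close>.
  It is the same from the left and from the right, which makes the sum of the a-th powers of the two
  neighbouring elements commute with \<open>T n\<close>.\<close>

primrec JM_rest :: "nat \<Rightarrow> nat \<Rightarrow> hecke_fin" where
  "JM_rest n 0 = 0"
| "JM_rest n (Suc a) = JM (Suc n) * JM_rest n a + (scal xi * JM (Suc n) + 1) * JM n ^ a"

context
  fixes n :: nat
  assumes n: "1 \<le> n"
begin

lemma JM_Suc_T: "JM (Suc n) * T n = T n * JM n + scal xi * JM (Suc n) + 1"
proof -
  have "JM (Suc n) * T n = T n * JM n * (T n * T n) + T n * T n"
    using n by (simp add: JM_Suc distrib_right mult.assoc)
  then show ?thesis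
    using n unfolding T_quad by (simp add: JM_Suc distrib_left mult_scal mult.assoc add_ac)
qed

lemma T_JM_Suc: "T n * JM (Suc n) = JM n * T n + scal xi * JM (Suc n) + 1"
proof -
  have "T n * JM (Suc n) = (T n * T n) * JM n * T n + T n * T n"
    using n by (simp add: JM_Suc distrib_left mult.assoc)
  then show ?thesis
    using n unfolding T_quad by (simp add: JM_Suc distrib_left distrib_right mult.assoc add_ac)
qed

lemma JM_rest_commute: "JM_rest n a * JM (Suc n) = JM (Suc n) * JM_rest n a"
proof (induction a)
  case (Suc a)
  have "(scal xi * JM (Suc n) + 1) * JM n ^ a * JM (Suc n) = JM (Suc n) * ((scal xi * JM (Suc n) + 1) * JM n ^ a)"
    by (simp add: distrib_left distrib_right mult.assoc mult_scal JM_JM_power [of "Suc n", symmetric])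
  with Suc show ?case
    by (simp add: distrib_left distrib_right mult.assoc)
qed simp

lemma JM_Suc_power_T: "JM (Suc n) ^ a * T n = T n * JM n ^ a + JM_rest n a"
proof (induction a)
  case (Suc a)
  have "JM (Suc n) ^ Suc a * T n = JM (Suc n) * T n * JM n ^ a + JM (Suc n) * JM_rest n a"
    by (simp add: mult.assoc Suc distrib_left)
  also have "\<dots> = T n * JM n ^ Suc a + JM_rest n (Suc a)"
    unfolding JM_Suc_T by (simp add: distrib_right mult.assoc add.assoc)
  finally show ?case .
qed simp

lemma T_JM_Suc_power: "T n * JM (Suc n) ^ a = JM n ^ a * T n + JM_rest n a"
proof (induction a)
  case (Suc a)
  have "T n * JM (Suc n) ^ Suc a = JM n ^ a * (T n * JM (Suc n)) + JM_rest n a * JM (Suc n)"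
    unfolding power_Suc2 mult.assoc [symmetric] Suc
    by (simp add: mult.assoc distrib_right)
  also have "\<dots> = JM n ^ a * JM n * T n + (JM n ^ a * (scal xi * JM (Suc n)) + JM n ^ a)
      + JM (Suc n) * JM_rest n a"
    unfolding T_JM_Suc JM_rest_commute by (simp add: distrib_left mult.assoc)
  also have "JM n ^ a * (scal xi * JM (Suc n)) + JM n ^ a = (scal xi * JM (Suc n) + 1) * JM n ^ a"
    by (simp add: distrib_right mult.assoc mult_scal JM_JM_power [of "Suc n"])
  also have "JM n ^ a * JM n = JM n ^ Suc a"
    by (simp add: power_commutes)
  finally show ?case
    by (simp add: add.assoc add.commute [of "JM (Suc n) * JM_rest n a"])
qed simp

lemma T_JM_power_sum: "T n * (JM n ^ a + JM (Suc n) ^ a) = (JM n ^ a + JM (Suc n) ^ a) * T n"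
  by (simp add: distrib_left distrib_right JM_Suc_power_T T_JM_Suc_power)

end

section \<open>Power sums and the degree filtration\<close>

definition psum :: "nat \<Rightarrow> nat \<Rightarrow> hecke_fin" where
  "psum n k = (\<Sum>i=1..n. JM i ^ k)"

lemma power_commute_T: "x * T j = T j * x \<Longrightarrow> x ^ k * T j = T j * x ^ k"
  by (metis power_commuting_commutes)

text \<open>\<open>T j\<close> commutes with every summand except those at j and j + 1, and with the
  sum of these two.\<close>

lemma central_psum: "central_in n (psum n k)"
proof (rule central_inI)
  show "psum n k \<in> Hsub n"
    unfolding psum_def by (intro Hsub_sum Hsub_power) (auto intro: Hsub_mono [OF Hsub_JM])
next
  fix j assume j: "1 \<le> j" "j < n"
  have split: "{1..n} = {j, Suc j} \<union> ({1..n} - {j, Suc j})"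
    using j by auto
  let ?S = "\<Sum>i\<in>{1..n} - {j, Suc j}. JM i ^ k"
  have "T j * JM i ^ k = JM i ^ k * T j" if "i \<in> {1..n} - {j, Suc j}" for i
  proof (cases "i < j")
    case True
    then show ?thesis
      using power_commute_T [OF Hsub_commute_T [OF Hsub_JM]] by metis
  next
    case False
    then show ?thesis
      using that j T_JM_commute [of j i] by (intro power_commute_T [symmetric]) auto
  qed
  then have "T j * ?S = ?S * T j"
    by (simp add: sum_distrib_left sum_distrib_right)
  moreover have "psum n k = (JM j ^ k + JM (Suc j) ^ k) + ?S"
    unfolding psum_def by (subst split, subst sum.union_disjoint) auto
  ultimately show "T j * psum n k = psum n k * T j"
    using T_JM_power_sum [OF j(1)] by (simp only: distrib_left distrib_right)
qed

text \<open>The degree bound \<open>r\<close> is strict, so that the degree of a product is bounded by \<open>r + s - 1\<close>.\<close>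

inductive JM_poly :: "nat \<Rightarrow> nat \<Rightarrow> hecke_fin \<Rightarrow> bool" for n where
  zero: "JM_poly n r 0"
| one: "JM_poly n (Suc r) 1"
| JM: "JM_poly n r x \<Longrightarrow> 1 \<le> i \<Longrightarrow> i \<le> n \<Longrightarrow> JM_poly n (Suc r) (JM i * x)"
| add: "JM_poly n r x \<Longrightarrow> JM_poly n r y \<Longrightarrow> JM_poly n r (x + y)"
| scal: "JM_poly n r x \<Longrightarrow> JM_poly n r (scal c * x)"

definition JMdeg :: "nat \<Rightarrow> nat \<Rightarrow> hecke_fin set" where
  "JMdeg n r = {x. JM_poly n r x}"

lemma JM_poly_iff: "JM_poly n r x \<longleftrightarrow> x \<in> JMdeg n r"
  by (simp add: JMdeg_def)

lemmas JMdeg_intros = JM_poly.intros [unfolded JM_poly_iff]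
lemmas JMdeg_zero = JM_poly.zero [unfolded JM_poly_iff]
lemmas JMdeg_one = JM_poly.one [unfolded JM_poly_iff]
lemmas JMdeg_JM = JM_poly.JM [unfolded JM_poly_iff]
lemmas JMdeg_add = JM_poly.add [unfolded JM_poly_iff]
lemmas JMdeg_scal = JM_poly.scal [unfolded JM_poly_iff]
lemmas JMdeg_induct = JM_poly.induct [unfolded JM_poly_iff, consumes 1, case_names zero one JM add scal]

lemma JMdeg_0: "x \<in> JMdeg n 0 \<Longrightarrow> x = 0"
  by (induction "0 :: nat" x rule: JMdeg_induct) auto

lemma JMdeg_mono: "x \<in> JMdeg m r \<Longrightarrow> m \<le> n \<Longrightarrow> r \<le> s \<Longrightarrow> x \<in> JMdeg n s"
proof (induction arbitrary: s rule: JMdeg_induct)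
  case (one r)
  then show ?case by (cases s) (auto intro: JMdeg_one)
next
  case (JM r x i)
  then show ?case by (cases s) (auto intro: JMdeg_JM)
qed (auto intro: JMdeg_intros)

lemma JMdeg_sum: "(\<And>i. i \<in> I \<Longrightarrow> f i \<in> JMdeg n r) \<Longrightarrow> (\<Sum>i\<in>I. f i) \<in> JMdeg n r"
  by (induction I rule: infinite_finite_induct) (auto intro: JMdeg_intros)

lemma JMdeg_mult:
  assumes "x \<in> JMdeg n r" "y \<in> JMdeg n s"
  shows "x * y \<in> JMdeg n (r + s - 1)"
  using assms(1)
proof (induction rule: JMdeg_induct)
  case (one r)
  then show ?case using assms(2) by (auto intro: JMdeg_mono)
next
  case (JM r x i)
  then have *: "JM i * (x * y) \<in> JMdeg n (Suc (r + s - 1))"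
    by (intro JMdeg_JM)
  show ?case
  proof (cases r)
    case 0
    then show ?thesis
      using JM(1) JMdeg_0 [of x n] by (auto intro: JMdeg_zero)
  next
    case (Suc r')
    then show ?thesis
      using * by (simp add: mult.assoc)
  qed
next
  case (scal r x c)
  then show ?case
    by (simp add: mult.assoc JMdeg_scal)
qed (auto simp: distrib_right intro: JMdeg_intros)

lemma JMdeg_JM_power: "1 \<le> i \<Longrightarrow> i \<le> n \<Longrightarrow> JM i ^ a \<in> JMdeg n (Suc a)"
  by (induction a) (auto intro: JMdeg_one JMdeg_JM)

lemma JMdeg_Hsub: "x \<in> JMdeg n r \<Longrightarrow> x \<in> Hsub n"
  by (induction rule: JMdeg_induct) (auto intro: Hsub_add Hsub_scal Hsub_mult Hsub_mono [OF Hsub_JM])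

lemma JMdeg_commute_JM: "x \<in> JMdeg n r \<Longrightarrow> x * JM i = JM i * x"
proof (induction rule: JMdeg_induct)
  case (JM r x j)
  then show ?case
    by (metis JM_commute mult.assoc)
next
  case (scal r x c)
  then show ?case
    by (simp add: mult.assoc mult_scal)
qed (simp_all add: distrib_left distrib_right)

lemma JMdeg_commute: "x \<in> JMdeg n r \<Longrightarrow> y \<in> JMdeg m s \<Longrightarrow> x * y = y * x"
proof (induction rule: JMdeg_induct)
  case (JM r x j)
  then show ?case
    by (metis JMdeg_commute_JM mult.assoc)
next
  case (scal r x c)
  then show ?case
    by (simp add: mult.assoc mult_scal)
qed (simp_all add: distrib_left distrib_right)

lemma JM_power_commute_Hsub: "x \<in> Hsub n \<Longrightarrow> x * JM (Suc n) ^ a = JM (Suc n) ^ a * x"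
  using power_commuting_commutes [of "JM (Suc n)" x a] JM_commute_Hsub by simp

text \<open>Polynomials sorted by powers of the top variable, with the degree left to each cofactor
  in the lower variables; this is the form in which a conditional expectation integrates the top
  variable out.\<close>

inductive JM_poly_top :: "nat \<Rightarrow> nat \<Rightarrow> hecke_fin \<Rightarrow> bool" for n r where
  zero: "JM_poly_top n r 0"
| add: "JM_poly_top n r x \<Longrightarrow> JM_poly_top n r y \<Longrightarrow> JM_poly_top n r (x + y)"
| top: "a < r \<Longrightarrow> y \<in> JMdeg n (r - a) \<Longrightarrow> JM_poly_top n r (JM (Suc n) ^ a * y)"

lemma JMdeg_Suc_imp_top: "x \<in> JMdeg (Suc n) r \<Longrightarrow> JM_poly_top n r x"
proof (induction rule: JMdeg_induct)
  case (one r)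
  show ?case
    using JM_poly_top.top [of 0 "Suc r" 1 n] by (simp add: JMdeg_one)
next
  case (JM r x i)
  show ?case
  proof (cases "i = Suc n")
    case True
    from JM(4) show ?thesis
      unfolding True
    proof (induction rule: JM_poly_top.induct)
      case (top a y)
      then have "JM_poly_top n (Suc r) (JM (Suc n) ^ Suc a * y)"
        by (intro JM_poly_top.top) auto
      then show ?case
        by (simp add: mult.assoc)
    qed (auto simp: distrib_left intro: JM_poly_top.intros)
  next
    case False
    then have i: "i \<le> n"
      using JM by simp
    from JM(4) show ?thesis
    proof (induction rule: JM_poly_top.induct)
      case (top a y)
      then have "JM i * y \<in> JMdeg n (Suc r - a)"
        using JMdeg_JM [OF top(2) JM(2) i] by (simp add: Suc_diff_le)
      then have *: "JM_poly_top n (Suc r) (JM (Suc n) ^ a * (JM i * y))"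
        using top by (intro JM_poly_top.top) auto
      have "JM i * (JM (Suc n) ^ a * y) = JM (Suc n) ^ a * (JM i * y)"
        using JM_JM_power [of i "Suc n" a] by (simp flip: mult.assoc)
      then show ?case
        using * by simp
    qed (auto simp: distrib_left intro: JM_poly_top.intros)
  qed
next
  case (scal r x c)
  from scal(2) show ?case
  proof (induction rule: JM_poly_top.induct)
    case (top a y)
    then have "JM_poly_top n r (JM (Suc n) ^ a * (scal c * y))"
      by (intro JM_poly_top.top JMdeg_scal)
    then show ?case
      by (simp add: mult_scal)
  qed (auto simp: distrib_left intro: JM_poly_top.intros)
qed (auto intro: JM_poly_top.intros)

lemmas JMdeg_Suc_induct [consumes 1, case_names zero add top] = JM_poly_top.induct [OF JMdeg_Suc_imp_top]

section \<open>Conditional expectations\<close>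

text \<open>Equality of the conditional expectations onto H_n with respect to \<open>tau\<close>. As
  a relation it spares the construction of the expectation as a map.\<close>

definition eq_on :: "nat \<Rightarrow> hecke_fin \<Rightarrow> hecke_fin \<Rightarrow> bool" where
  "eq_on n x y \<longleftrightarrow> (\<forall>h\<in>Hsub n. tau (x * h) = tau (y * h))"

lemma eq_on_refl [simp]: "eq_on n x x"
  by (simp add: eq_on_def)

lemma eq_on_add: "eq_on n x y \<Longrightarrow> eq_on n x' y' \<Longrightarrow> eq_on n (x + x') (y + y')"
  by (simp add: eq_on_def distrib_right)

lemma eq_on_scal: "eq_on n x y \<Longrightarrow> eq_on n (scal c * x) (scal c * y)"
  by (simp add: eq_on_def mult.assoc)

lemma eq_on_mult: "eq_on n x y \<Longrightarrow> g \<in> Hsub n \<Longrightarrow> eq_on n (x * g) (y * g)"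
  by (simp add: eq_on_def mult.assoc Hsub_mult)

lemma eq_on_mult_left:
  assumes "eq_on n x y" "g \<in> Hsub n"
  shows "eq_on n (g * x) (g * y)"
proof -
  have "tau (g * x * h) = tau (x * (h * g))" for x h
    by (metis tau_commute mult.assoc)
  then show ?thesis
    using assms by (simp add: eq_on_def Hsub_mult)
qed

lemma eq_on_Tcox: "eq_on n x y \<Longrightarrow> tau (x * Tcox J 1 n) = tau (y * Tcox J 1 n)"
  by (simp add: eq_on_def Hsub_Tcox)

lemma eq_on_T_0: "eq_on n (T n) 0"
  unfolding eq_on_def by (metis tau_commute tau_mult_T_eq_0 mult_zero_left tau_0)

text \<open>Tested against H_n = H_{n-1} + H_{n-1} T_{n-1} H_{n-1}: on the first piece T_n T_n = 1 +
  \<xi> T_n, and the \<xi> term has trace zero; on the second the braid relation leaves a single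
  T_n, so that both sides vanish.\<close>

lemma eq_on_T_mult_T:
  assumes n: "1 \<le> n" and h: "h \<in> Hsub n" and h0: "h0 \<in> Hsub (n - 1)" and eq: "eq_on (n - 1) h h0"
  shows "eq_on n (T n * h * T n) h0"
proof -
  let ?m = "n - 1"
  have comm: "u * T n = T n * u" if "u \<in> Hsub ?m" for u
    using Hsub_commute_T [OF that] n by simp
  have mono: "u \<in> Hsub n" if "u \<in> Hsub ?m" for u
    using that by (rule Hsub_mono) simp
  have step: "tau (T n * h * T n * x) = tau (h0 * x)" if "double_coset ?m p x" for p x
    using that
  proof (induction rule: double_coset.induct)
    case (base p u)
    then have u: "u \<in> Hsub ?m"
      by (rule pos_comb_Hsub)
    have "tau (T n * h * T n * u) = tau (T n * h * u * T n)"
      by (simp only: mult.assoc comm [OF u])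
    also have "\<dots> = tau (h * u * (T n * T n))"
      by (metis tau_commute mult.assoc)
    also have "\<dots> = tau (h * u) + xi * tau (h * u * T n)"
      by (simp add: T_quad distrib_left mult_scal)
    also have "tau (h * u * T n) = 0"
      using h mono [OF u] by (intro tau_mult_T_eq_0 Hsub_mult)
    finally show ?case
      using eq u by (simp add: eq_on_def)
  next
    case (mid p v q v')
    then have v: "v \<in> Hsub ?m" "v' \<in> Hsub ?m"
      by (auto intro: pos_comb_Hsub)
    have m: "n = Suc ?m"
      using mid n by simp
    have br: "T n * T ?m * T n = T ?m * T n * T ?m"
      using T_braid [of ?m] m by simp
    have "tau (T n * h * T n * (v * T ?m * v')) = tau (v' * T n * h * (T n * v) * T ?m)"
      by (metis tau_commute mult.assoc)
    also have "\<dots> = tau (T n * (v' * h * v * T n * T ?m))"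
      by (simp only: comm [OF v(1), symmetric] comm [OF v(2)] mult.assoc)
    also have "\<dots> = tau (v' * h * v * (T n * T ?m * T n))"
      by (metis tau_commute mult.assoc)
    also have "\<dots> = tau (T ?m * v' * h * v * T ?m * T n)"
      unfolding br by (metis tau_commute mult.assoc)
    also have "\<dots> = 0"
      using h v mono m mid by (intro tau_mult_T_eq_0 Hsub_mult Hsub_T) auto
    finally have "tau (T n * h * T n * (v * T ?m * v')) = 0" .
    moreover have "tau (h0 * (v * T ?m * v')) = tau (v' * h0 * v * T ?m)"
      by (metis tau_commute mult.assoc)
    moreover have "\<dots> = 0"
      using h0 v by (intro tau_mult_T_eq_0 Hsub_mult)
    ultimately show ?case by simp
  qed (simp_all add: distrib_left)
  have "tau (T n * h * T n * x) = tau (h0 * x)" if "x \<in> Hsub n" for x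
    using that
  proof (induction rule: Hsub_induct)
    case (basis c w)
    have "double_coset ?m (odd (inv_num w)) (Tperm w)"
      using pos_comb_Tperm [OF basis] n by (intro pos_comb_Suc_double_coset) simp
    from step [OF this] show ?case
      by (simp add: mult_scal)
  qed (simp_all add: distrib_left)
  then show ?thesis
    by (simp add: eq_on_def)
qed

text \<open>As the bounds are strict, for positive r these are the polynomials that can be written
  in degree at most r - 1 with a part of degree r - 1 divisible by \<xi>.\<close>

definition JMdeg_xi :: "nat \<Rightarrow> nat \<Rightarrow> hecke_fin set" where
  "JMdeg_xi n r = {u + scal xi * v | u v. u \<in> JMdeg n (r - 1) \<and> v \<in> JMdeg n r}"

lemma JMdeg_xi_I1: "u \<in> JMdeg n (r - 1) \<Longrightarrow> u \<in> JMdeg_xi n r"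
  unfolding JMdeg_xi_def mem_Collect_eq by (rule exI [of _ u], rule exI [of _ 0]) (simp add: JMdeg_zero)

lemma JMdeg_xi_I2: "v \<in> JMdeg n r \<Longrightarrow> scal xi * v \<in> JMdeg_xi n r"
  unfolding JMdeg_xi_def mem_Collect_eq by (rule exI [of _ 0], rule exI [of _ v]) (simp add: JMdeg_zero)

lemma JMdeg_xi_add: "x \<in> JMdeg_xi n r \<Longrightarrow> y \<in> JMdeg_xi n r \<Longrightarrow> x + y \<in> JMdeg_xi n r"
proof -
  assume "x \<in> JMdeg_xi n r" "y \<in> JMdeg_xi n r"
  then obtain u v u' v' where "x = u + scal xi * v" "y = u' + scal xi * v'"
    "u \<in> JMdeg n (r - 1)" "u' \<in> JMdeg n (r - 1)" "v \<in> JMdeg n r" "v' \<in> JMdeg n r"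
    by (auto simp: JMdeg_xi_def)
  moreover from this have "x + y = (u + u') + scal xi * (v + v')"
    by (simp add: algebra_simps)
  ultimately show ?thesis
    unfolding JMdeg_xi_def using JMdeg_add by blast
qed

lemma JMdeg_xi_JMdeg: "x \<in> JMdeg_xi n r \<Longrightarrow> x \<in> JMdeg n r"
  by (auto simp: JMdeg_xi_def intro!: JMdeg_add JMdeg_scal intro: JMdeg_mono [of _ n "r - Suc 0" n r])

lemma JMdeg_xi_mono: "x \<in> JMdeg_xi m r \<Longrightarrow> m \<le> n \<Longrightarrow> x \<in> JMdeg_xi n r"
  unfolding JMdeg_xi_def using JMdeg_mono [OF _ _ order_refl] by blast

lemma JMdeg_xi_mult:
  assumes "x \<in> JMdeg_xi n r" "y \<in> JMdeg n (Suc s)" "1 \<le> r"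
  shows "x * y \<in> JMdeg_xi n (r + s)"
proof -
  obtain u v where x: "x = u + scal xi * v" "u \<in> JMdeg n (r - 1)" "v \<in> JMdeg n r"
    using assms(1) by (auto simp: JMdeg_xi_def)
  have "u * y \<in> JMdeg n (r + s - 1)" "v * y \<in> JMdeg n (r + s)"
    using JMdeg_mult [OF x(2) assms(2)] JMdeg_mult [OF x(3) assms(2)] assms(3) by simp_all
  then show ?thesis
    unfolding x(1) distrib_right mult.assoc by (intro JMdeg_xi_add JMdeg_xi_I1 JMdeg_xi_I2)
qed

definition cond_exp :: "nat \<Rightarrow> nat \<Rightarrow> hecke_fin set" where
  "cond_exp n r = {x. \<exists>d\<in>JMdeg_xi n r. eq_on n x d}"

lemma cond_exp_add: "x \<in> cond_exp n r \<Longrightarrow> y \<in> cond_exp n r \<Longrightarrow> x + y \<in> cond_exp n r"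
  unfolding cond_exp_def by (auto intro: JMdeg_xi_add eq_on_add)

lemma cond_exp_0: "0 \<in> cond_exp n r"
  unfolding cond_exp_def using JMdeg_xi_I1 [OF JMdeg_zero] eq_on_refl by blast

lemma cond_exp_sum: "(\<And>i. i \<in> I \<Longrightarrow> f i \<in> cond_exp n r) \<Longrightarrow> (\<Sum>i\<in>I. f i) \<in> cond_exp n r"
  by (induction I rule: infinite_finite_induct) (auto intro: cond_exp_0 cond_exp_add)

lemma cond_exp_I: "eq_on n x d \<Longrightarrow> d \<in> JMdeg_xi n r \<Longrightarrow> x \<in> cond_exp n r"
  unfolding cond_exp_def by blast

text \<open>
  The conditional expectations of \<open>L\<^sub>n\<^sub>+\<^sub>1\<^sup>a\<close> and \<open>L\<^sub>n\<^sub>+\<^sub>1\<^sup>a T\<^sub>n\<close> onto \<open>H\<^sub>n\<close>: passing to \<open>H\<^sub>n\<close> lowers the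
  degree by one, and modulo \<open>\<xi>\<close> the leading term is \<open>0\<close> and \<open>L\<^sub>n\<^sup>a\<^sup>-\<^sup>1\<close>, respectively.
\<close>

definition cond_exp_T :: "nat \<Rightarrow> nat \<Rightarrow> bool" where
  "cond_exp_T n a \<longleftrightarrow> (\<exists>e\<in>JMdeg n a. e - JM n ^ (a - 1) \<in> JMdeg_xi n a \<and> eq_on n (JM (Suc n) ^ a * T n) e)"

lemma JM_rest_sum:
  "JM_rest n b = (\<Sum>i<b. scal xi * (JM (Suc n) ^ Suc i * JM n ^ (b - 1 - i)) + JM (Suc n) ^ i * JM n ^ (b - 1 - i))"
proof (induction b)
  case (Suc b)
  have "JM (Suc n) * (scal xi * (JM (Suc n) ^ Suc i * x) + JM (Suc n) ^ i * x)
    = scal xi * (JM (Suc n) ^ Suc (Suc i) * x) + JM (Suc n) ^ Suc i * x" for i x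
    by (simp add: distrib_left mult.assoc mult_scal)
  then have "JM (Suc n) * JM_rest n b = (\<Sum>i<b. scal xi * (JM (Suc n) ^ Suc (Suc i) * JM n ^ (b - 1 - i))
      + JM (Suc n) ^ Suc i * JM n ^ (b - 1 - i))"
    unfolding Suc by (simp add: sum_distrib_left)
  moreover have "(scal xi * JM (Suc n) + 1) * JM n ^ b = scal xi * (JM (Suc n) ^ Suc 0 * JM n ^ b) + JM n ^ b"
    by (simp add: distrib_right mult.assoc)
  ultimately show ?case
    unfolding sum.lessThan_Suc_shift by (simp add: algebra_simps)
qed simp

text \<open>The power of \<open>JM n\<close> lies in H_n and comes out of the expectation. For i = 0
  the witness is 0: \<open>T n\<close> has expectation zero, and \<open>JMdeg n 0\<close> contains
  nothing else.\<close>

lemma cond_exp_T_term: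
  assumes n: "1 \<le> n" and i: "i = 0 \<or> cond_exp_T n i"
  shows "\<exists>e\<in>JMdeg n i. eq_on n (JM (Suc n) ^ i * JM n ^ c * T n) (e * JM n ^ c)"
proof -
  have "\<exists>e\<in>JMdeg n i. eq_on n (JM (Suc n) ^ i * T n) e"
  proof (cases "i = 0")
    case True
    then show ?thesis
      using eq_on_T_0 [of n] JMdeg_zero [of n 0] by auto
  next
    case False
    then show ?thesis
      using i by (auto simp: cond_exp_T_def)
  qed
  then obtain e where e: "e \<in> JMdeg n i" "eq_on n (JM (Suc n) ^ i * T n) e"
    by blast
  have L: "JM n ^ c \<in> Hsub n"
    by (intro Hsub_power Hsub_JM)
  have "JM (Suc n) ^ i * JM n ^ c * T n = JM n ^ c * (JM (Suc n) ^ i * T n)"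
    using JM_power_commute_Hsub [OF L, of i] by (simp flip: mult.assoc)
  moreover have "e * JM n ^ c = JM n ^ c * e"
    using JMdeg_commute [OF e(1) JMdeg_JM_power [of n n c]] n by simp
  ultimately show ?thesis
    using e eq_on_mult_left [OF e(2) L] by metis
qed

text \<open>One factor is opened as T_n L_n T_n + T_n, and its left \<open>T n\<close> is moved to
  the front past the other b factors. What results is T_n L_n^(b+1) T_n, whose expectation is that
  of L_n^(b+1) one level down, and terms ending in \<open>T n\<close> with exponent at most b on the
  top variable, covered by \<open>less\<close>.\<close>

lemma cond_exp_step:
  assumes n: "1 \<le> n"
    and prev: "\<And>a. 1 \<le> a \<Longrightarrow> JM n ^ a \<in> cond_exp (n - 1) a"
    and less: "\<And>i. 1 \<le> i \<Longrightarrow> i \<le> b \<Longrightarrow> cond_exp_T n i"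
  shows "JM (Suc n) ^ Suc b \<in> cond_exp n (Suc b)"
proof -
  let ?L' = "JM (Suc n)" and ?L = "JM n"
  have E: "i = 0 \<or> cond_exp_T n i" if "i \<le> b" for i
    using less [of i] that by (cases i) auto
  have "?L' ^ Suc b = ?L' ^ b * T n * ?L * T n + ?L' ^ b * T n"
    unfolding power_Suc2 using n by (simp add: JM_Suc distrib_left mult.assoc)
  also have "?L' ^ b * T n * ?L * T n = T n * ?L ^ Suc b * T n + JM_rest n b * ?L * T n"
    unfolding JM_Suc_power_T [OF n] power_Suc2 by (simp add: distrib_right mult.assoc)
  also have "JM_rest n b * ?L * T n = (\<Sum>i<b. scal xi * (?L' ^ Suc i * ?L ^ (b - i) * T n) + ?L' ^ i * ?L ^ (b - i) * T n)"
  proof -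
    have "?L ^ (b - Suc i) * ?L = ?L ^ (b - i)" if "i < b" for i
      using that by (simp add: Suc_diff_Suc flip: power_Suc2)
    then have *: "?L ^ (b - Suc i) * (?L * x) = ?L ^ (b - i) * x" if "i < b" for i x
      using that by (simp flip: mult.assoc)
    show ?thesis
      unfolding JM_rest_sum sum_distrib_right by (intro sum.cong) (simp_all add: distrib_right mult.assoc *)
  qed
  finally have eq: "?L' ^ Suc b = (T n * ?L ^ Suc b * T n
     + (\<Sum>i<b. scal xi * (?L' ^ Suc i * ?L ^ (b - i) * T n) + ?L' ^ i * ?L ^ (b - i) * T n)) + ?L' ^ b * T n" .
  have "T n * ?L ^ Suc b * T n \<in> cond_exp n (Suc b)"
  proof -
    obtain d where d: "d \<in> JMdeg_xi (n - 1) (Suc b)" "eq_on (n - 1) (?L ^ Suc b) d"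
      using prev [of "Suc b"] by (auto simp: cond_exp_def)
    have "eq_on n (T n * ?L ^ Suc b * T n) d"
      using n d Hsub_power [OF Hsub_JM] JMdeg_Hsub [OF JMdeg_xi_JMdeg] by (intro eq_on_T_mult_T) blast+
    then show ?thesis
      using JMdeg_xi_mono [OF d(1), of n] by (intro cond_exp_I) auto
  qed
  moreover have "scal xi * (?L' ^ Suc i * ?L ^ (b - i) * T n) + ?L' ^ i * ?L ^ (b - i) * T n \<in> cond_exp n (Suc b)"
    if "i < b" for i
  proof (rule cond_exp_add)
    obtain e where e: "e \<in> JMdeg n (Suc i)" "eq_on n (?L' ^ Suc i * ?L ^ (b - i) * T n) (e * ?L ^ (b - i))"
      using cond_exp_T_term [OF n E [of "Suc i"]] \<open>i < b\<close> Suc_leI by blast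
    have "e * ?L ^ (b - i) \<in> JMdeg n (Suc b)"
      using JMdeg_mult [OF e(1) JMdeg_JM_power [of n n "b - i"]] n \<open>i < b\<close> by simp
    then show "scal xi * (?L' ^ Suc i * ?L ^ (b - i) * T n) \<in> cond_exp n (Suc b)"
      by (intro cond_exp_I [OF eq_on_scal [OF e(2)]] JMdeg_xi_I2)
  next
    obtain e where e: "e \<in> JMdeg n i" "eq_on n (?L' ^ i * ?L ^ (b - i) * T n) (e * ?L ^ (b - i))"
      using cond_exp_T_term [OF n E [of i]] \<open>i < b\<close> less_imp_le by blast
    have "e * ?L ^ (b - i) \<in> JMdeg n b"
      using JMdeg_mult [OF e(1) JMdeg_JM_power [of n n "b - i"]] n \<open>i < b\<close> by simp
    then show "?L' ^ i * ?L ^ (b - i) * T n \<in> cond_exp n (Suc b)"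
      by (intro cond_exp_I [OF e(2)] JMdeg_xi_I1) simp
  qed
  then have "(\<Sum>i<b. scal xi * (?L' ^ Suc i * ?L ^ (b - i) * T n) + ?L' ^ i * ?L ^ (b - i) * T n) \<in> cond_exp n (Suc b)"
    by (intro cond_exp_sum) auto
  moreover have "?L' ^ b * T n \<in> cond_exp n (Suc b)"
  proof -
    obtain e where e: "e \<in> JMdeg n b" "eq_on n (?L' ^ b * T n) e"
      using cond_exp_T_term [OF n E [of b], of 0] by auto
    then show ?thesis
      by (intro cond_exp_I JMdeg_xi_I1) auto
  qed
  ultimately show ?thesis
    unfolding eq by (intro cond_exp_add)
qed

text \<open>Rests on L_{n+1} T_n = T_n L_n + \<xi> L_{n+1} + 1: the first term multiplies the
  leading term at exponent b by L_n, and the constant 1 provides the leading term when b =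
  0.\<close>

lemma cond_exp_T_step:
  assumes n: "1 \<le> n"
    and cond_exp: "\<And>a. 1 \<le> a \<Longrightarrow> a \<le> Suc b \<Longrightarrow> JM (Suc n) ^ a \<in> cond_exp n a"
    and less: "b = 0 \<or> cond_exp_T n b"
  shows "cond_exp_T n (Suc b)"
proof -
  let ?L' = "JM (Suc n)" and ?L = "JM n"
  obtain d where d: "d \<in> JMdeg_xi n (Suc b)" "eq_on n (?L' ^ Suc b) d"
    using cond_exp [of "Suc b"] by (auto simp: cond_exp_def)
  have eq: "?L' ^ Suc b * T n = ?L' ^ b * T n * ?L + scal xi * ?L' ^ Suc b + ?L' ^ b"
    unfolding power_Suc2 mult.assoc JM_Suc_T [OF n] by (simp add: distrib_left mult.assoc mult_scal power_commutes)
  show ?thesis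
  proof (cases "b = 0")
    case True
    have "eq_on n (?L' ^ Suc b * T n) (0 * ?L + scal xi * d + 1)"
      unfolding eq using True d eq_on_T_0 Hsub_JM by (intro eq_on_add eq_on_scal eq_on_mult) auto
    moreover have "0 * ?L + scal xi * d + 1 \<in> JMdeg n (Suc b)"
      by (intro JMdeg_add JMdeg_scal JMdeg_one JMdeg_xi_JMdeg [OF d(1)]) (simp add: JMdeg_zero)
    moreover have "0 * ?L + scal xi * d + 1 - ?L ^ (Suc b - 1) \<in> JMdeg_xi n (Suc b)"
      using True d by (auto intro: JMdeg_xi_I2 JMdeg_xi_JMdeg)
    ultimately show ?thesis
      unfolding cond_exp_T_def by blast
  next
    case False
    then obtain e where e: "e \<in> JMdeg n b" "e - ?L ^ (b - 1) \<in> JMdeg_xi n b" "eq_on n (?L' ^ b * T n) e"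
      using less by (auto simp: cond_exp_T_def)
    obtain d' where d': "d' \<in> JMdeg_xi n b" "eq_on n (?L' ^ b) d'"
      using cond_exp [of b] False by (auto simp: cond_exp_def)
    have L: "?L \<in> JMdeg n (Suc 1)"
      using JMdeg_JM_power [of n n 1] n by simp
    have "eq_on n (?L' ^ Suc b * T n) (e * ?L + scal xi * d + d')"
      unfolding eq using d d' e Hsub_JM by (intro eq_on_add eq_on_scal eq_on_mult) auto
    moreover have "e * ?L + scal xi * d + d' \<in> JMdeg n (Suc b)"
      using JMdeg_mult [OF e(1) L] JMdeg_mono [OF JMdeg_xi_JMdeg [OF d'(1)], of n "Suc b"]
      by (intro JMdeg_add JMdeg_scal JMdeg_xi_JMdeg [OF d(1)]) auto
    moreover have "e * ?L + scal xi * d + d' - ?L ^ (Suc b - 1) \<in> JMdeg_xi n (Suc b)"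
    proof -
      have "e * ?L + scal xi * d + d' - ?L ^ (Suc b - 1) = (e - ?L ^ (b - 1)) * ?L + scal xi * d + d'"
        using False by (cases b) (simp_all add: algebra_simps power_commutes)
      also have "\<dots> \<in> JMdeg_xi n (Suc b)"
        using JMdeg_xi_mult [OF e(2) L] False d JMdeg_xi_JMdeg [OF d'(1)]
        by (intro JMdeg_xi_add) (auto intro: JMdeg_xi_I2 JMdeg_xi_I1 JMdeg_xi_JMdeg)
      finally show ?thesis .
    qed
    ultimately show ?thesis
      unfolding cond_exp_T_def by blast
  qed
qed

text \<open>The claims feed each other: the plain power at exponent a uses level n - 1 and the
  products with \<open>T n\<close> at smaller exponents; the product at a uses plain powers up to a.
  The recursion is grounded in L_1 = 0.\<close>

lemma cond_exp_and_EXT: "(\<forall>a\<ge>1. JM (Suc n) ^ a \<in> cond_exp n a) \<and> (1 \<le> n \<longrightarrow> (\<forall>a\<ge>1. cond_exp_T n a))"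
proof (induction n)
  case 0
  have "(0::hecke_fin) ^ a \<in> cond_exp 0 a" if "1 \<le> a" for a
    using that cond_exp_0 by (simp add: power_0_left)
  then show ?case by simp
next
  case (Suc n)
  have "cond_exp_T (Suc n) a \<and> JM (Suc (Suc n)) ^ a \<in> cond_exp (Suc n) a" if "1 \<le> a" for a
    using that
  proof (induction a rule: less_induct)
    case (less a)
    then obtain b where a: "a = Suc b"
      by (cases a) auto
    have cond_exp: "JM (Suc (Suc n)) ^ Suc b \<in> cond_exp (Suc n) (Suc b)"
      using Suc less by (intro cond_exp_step) (auto simp: a)
    have "cond_exp_T (Suc n) (Suc b)"
    proof (rule cond_exp_T_step)
      fix c assume "1 \<le> c" "c \<le> Suc b"
      then show "JM (Suc (Suc n)) ^ c \<in> cond_exp (Suc n) c"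
        using cond_exp less by (cases "c = Suc b") (auto simp: a)
    qed (use less(1) [of b] in \<open>cases "b = 0", auto simp: a Suc_le_eq\<close>)
    with cond_exp show ?case
      by (simp add: a)
  qed
  then show ?case by simp
qed

lemma expectation_power:
  assumes "1 \<le> a"
  obtains d where "d \<in> JMdeg_xi n a" "eq_on n (JM (Suc n) ^ a) d"
  using cond_exp_and_EXT [of n] assms by (auto simp: cond_exp_def)

lemma expectation_power_T:
  assumes "1 \<le> a" "1 \<le> n"
  obtains e where "e \<in> JMdeg n a" "e - JM n ^ (a - 1) \<in> JMdeg_xi n a" "eq_on n (JM (Suc n) ^ a * T n) e"
  using cond_exp_and_EXT [of n] assms by (auto simp: cond_exp_T_def)

text \<open>The Coxeter product ends in \<open>T n\<close>; the rest of it lies in H_n, hence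
  commutes with L_{n+1} and can be moved cyclically behind \<open>T n\<close>.\<close>

lemma tau_top_eq:
  assumes n: "1 \<le> n" and y: "y \<in> Hsub n" and nJ: "n \<in> J"
  shows "tau (JM (Suc n) ^ a * y * Tcox J 1 (Suc n)) = tau (JM (Suc n) ^ a * T n * (y * Tcox (J - {n}) 1 n))"
proof -
  have Tcox: "Tcox J (Suc 0) n = Tcox (J - {n}) (Suc 0) n"
    by (intro Tcox_cong) auto
  let ?h = "y * Tcox (J - {n}) 1 n"
  have h: "?h \<in> Hsub n"
    using y by (intro Hsub_mult Hsub_Tcox) auto
  have "tau (JM (Suc n) ^ a * y * Tcox J 1 (Suc n)) = tau (JM (Suc n) ^ a * ?h * T n)"
    using n nJ by (simp add: Tcox_Suc Tcox mult.assoc)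
  also have "\<dots> = tau (?h * JM (Suc n) ^ a * T n)"
    using JM_power_commute_Hsub [OF h] by simp
  also have "\<dots> = tau (JM (Suc n) ^ a * T n * ?h)"
    by (metis tau_commute mult.assoc)
  finally show ?thesis .
qed

text \<open>Integrating out the top variable: if n is not in J, the expectation of a positive power
  loses one degree; if n is in J, the power absorbs \<open>T n\<close>, and the degree and the
  length of the Coxeter element drop by one together. If n is in J but the power is trivial, the
  trace is zero because \<open>T n\<close> has expectation zero.\<close>

lemma JMdeg_vanish:
  "x \<in> JMdeg n r \<Longrightarrow> J \<subseteq> {1..<n} \<Longrightarrow> r \<le> card J \<Longrightarrow> tau (x * Tcox J 1 n) = 0"
proof (induction n arbitrary: x r J)
  case 0
  then show ?case
    using JMdeg_0 [of x 0] by auto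
next
  case (Suc n)
  have fin: "finite J"
    using Suc.prems(2) finite_subset by blast
  from Suc.prems(1) show ?case
  proof (induction rule: JMdeg_Suc_induct)
    case (top a y)
    have y: "y \<in> Hsub n"
      using top by (auto intro: JMdeg_Hsub)
    show ?case
    proof (cases "n \<in> J")
      case False
      then have J: "J \<subseteq> {1..<n}"
        using Suc.prems(2) by (auto simp: less_Suc_eq)
      have n: "1 \<le> n \<or> J = {}"
        using J by auto
      have Tcox: "Tcox J (Suc 0) (Suc n) = Tcox J (Suc 0) n"
        using False by (cases "n = 0") (auto simp: Tcox_Suc)
      show ?thesis
      proof (cases "a = 0")
        case True
        then show ?thesis
          using Suc.IH [OF _ J Suc.prems(3)] top by (simp add: Tcox)
      next
        case False
        then obtain d where d: "d \<in> JMdeg_xi n a" "eq_on n (JM (Suc n) ^ a) d"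
          using expectation_power [of a n] by (metis One_nat_def Suc_leI neq0_conv)
        have "tau (JM (Suc n) ^ a * y * Tcox J 1 (Suc n)) = tau (d * y * Tcox J 1 n)"
          using eq_on_Tcox [OF eq_on_mult [OF d(2) y]] by (simp add: Tcox)
        also have "\<dots> = 0"
          using Suc.IH [OF JMdeg_mult [OF JMdeg_xi_JMdeg [OF d(1)] top(2)] J] top Suc.prems(3) by simp
        finally show ?thesis .
      qed
    next
      case True
      then have n: "1 \<le> n"
        using Suc.prems(2) by auto
      let ?J = "J - {n}"
      have J: "?J \<subseteq> {1..<n}"
        using Suc.prems(2) by (auto simp: less_Suc_eq)
      show ?thesis
      proof (cases "a = 0")
        case True
        then show ?thesis
          unfolding tau_top_eq [OF n y \<open>n \<in> J\<close>]
          using tau_mult_T_eq_0 [OF Hsub_mult [OF y Hsub_Tcox [of 1 ?J n]]] by (simp add: tau_commute [of "T n"])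
      next
        case False
        then obtain e where e: "e \<in> JMdeg n a" "eq_on n (JM (Suc n) ^ a * T n) e"
          using expectation_power_T [of a n] n by (metis One_nat_def Suc_leI neq0_conv)
        have "tau (JM (Suc n) ^ a * y * Tcox J 1 (Suc n)) = tau (e * y * Tcox ?J 1 n)"
          unfolding tau_top_eq [OF n y \<open>n \<in> J\<close>] mult.assoc [symmetric]
          by (rule eq_on_Tcox [OF eq_on_mult [OF e(2) y]])
        also have "\<dots> = 0"
          using Suc.IH [OF JMdeg_mult [OF e(1) top(2)] J] top Suc.prems(3) fin \<open>n \<in> J\<close> by simp
        finally show ?thesis .
      qed
    qed
  qed (simp_all add: distrib_right)
qed

text \<open>The factor L_{n+1} pays for itself: n is not in J, so the expectation of L_{n+1}^(a+1)
  has degree at most a, as if the factor were absent.\<close>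

lemma JM_JMdeg_vanish:
  assumes "x \<in> JMdeg (Suc n) r" "J \<subseteq> {1..<n}" "r \<le> card J"
  shows "tau (JM (Suc n) * x * Tcox J 1 (Suc n)) = 0"
  using assms(1)
proof (induction rule: JMdeg_Suc_induct)
  case (top a y)
  have y: "y \<in> Hsub n"
    using top by (auto intro: JMdeg_Hsub)
  have Tcox: "Tcox J (Suc 0) (Suc n) = Tcox J (Suc 0) n"
    using assms(2) by (cases "n = 0") (auto simp: Tcox_Suc)
  obtain d where d: "d \<in> JMdeg_xi n (Suc a)" "eq_on n (JM (Suc n) ^ Suc a) d"
    by (rule expectation_power [of "Suc a" n]) simp_all
  have "tau (JM (Suc n) * (JM (Suc n) ^ a * y) * Tcox J 1 (Suc n)) = tau (JM (Suc n) ^ Suc a * y * Tcox J 1 n)"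
    by (simp add: Tcox mult.assoc)
  also have "\<dots> = tau (d * y * Tcox J 1 n)"
    by (rule eq_on_Tcox [OF eq_on_mult [OF d(2) y]])
  also have "\<dots> = 0"
    using JMdeg_vanish [OF JMdeg_mult [OF JMdeg_xi_JMdeg [OF d(1)] top(2)] assms(2)] top assms(3) by simp
  finally show ?case .
qed (simp_all add: distrib_right distrib_left)

section \<open>Leading coefficients of power sums\<close>

primrec JMmonom :: "(nat \<Rightarrow> nat) \<Rightarrow> nat \<Rightarrow> hecke_fin" where
  "JMmonom f 0 = 1"
| "JMmonom f (Suc n) = JM (Suc n) ^ f (Suc n) * JMmonom f n"

lemma JMmonom_cong: "(\<And>i. 1 \<le> i \<Longrightarrow> i \<le> n \<Longrightarrow> f i = g i) \<Longrightarrow> JMmonom f n = JMmonom g n"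
  by (induction n) auto

lemma JMmonom_JMdeg: "JMmonom f n \<in> JMdeg n (Suc (\<Sum>i=1..n. f i))"
proof (induction n)
  case (Suc n)
  then have *: "JMmonom f n \<in> JMdeg (Suc n) (Suc (\<Sum>i=1..n. f i))"
    by (rule JMdeg_mono) auto
  have "JM (Suc n) ^ f (Suc n) * JMmonom f n \<in> JMdeg (Suc n) (Suc (f (Suc n)) + Suc (\<Sum>i=1..n. f i) - 1)"
    by (intro JMdeg_mult JMdeg_JM_power *) auto
  then show ?case
    by (simp add: add.commute)
qed (simp add: JMdeg_one)

lemma JMmonom_Hsub: "JMmonom f n \<in> Hsub n"
  using JMmonom_JMdeg by (rule JMdeg_Hsub)

lemma JMmonom_add:
  assumes "1 \<le> i" "i \<le> n"
  shows "JMmonom (f(i := f i + k)) n = JMmonom f n * JM i ^ k"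
  using assms
proof (induction n)
  case (Suc n)
  show ?case
  proof (cases "i = Suc n")
    case True
    define g where "g = f(i := f i + k)"
    have "JMmonom g n = JMmonom f n" "g (Suc n) = f (Suc n) + k"
      using True by (auto simp: g_def intro: JMmonom_cong)
    then have "JMmonom g (Suc n) = JMmonom f (Suc n) * JM i ^ k"
      using True JM_power_commute_Hsub [OF JMmonom_Hsub [of f n], of k] by (simp add: power_add mult.assoc)
    then show ?thesis
      unfolding g_def .
  next
    case False
    then show ?thesis
      using Suc by (simp add: mult.assoc)
  qed
qed simp

text \<open>
  \<open>top_nonzero J n f\<close> decides whether the coefficient of the monomial with exponents \<open>f\<close> at the Coxeter
  element of \<open>J\<close> is nonzero modulo \<open>\<xi>\<close>, where the degree equals the size of \<open>J\<close>.
\<close>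

primrec top_nonzero :: "nat set \<Rightarrow> nat \<Rightarrow> (nat \<Rightarrow> nat) \<Rightarrow> bool" where
  "top_nonzero J 0 f \<longleftrightarrow> True"
| "top_nonzero J (Suc n) f \<longleftrightarrow> (if n \<in> J then 1 \<le> f (Suc n) \<and> top_nonzero J n (f(n := f n + (f (Suc n) - 1)))
     else f (Suc n) = 0 \<and> top_nonzero J n f)"

lemma top_nonzero_cong: "(\<And>i. i \<le> n \<Longrightarrow> f i = g i) \<Longrightarrow> top_nonzero J n f = top_nonzero J n g"
proof (induction n arbitrary: f g)
  case (Suc n)
  have "top_nonzero J n (f(n := f n + (f (Suc n) - 1))) = top_nonzero J n (g(n := g n + (g (Suc n) - 1)))"
    "top_nonzero J n f = top_nonzero J n g"
    using Suc.prems by (intro Suc.IH; simp)+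
  then show ?case
    using Suc.prems [of "Suc n"] by simp
qed simp

lemma sum_upd:
  fixes f :: "nat \<Rightarrow> nat"
  assumes "finite A" "i \<in> A"
  shows "sum (f(i := f i + k)) A = sum f A + k"
  using assms by (simp add: sum.remove [of A i])

lemma poly_xi_0 [simp]: "poly xi 0 = 0"
  by (simp add: xi_def)

text \<open>In the critical degree the lower terms vanish at J and multiples of \<xi> are ignored,
  so every integration keeps at most one monomial: without n in J only exponent 0 survives, with n
  in J a power L_{n+1}^a becomes L_n^(a-1).\<close>

lemma tau_JMmonom:
  "J \<subseteq> {1..<n} \<Longrightarrow> card J = (\<Sum>i=1..n. f i) \<Longrightarrow>
    poly (tau (JMmonom f n * Tcox J 1 n)) 0 = of_bool (top_nonzero J n f)"
proof (induction n arbitrary: f J)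
  case 0
  then show ?case by (simp add: tau_def coef_1)
next
  case (Suc n)
  have fin: "finite J"
    using Suc.prems finite_subset by blast
  let ?a = "f (Suc n)" and ?y = "JMmonom f n"
  have y: "?y \<in> Hsub n"
    by (rule JMmonom_Hsub)
  have card: "card J = (\<Sum>i=1..n. f i) + ?a"
    using Suc.prems by simp
  show ?case
  proof (cases "n \<in> J")
    case False
    then have J: "J \<subseteq> {1..<n}"
      using Suc.prems by (auto simp: less_Suc_eq)
    have Tcox: "Tcox J (Suc 0) (Suc n) = Tcox J (Suc 0) n"
      using False by (cases "n = 0") (auto simp: Tcox_Suc)
    show ?thesis
    proof (cases "?a = 0")
      case True
      then show ?thesis
        using Suc.IH [OF J, of f] card False by (simp add: Tcox)
    next
      case a: False
      then obtain d where d: "d \<in> JMdeg_xi n ?a" "eq_on n (JM (Suc n) ^ ?a) d"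
        using expectation_power [of ?a n] by (metis One_nat_def Suc_leI neq0_conv)
      then obtain u v where uv: "d = u + scal xi * v" "u \<in> JMdeg n (?a - 1)"
        by (auto simp: JMdeg_xi_def)
      have "tau (JMmonom f (Suc n) * Tcox J 1 (Suc n)) = tau (d * ?y * Tcox J 1 n)"
        using eq_on_Tcox [OF eq_on_mult [OF d(2) y]] by (simp add: Tcox)
      also have "\<dots> = tau (u * ?y * Tcox J 1 n) + xi * tau (v * ?y * Tcox J 1 n)"
        by (simp add: uv distrib_right mult.assoc)
      also have "tau (u * ?y * Tcox J 1 n) = 0"
        using JMdeg_vanish [OF JMdeg_mult [OF uv(2) JMmonom_JMdeg] J] card by simp
      finally show ?thesis
        using False a by simp
    qed
  next
    case True
    then have n: "1 \<le> n"
      using Suc.prems by auto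
    let ?J = "J - {n}"
    have J: "?J \<subseteq> {1..<n}"
      using Suc.prems by (auto simp: less_Suc_eq)
    have cardJ: "card J = Suc (card ?J)"
      using True fin by (metis card_Suc_Diff1)
    show ?thesis
    proof (cases "?a = 0")
      case a: True
      have "tau (JM (Suc n) ^ ?a * ?y * Tcox J 1 (Suc n)) = 0"
        unfolding tau_top_eq [OF n y True]
        using a tau_mult_T_eq_0 [OF Hsub_mult [OF y Hsub_Tcox [of 1 ?J n]]] by (simp add: tau_commute [of "T n"])
      then show ?thesis
        using True a by simp
    next
      case a: False
      then obtain e where e: "e - JM n ^ (?a - 1) \<in> JMdeg_xi n ?a" "eq_on n (JM (Suc n) ^ ?a * T n) e"
        using expectation_power_T [of ?a n] n by (metis One_nat_def Suc_leI neq0_conv)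
      then obtain u v where "e - JM n ^ (?a - 1) = u + scal xi * v" and u: "u \<in> JMdeg n (?a - 1)"
        by (auto simp: JMdeg_xi_def)
      then have ee: "e = JM n ^ (?a - 1) + u + scal xi * v"
        by (simp add: algebra_simps)
      let ?f = "f(n := f n + (?a - 1))"
      have mon: "JM n ^ (?a - 1) * ?y = JMmonom ?f n"
        using JMmonom_add [of n n f "?a - 1"] n JMdeg_commute [OF JMmonom_JMdeg [of f n] JMdeg_JM_power [of n n "?a - 1"]]
        by simp
      have f: "sum ?f {1..n} = sum f {1..n} + (?a - 1)"
        using n by (intro sum_upd) auto
      have "tau (JM (Suc n) ^ ?a * ?y * Tcox J 1 (Suc n)) = tau (e * ?y * Tcox ?J 1 n)"
        unfolding tau_top_eq [OF n y True] mult.assoc [symmetric]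
        by (rule eq_on_Tcox [OF eq_on_mult [OF e(2) y]])
      also have "\<dots> = tau (JMmonom ?f n * Tcox ?J 1 n) + tau (u * ?y * Tcox ?J 1 n) + xi * tau (v * ?y * Tcox ?J 1 n)"
        unfolding ee distrib_right mon [symmetric] by (simp add: mult.assoc)
      also have "tau (u * ?y * Tcox ?J 1 n) = 0"
        using JMdeg_vanish [OF JMdeg_mult [OF u JMmonom_JMdeg] J] card cardJ a by simp
      finally have "poly (tau (JMmonom f (Suc n) * Tcox J 1 (Suc n))) 0 = poly (tau (JMmonom ?f n * Tcox ?J 1 n)) 0"
        by (simp only: JMmonom.simps poly_add poly_mult poly_xi_0 poly_0 mult_zero_left add_0_right)
      also have "\<dots> = of_bool (top_nonzero ?J n ?f)"
        using card cardJ a f by (intro Suc.IH J) simp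
      also have "top_nonzero ?J n ?f = top_nonzero J n ?f"
      proof -
        have "top_nonzero (J - {n}) m g = top_nonzero J m g" if "m \<le> n" for m g
          using that by (induction m arbitrary: g) auto
        then show ?thesis by simp
      qed
      finally show ?thesis
        using True a by simp
    qed
  qed
qed

section \<open>Products of power sums and distributions of exponents over variables\<close>

definition psums :: "nat \<Rightarrow> nat list \<Rightarrow> hecke_fin" where
  "psums n ks = prod_list (map (psum n) ks)"

text \<open>Expanding the product of power sums, this counts the ways to distribute the exponents
  \<open>ks\<close> over the variables, on top of \<open>f\<close>, such that the monomial
  survives.\<close>

primrec top_count :: "nat set \<Rightarrow> nat \<Rightarrow> nat list \<Rightarrow> (nat \<Rightarrow> nat) \<Rightarrow> int" where
  "top_count J n [] f = of_bool (top_nonzero J n f)"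
| "top_count J n (k # ks) f = (\<Sum>i=1..n. top_count J n ks (f(i := f i + k)))"

lemma tau_psums:
  "J \<subseteq> {1..<n} \<Longrightarrow> card J = (\<Sum>i=1..n. f i) + sum_list ks \<Longrightarrow>
    poly (tau (JMmonom f n * psums n ks * Tcox J 1 n)) 0 = top_count J n ks f"
proof (induction ks arbitrary: f)
  case Nil
  then show ?case
    using tau_JMmonom [of J n f] by (simp add: psums_def)
next
  case (Cons k ks)
  have "JMmonom f n * psums n (k # ks) * Tcox J 1 n
    = (\<Sum>i=1..n. JMmonom (f(i := f i + k)) n * psums n ks * Tcox J 1 n)"
    by (simp add: psums_def psum_def JMmonom_add sum_distrib_left sum_distrib_right mult.assoc)
  moreover have "poly (tau (JMmonom (f(i := f i + k)) n * psums n ks * Tcox J 1 n)) 0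
      = top_count J n ks (f(i := f i + k))" if "i \<in> {1..n}" for i
    using Cons.prems sum_upd [of "{1..n}" i f k] that by (intro Cons.IH) auto
  ultimately show ?case
    by (simp add: poly_sum)
qed

lemma top_count_nonneg: "0 \<le> top_count J n ks f"
  by (induction ks arbitrary: f) (auto intro: sum_nonneg)

text \<open>Items are pairs of a variable and an exponent; the result is their exponent vector, in
  which several items on one variable add up.\<close>

definition load :: "(nat \<times> nat) list \<Rightarrow> nat \<Rightarrow> nat" where
  "load its i = sum_list (map snd (filter (\<lambda>p. fst p = i) its))"

lemma load_Nil [simp]: "load [] i = 0"
  and load_Cons: "load (p # its) i = (if fst p = i then snd p else 0) + load its i"
  by (simp_all add: load_def)

text \<open>All contributions are nonnegative, so nothing cancels and one surviving distribution is
  enough.\<close>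

lemma top_count_neq_0_iff:
  "top_count J n ks f \<noteq> 0 \<longleftrightarrow> (\<exists>its. map snd its = ks \<and> fst ` set its \<subseteq> {1..n} \<and> top_nonzero J n (\<lambda>i. f i + load its i))"
proof (induction ks arbitrary: f)
  case (Cons k ks)
  have load: "(\<lambda>j. (f(i := f i + k)) j + load its j) = (\<lambda>j. f j + load ((i, k) # its) j)" for i its
    by (rule ext) (simp add: load_Cons)
  have "top_count J n (k # ks) f \<noteq> 0 \<longleftrightarrow> (\<exists>i\<in>{1..n}. top_count J n ks (f(i := f i + k)) \<noteq> 0)"
    by (simp add: sum_nonneg_eq_0_iff top_count_nonneg)
  also have "\<dots> \<longleftrightarrow> (\<exists>i\<in>{1..n}. \<exists>its. map snd its = ks \<and> fst ` set its \<subseteq> {1..n}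
      \<and> top_nonzero J n (\<lambda>j. f j + load ((i, k) # its) j))"
    by (simp only: Cons.IH load)
  also have "\<dots> \<longleftrightarrow> (\<exists>its. map snd its = k # ks \<and> fst ` set its \<subseteq> {1..n} \<and> top_nonzero J n (\<lambda>j. f j + load its j))"
    (is "?A \<longleftrightarrow> ?B")
  proof
    assume ?A
    then obtain i its where "i \<in> {1..n}" "map snd its = ks" "fst ` set its \<subseteq> {1..n}"
      "top_nonzero J n (\<lambda>j. f j + load ((i, k) # its) j)"
      by blast
    then have "map snd ((i, k) # its) = k # ks \<and> fst ` set ((i, k) # its) \<subseteq> {1..n}
        \<and> top_nonzero J n (\<lambda>j. f j + load ((i, k) # its) j)"
      by simp
    then show ?B ..
  next
    assume ?B
    then obtain its where its: "map snd its = k # ks" "fst ` set its \<subseteq> {1..n}"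
      "top_nonzero J n (\<lambda>j. f j + load its j)"
      by (elim exE conjE) (rule that)
    then obtain i its' where eq: "its = (i, k) # its'"
      by (cases its) auto
    then have "i \<in> {1..n}" "map snd its' = ks" "fst ` set its' \<subseteq> {1..n}"
      using its(1,2) by simp_all
    moreover have "top_nonzero J n (\<lambda>j. f j + load ((i, k) # its') j)"
      using its(3) unfolding eq .
    ultimately show ?A
      by (intro bexI [of _ i] exI [of _ its'] conjI)
  qed
  finally show ?case .
qed simp

text \<open>Compositions \<open>bs\<close>, listed from the topmost block down, encode the sets of generators of
  parabolic subgroups.\<close>

primrec cgens :: "nat list \<Rightarrow> nat set" where
  "cgens [] = {}"
| "cgens (b # bs) = cgens bs \<union> {Suc (sum_list bs)..<sum_list bs + b}"

lemma cgens_subset: "cgens bs \<subseteq> {1..<sum_list bs}"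
  by (induction bs) auto

lemma finite_cgens [simp]: "finite (cgens bs)"
  by (induction bs) auto

lemma card_cgens: "card (cgens bs) = sum_list (map (\<lambda>b. b - 1) bs)"
proof (induction bs)
  case (Cons b bs)
  have "cgens bs \<inter> {Suc (sum_list bs)..<sum_list bs + b} = {}"
    using cgens_subset [of bs] by auto
  then show ?case
    using Cons by (simp add: card_Un_disjoint)
qed simp

lemma exists_composition: "J \<subseteq> {1..<n} \<Longrightarrow> \<exists>bs. 0 \<notin> set bs \<and> sum_list bs = n \<and> cgens bs = J"
proof (induction n arbitrary: J)
  case 0
  then show ?case by (intro exI [of _ "[]"]) auto
next
  case (Suc n)
  have "J - {n} \<subseteq> {1..<n}"
    using Suc.prems by (auto simp: less_Suc_eq)
  then obtain bs where bs: "0 \<notin> set bs" "sum_list bs = n" "cgens bs = J - {n}"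
    using Suc.IH by blast
  show ?case
  proof (cases "n \<in> J")
    case False
    then show ?thesis
      using bs by (intro exI [of _ "1 # bs"]) auto
  next
    case True
    then have "1 \<le> n"
      using Suc.prems by auto
    then obtain b bs' where b: "bs = b # bs'"
      using bs(2) by (cases bs) auto
    then have n: "n = sum_list bs' + b" "1 \<le> b"
      using bs(1,2) by auto
    then have "{Suc (sum_list bs')..<sum_list bs' + Suc b} = insert n {Suc (sum_list bs')..<sum_list bs' + b}"
      by auto
    then have "cgens (Suc b # bs') = insert n (cgens bs)"
      by (simp add: b)
    also have "\<dots> = J"
      using True unfolding bs(3) by (rule insert_Diff)
    finally show ?thesis
      using bs(1) b n by (intro exI [of _ "Suc b # bs'"]) simp
  qed
qed

definition ctype :: "nat list \<Rightarrow> ptn" where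
  "ctype bs = mset (map (\<lambda>b. b - 1) (filter (\<lambda>b. 1 < b) bs))"

lemma ctype_Nil [simp]: "ctype [] = {#}"
  and ctype_Cons: "ctype (b # bs) = (if 1 < b then add_mset (b - 1) (ctype bs) else ctype bs)"
  by (simp_all add: ctype_def)

lemma sum_ctype: "\<Sum>\<^sub># (ctype bs) = card (cgens bs)"
  unfolding card_cgens by (induction bs) (auto simp: ctype_Cons)

text \<open>Each generator of the block consumes one unit of exponent and hands the surplus to the
  next lower variable; at the bottom, where s is not in J, nothing may be left. The t - 1 generators
  therefore account for all units.\<close>

lemma top_nonzero_block:
  assumes "1 \<le> t" "{Suc s..<s + t} \<subseteq> J" "s \<notin> J" "top_nonzero J (s + t) f"
  shows "top_nonzero J s f \<and> (\<Sum>i=Suc s..s+t. f i) = t - 1"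
  using assms
proof (induction t arbitrary: f rule: dec_induct)
  case base
  then show ?case by simp
next
  case (step t)
  then have "s + t \<in> J"
    by auto
  define g where "g = f(s + t := f (s + t) + (f (Suc (s + t)) - 1))"
  have "1 \<le> f (Suc (s + t)) \<and> top_nonzero J (s + t) g"
    using step.prems(3) unfolding g_def add_Suc_right top_nonzero.simps if_P [OF \<open>s + t \<in> J\<close>] .
  then have c: "1 \<le> f (Suc (s + t))" "top_nonzero J (s + t) g"
    by blast+
  have "{Suc s..<s + t} \<subseteq> J"
    using step.prems(1) by auto
  note IH = step.IH [OF this step.prems(2) c(2)]
  have "sum g {Suc s..s + t} = sum f {Suc s..s + t} + (f (Suc (s + t)) - 1)"
    unfolding g_def using step.hyps by (intro sum_upd) auto
  moreover have "top_nonzero J s g = top_nonzero J s f"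
    using step.hyps by (intro top_nonzero_cong) (simp add: g_def)
  ultimately show ?case
    using IH c(1) step.hyps by simp
qed

lemma top_nonzero_block_top:
  assumes "1 \<le> t" "{Suc s..<s + t} \<subseteq> J" "s \<notin> J" "top_nonzero J s f"
    and "f (s + t) = t - 1" "\<And>i. s < i \<Longrightarrow> i < s + t \<Longrightarrow> f i = 0"
  shows "top_nonzero J (s + t) f"
  using assms
proof (induction t arbitrary: f rule: dec_induct)
  case (step t)
  then have "s + t \<in> J"
    by auto
  let ?f = "f(s + t := f (s + t) + (f (Suc (s + t)) - 1))"
  define g where "g = ?f"
  have f0: "f (s + t) = 0"
    using step.prems(5) [of "s + t"] step.hyps by simp
  then have g: "g (s + t) = t - 1" "\<And>i. i \<noteq> s + t \<Longrightarrow> g i = f i"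
    using step.prems(4) by (simp_all add: g_def)
  have "top_nonzero J s g"
    using step.hyps step.prems(3) g(2) top_nonzero_cong [of s g f J] by simp
  then have "top_nonzero J (s + t) g"
    using step.prems(1,2,5) g by (intro step.IH) auto
  then show ?case
    using \<open>s + t \<in> J\<close> step.prems(4) step.hyps unfolding g_def add_Suc_right top_nonzero.simps by simp
qed simp

lemma top_nonzero_mono_set: "(\<And>i. i < n \<Longrightarrow> i \<in> J \<longleftrightarrow> i \<in> K) \<Longrightarrow> top_nonzero J n f = top_nonzero K n f"
  by (induction n arbitrary: f) auto

lemma cgens_Cons_facts:
  "{Suc (sum_list bs)..<sum_list bs + b} \<subseteq> cgens (b # bs)" "sum_list bs \<notin> cgens (b # bs)"
  "top_nonzero (cgens (b # bs)) (sum_list bs) f = top_nonzero (cgens bs) (sum_list bs) f"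
  using cgens_subset [of bs] by (auto intro!: top_nonzero_mono_set)

lemma sum_load:
  assumes "finite A"
  shows "(\<Sum>i\<in>A. load its i) = sum_list (map snd (filter (\<lambda>p. fst p \<in> A) its))"
  using assms by (induction its) (auto simp: load_Cons sum.distrib)

text \<open>A block of size b > 1 needs units of total b - 1 > 0, hence at least one item, and a
  block of size 1 admits none. Equal counts leave exactly one item per nontrivial block, of exponent
  b - 1.\<close>

lemma top_nonzero_cgens_load:
  assumes "0 \<notin> set bs" "0 \<notin> snd ` set its" "fst ` set its \<subseteq> {1..sum_list bs}"
    and "top_nonzero (cgens bs) (sum_list bs) (load its)"
  shows "size (ctype bs) \<le> length its \<and> (size (ctype bs) = length its \<longrightarrow> ctype bs = mset (map snd its))"
  using assms
proof (induction bs arbitrary: its)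
  case (Cons b bs)
  let ?s = "sum_list bs"
  \<comment> \<open>Items on variables of the lower blocks, and items on the topmost block of size
    \<open>b\<close>.\<close>
  let ?low = "filter (\<lambda>p. fst p \<le> ?s) its" and ?top = "filter (\<lambda>p. \<not> fst p \<le> ?s) its"
  have b: "1 \<le> b"
    using Cons.prems by auto
  have c: "top_nonzero (cgens bs) ?s (load its)" "(\<Sum>i=Suc ?s..?s+b. load its i) = b - 1"
    using top_nonzero_block [OF b cgens_Cons_facts(1) [of bs b] cgens_Cons_facts(2) [of bs b], of "load its"] Cons.prems(4)
    by (simp_all add: add.commute cgens_Cons_facts(3) del: cgens.simps)
  have "top_nonzero (cgens bs) ?s (load ?low)"
  proof -
    have "load ?low i = load its i" if "i \<le> ?s" for i
    proof -
      have "filter (\<lambda>p. fst p = i) ?low = filter (\<lambda>p. fst p = i) its"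
        unfolding filter_filter using that by (intro filter_cong) auto
      then show ?thesis
        by (simp add: load_def)
    qed
    then show ?thesis
      using c(1) top_nonzero_cong [of ?s "load ?low" "load its"] by simp
  qed
  moreover have "0 \<notin> set bs" "0 \<notin> snd ` set ?low" "fst ` set ?low \<subseteq> {1..?s}"
    using Cons.prems(1-3) by force+
  ultimately have IH: "size (ctype bs) \<le> length ?low"
    "size (ctype bs) = length ?low \<Longrightarrow> ctype bs = mset (map snd ?low)"
    using Cons.IH [of ?low] by blast+
  have top: "sum_list (map snd ?top) = b - 1"
  proof -
    have "filter (\<lambda>p. fst p \<in> {Suc ?s..?s+b}) its = ?top"
      using Cons.prems(3) by (intro filter_cong) (force simp: add.commute)+
    then show ?thesis
      using c(2) sum_load [of "{Suc ?s..?s+b}" its] by simp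
  qed
  have its: "mset its = mset ?low + mset ?top"
    by (simp add: multiset_partition [symmetric])
  then have len: "length its = length ?low + length ?top"
    by (metis size_mset size_union)
  show ?case
  proof (cases "1 < b")
    case False
    have nil: "?top = []"
    proof -
      have "snd p = 0" if "p \<in> set ?top" for p
        using top False sum_list_eq_0_iff [of "map snd ?top"] that by (cases p) auto
      then have np: "p \<notin> set ?top" for p
        using Cons.prems(2) by (metis filter_is_subset image_eqI subsetD)
      have "set ?top = {}"
        by (rule equals0I) (erule notE [OF np])
      then show ?thesis
        by (simp only: set_empty)
    qed
    have eq: "ctype (b # bs) = ctype bs" "length its = length ?low" "mset (map snd its) = mset (map snd ?low)"
      using False len its by (simp_all only: nil ctype_Cons if_False list.size mset.simps add_0_right mset_map)
    show ?thesis
      unfolding eq using IH by blast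
  next
    case True
    then have "?top \<noteq> []"
      using top by auto
    then have tl: "1 \<le> length ?top"
      by (simp add: Suc_leI)
    have bt: "ctype (b # bs) = add_mset (b - 1) (ctype bs)"
      using True by (simp add: ctype_Cons)
    then have le: "size (ctype (b # bs)) \<le> length its"
      using IH(1) tl len by simp
    have "ctype (b # bs) = mset (map snd its)" if "size (ctype (b # bs)) = length its"
    proof -
      have eq: "size (ctype bs) = length ?low" "length ?top = 1"
        using that IH(1) tl len unfolding bt by simp_all
      then obtain p where p: "?top = [p]"
        by (metis One_nat_def length_0_conv length_Suc_conv)
      then have "snd p = b - 1"
        using top by simp
      moreover have "mset its = add_mset p (mset ?low)"
        unfolding its p by simp
      ultimately show ?thesis
        unfolding bt IH(2) [OF eq(1)] mset_map by (simp only: image_mset_add_mset)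
    qed
    with le show ?thesis
      by blast
  qed
qed (simp_all add: image_subset_iff)

text \<open>The surviving distribution behind the diagonal entries: every nontrivial block receives
  its whole exponent at its top variable.\<close>

primrec top_items :: "nat list \<Rightarrow> (nat \<times> nat) list" where
  "top_items [] = []"
| "top_items (b # bs) = (if 1 < b then (sum_list bs + b, b - 1) # top_items bs else top_items bs)"

lemma map_snd_top_items: "map snd (top_items bs) = map (\<lambda>b. b - 1) (filter (\<lambda>b. 1 < b) bs)"
  by (induction bs) auto

lemma fst_top_items: "fst ` set (top_items bs) \<subseteq> {1..sum_list bs}"
  by (induction bs) auto

lemma top_nonzero_top_items: "0 \<notin> set bs \<Longrightarrow> top_nonzero (cgens bs) (sum_list bs) (load (top_items bs))"
proof (induction bs)
  case (Cons b bs)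
  let ?s = "sum_list bs" and ?f = "load (top_items (b # bs))"
  have z: "load (top_items bs) i = 0" if "?s < i" for i
  proof -
    have "filter (\<lambda>p. fst p = i) (top_items bs) = []"
      using fst_top_items [of bs] that by (auto simp: filter_empty_conv image_subset_iff)
    then show ?thesis
      by (simp add: load_def)
  qed
  have b: "1 \<le> b"
    using Cons.prems by auto
  have "top_nonzero (cgens bs) ?s ?f = top_nonzero (cgens bs) ?s (load (top_items bs))"
    using b by (intro top_nonzero_cong) (auto simp: load_Cons)
  then have "top_nonzero (cgens (b # bs)) ?s ?f"
    using Cons by (simp add: cgens_Cons_facts(3) del: cgens.simps top_items.simps)
  then have "top_nonzero (cgens (b # bs)) (?s + b) ?f"
    using b z by (intro top_nonzero_block_top [OF b cgens_Cons_facts(1,2)]) (auto simp: load_Cons)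
  then show ?case
    by (simp add: add.commute)
qed simp

text \<open>Several parts of \<open>ks\<close> can share a block, but a single part cannot serve two
  blocks; this is the triangularity by number of parts.\<close>

theorem psums_leading:
  assumes bs: "0 \<notin> set bs" and ks: "0 \<notin> set ks" "sum_list ks = card (cgens bs)"
    and nz: "poly (tau (psums (sum_list bs) ks * Tcox (cgens bs) 1 (sum_list bs))) 0 \<noteq> 0"
  shows "size (ctype bs) < length ks \<or> ctype bs = mset ks"
proof -
  let ?n = "sum_list bs"
  have "JMmonom (\<lambda>_. 0) n = 1" for n
    by (induction n) auto
  then have "top_count (cgens bs) ?n ks (\<lambda>_. 0) \<noteq> 0"
    using nz tau_psums [OF cgens_subset [of bs], of "\<lambda>_. 0" ks] ks by simp
  then obtain its where "map snd its = ks" "fst ` set its \<subseteq> {1..?n}" "top_nonzero (cgens bs) ?n (load its)"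
    unfolding top_count_neq_0_iff by auto
  then show ?thesis
    using top_nonzero_cgens_load [OF bs, of its] ks(1) by force
qed

theorem psums_leading_diag:
  assumes bs: "0 \<notin> set bs"
  shows "poly (tau (psums (sum_list bs) (map (\<lambda>b. b - 1) (filter (\<lambda>b. 1 < b) bs)) * Tcox (cgens bs) 1 (sum_list bs))) 0 \<noteq> 0"
proof -
  let ?n = "sum_list bs" and ?ks = "map (\<lambda>b. b - 1) (filter (\<lambda>b. 1 < b) bs)"
  have "JMmonom (\<lambda>_. 0) n = 1" for n
    by (induction n) auto
  moreover have "sum_list ?ks = card (cgens bs)"
    using sum_ctype [of bs] by (simp add: ctype_def sum_mset_sum_list flip: mset_map)
  moreover have "top_count (cgens bs) ?n ?ks (\<lambda>_. 0) \<noteq> 0"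
    unfolding top_count_neq_0_iff
    using top_nonzero_top_items [OF bs] fst_top_items [of bs] map_snd_top_items [of bs]
    by (intro exI [of _ "top_items bs"]) simp
  ultimately show ?thesis
    using tau_psums [OF cgens_subset [of bs], of "\<lambda>_. 0" ?ks] by simp
qed

lemma psums_JMdeg: "1 \<le> n \<Longrightarrow> psums n ks \<in> JMdeg n (Suc (sum_list ks))"
proof (induction ks)
  case (Cons k ks)
  have "psum n k \<in> JMdeg n (Suc k)"
    unfolding psum_def by (intro JMdeg_sum JMdeg_JM_power) auto
  from JMdeg_mult [OF this Cons.IH [OF Cons.prems]] show ?case
    by (simp add: psums_def add.commute)
qed (simp add: psums_def JMdeg_one)

lemma central_in_mult:
  assumes "central_in n x" "central_in n y"
  shows "central_in n (x * y)"
proof -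
  have "h * (x * y) = x * y * h" if "h \<in> Hsub n" for h
  proof -
    have "h * x = x * h" "h * y = y * h"
      using assms that by (simp_all add: central_in_def)
    have "h * (x * y) = (h * x) * y"
      by (rule mult.assoc [symmetric])
    also have "\<dots> = x * (h * y)"
      unfolding \<open>h * x = x * h\<close> by (rule mult.assoc)
    also have "\<dots> = x * y * h"
      unfolding \<open>h * y = y * h\<close> by (rule mult.assoc [symmetric])
    finally show ?thesis .
  qed
  moreover have "x * y \<in> Hsub n"
    using assms by (intro Hsub_mult) (simp_all add: central_in_def)
  ultimately show ?thesis
    unfolding central_in_def by blast
qed

lemma central_in_1: "central_in n 1"
  by (simp add: central_in_def)

lemma central_psums: "central_in n (psums n ks)"
  by (induction ks) (auto simp: psums_def intro: central_in_mult central_in_1 central_psum)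

section \<open>Rearranging parabolic subgroups\<close>

text \<open>Since \<open>g\<close> carries i, i + 1 to j, j + 1 in order, it has neither a right
  descent at i nor a left descent at j, so both sides are basis elements of the same
  permutation.\<close>

lemma Tperm_conj:
  assumes "apply g i = j" "apply g (Suc i) = Suc j"
  shows "Tperm g * T i = T j * Tperm g"
proof -
  have inv: "apply (inverse g) j = i" "apply (inverse g) (Suc j) = Suc i"
    using apply_inverse_cancel(1) [of g i] apply_inverse_cancel(1) [of g "Suc i"] assms by simp_all
  have "Tperm g * T i = Tperm (g * tr i)"
    using assms by (intro Tperm_mult_T) (simp add: right_descent_def)
  moreover have "T j * Tperm g = Tperm (tr j * g)"
    using inv by (intro T_mult_Tperm) (simp add: right_descent_def)
  moreover have "g * tr i = tr j * g"
  proof (rule perm_eqI)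
    fix x
    have "apply g x = j \<longleftrightarrow> x = i" "apply g x = Suc j \<longleftrightarrow> x = Suc i"
      using assms by (metis apply_inj)+
    then show "apply (g * tr i) x = apply (tr j * g) x"
      using assms by (auto simp: apply_tr_eval)
  qed
  ultimately show ?thesis by simp
qed

lemma Tperm_invertible: "in_Sym n w \<Longrightarrow> \<exists>h\<in>Hsub n. h * Tperm w = 1 \<and> Tperm w * h = 1"
proof (induction w rule: in_Sym_induct)
  case one
  then show ?case
    by (intro bexI [of _ 1]) auto
next
  case (step w i)
  then obtain h where h: "h \<in> Hsub n" "h * Tperm w = 1" "Tperm w * h = 1"
    by blast
  \<comment> \<open>By the quadratic relation T_i - \<xi> is inverse to T_i.\<close>
  let ?t = "T i - scal xi"
  have t: "?t * T i = 1" "T i * ?t = 1"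
    using scal_commute [of xi "T i"] by (simp_all add: left_diff_distrib right_diff_distrib T_quad)
  have "scal xi * 1 \<in> Hsub n"
    by (intro Hsub_scal) simp
  then have tn: "?t * h \<in> Hsub n"
    using step h(1) by (intro Hsub_mult Hsub_diff Hsub_T) simp_all
  have "?t * h * (Tperm w * T i) = ?t * (h * Tperm w) * T i" "Tperm w * T i * (?t * h) = Tperm w * (T i * ?t) * h"
    by (simp_all only: mult.assoc)
  then have "?t * h * (Tperm w * T i) = 1" "Tperm w * T i * (?t * h) = 1"
    by (simp_all add: h t)
  then show ?case
    using tn step(4) by (auto simp: Tperm_mult_T)
qed

lemma Tcox_split: "m \<le> k \<Longrightarrow> k \<le> n \<Longrightarrow> Tcox J m n = Tcox J m k * Tcox J k n"
proof (induction n)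
  case (Suc n)
  then show ?case
    by (cases "k = Suc n") (simp_all add: Tcox_Suc mult.assoc)
qed simp

lemma intertwine_mult:
  fixes x :: "'a :: semigroup_mult"
  shows "x * a = b * x \<Longrightarrow> x * c = d * x \<Longrightarrow> x * (a * c) = b * d * x"
  by (metis mult.assoc)

text \<open>The offset \<open>i + k - l\<close> covers upward shifts (l = 0) and downward shifts (k
  = 0) within the natural numbers.\<close>

lemma Tcox_shift:
  assumes "\<And>i. m \<le> i \<Longrightarrow> i < m + t \<Longrightarrow> i \<in> J \<Longrightarrow> x * T i = T (i + k - l) * x"
    and "\<And>i. m \<le> i \<Longrightarrow> i < m + t \<Longrightarrow> i \<in> J \<longleftrightarrow> i + k - l \<in> K" and "l \<le> m"
  shows "x * Tcox J m (m + t) = Tcox K (m + k - l) (m + k - l + t) * x"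
  using assms(1,2)
proof (induction t)
  case (Suc t)
  have "x * Tcox J m (m + t) = Tcox K (m + k - l) (m + k - l + t) * x"
    using Suc.prems by (intro Suc.IH) auto
  moreover have e: "m + t + k - l = m + k - l + t"
    using assms(3) by simp
  moreover have c: "x * (if m + t \<in> J then T (m + t) else 1) = (if m + k - l + t \<in> K then T (m + k - l + t) else 1) * x"
    using Suc.prems(1) [of "m + t"] Suc.prems(2) [of "m + t"] e by auto
  moreover have "Tcox J m (m + Suc t) = Tcox J m (m + t) * (if m + t \<in> J then T (m + t) else 1)"
    "Tcox K (m + k - l) (m + k - l + Suc t)
      = Tcox K (m + k - l) (m + k - l + t) * (if m + k - l + t \<in> K then T (m + k - l + t) else 1)"
    by (simp_all add: Tcox_Suc)
  ultimately show ?case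
    by (simp only: intertwine_mult)
qed simp

lemma Tcox_commute_far:
  assumes "\<And>i j. i \<in> J \<Longrightarrow> m \<le> i \<Longrightarrow> i < n \<Longrightarrow> j \<in> K \<Longrightarrow> p \<le> j \<Longrightarrow> j < q \<Longrightarrow> Suc i < j \<or> Suc j < i"
  shows "Tcox J m n * Tcox K p q = Tcox K p q * Tcox J m n"
proof -
  have 1: "T i * Tcox K p q = Tcox K p q * T i" if "i \<in> J" "m \<le> i" "i < n" for i
    using assms [OF that]
  proof (induction q)
    case (Suc q)
    show ?case
    proof (cases "p \<le> q")
      case True
      have "T i * Tcox K p q = Tcox K p q * T i"
        using Suc by simp
      moreover have "q \<in> K \<Longrightarrow> T i * T q = T q * T i"
        using Suc.prems [of q] True by (intro T_commute) auto
      ultimately show ?thesis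
        using True by (auto simp: Tcox_Suc) (metis mult.assoc)
    qed simp
  qed simp
  show ?thesis
    using 1
  proof (induction n)
    case (Suc n)
    show ?case
    proof (cases "m \<le> n")
      case True
      have "Tcox J m n * Tcox K p q = Tcox K p q * Tcox J m n"
        using Suc by simp
      moreover have "n \<in> J \<Longrightarrow> T n * Tcox K p q = Tcox K p q * T n"
        using Suc.prems [of n] True by simp
      ultimately show ?thesis
        using True by (auto simp: Tcox_Suc) (metis mult.assoc)
    qed simp
  qed simp
qed

text \<open>Exchanges the \<open>b\<close> points after \<open>s\<close> with the \<open>a\<close>
  points following them and keeps the order inside both blocks; this order is what
  \<open>Tperm_conj\<close> requires.\<close>

definition block_swap :: "nat \<Rightarrow> nat \<Rightarrow> nat \<Rightarrow> nat \<Rightarrow> nat" where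
  "block_swap s a b x = (if s < x \<and> x \<le> s + b then x + a
     else if s + b < x \<and> x \<le> s + a + b then x - b else x)"

lemma block_swap_inverse: "block_swap s b a (block_swap s a b x) = x"
  by (auto simp: block_swap_def)

lemma block_swap_perm: "\<exists>g. apply g = block_swap s a b \<and> in_Sym (s + a + b) g"
proof -
  have "bij (block_swap s a b)"
    by (rule o_bij [of "block_swap s b a"]) (auto simp: fun_eq_iff block_swap_inverse)
  moreover have aff: "{x. block_swap s a b x \<noteq> x} \<subseteq> {1..s + a + b}"
    by (auto simp: block_swap_def)
  ultimately have "apply (Perm (block_swap s a b)) = block_swap s a b"
    by (intro Perm_inverse) (auto intro: finite_subset)
  moreover from this have "in_Sym (s + a + b) (Perm (block_swap s a b))"
    using aff by (auto simp: in_Sym_def affected.rep_eq)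
  ultimately show ?thesis by blast
qed

lemma cgens_append: "cgens (xs @ ys) = (\<lambda>i. i + sum_list ys) ` cgens xs \<union> cgens ys"
proof (induction xs)
  case (Cons x xs)
  have "{Suc (sum_list xs + sum_list ys)..<sum_list xs + sum_list ys + x}
      = (\<lambda>i. i + sum_list ys) ` {Suc (sum_list xs)..<sum_list xs + x}"
    by (simp add: image_add_atLeastLessThan' ac_simps)
  then show ?case
    using Cons by (auto simp: image_Un)
qed simp

text \<open>\<open>Tperm g\<close> conjugates one Coxeter product into the other, up to the order of
  the two exchanged blocks, which commute; it is invertible in H_n, and a trace does not see
  conjugation. Compositions are listed from the top, so on the left-hand side \<open>b\<close> is
  the lower block.\<close>

lemma tau_Tcox_swap:
  assumes z: "central_in n z" and n: "n = sum_list (xs @ a # b # ys)" and pos_comb: "0 < a" "0 < b"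
  shows "tau (z * Tcox (cgens (xs @ a # b # ys)) 1 n) = tau (z * Tcox (cgens (xs @ b # a # ys)) 1 n)"
proof -
  define s where "s = sum_list ys"
  let ?J = "cgens (xs @ a # b # ys)" and ?K = "cgens (xs @ b # a # ys)"
  obtain g where g: "apply g = block_swap s a b" "in_Sym (s + a + b) g"
    using block_swap_perm by blast
  have le: "s + a + b \<le> n"
    using n by (simp add: s_def)
  have ysub: "i < s" "1 \<le> i" if "i \<in> cgens ys" for i
    using cgens_subset [of ys] that by (auto simp: s_def)
  have J: "i \<in> ?J \<longleftrightarrow> i \<in> (\<lambda>i. i + (a + b + s)) ` cgens xs \<or> i \<in> cgens ys \<or> s < i \<and> i < s + b \<or> s + b < i \<and> i < s + b + a" for i
    unfolding cgens_append by (auto simp: s_def add.assoc)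
  have K: "i \<in> ?K \<longleftrightarrow> i \<in> (\<lambda>i. i + (a + b + s)) ` cgens xs \<or> i \<in> cgens ys \<or> s < i \<and> i < s + a \<or> s + a < i \<and> i < s + b + a" for i
    unfolding cgens_append by (auto simp: s_def ac_simps)
  have x0: "0 \<notin> cgens xs"
    using cgens_subset [of xs] by auto
  have xsub: "s + a + b < i" if "i \<in> (\<lambda>i. i + (a + b + s)) ` cgens xs" for i
    using cgens_subset [of xs] that by auto
  have g_fix: "apply g i = i" if "i \<le> s \<or> s + a + b < i" for i
    using that by (auto simp: g block_swap_def)
  have low: "Tperm g * Tcox ?J 1 (1 + s) = Tcox ?K (1 + 0 - 0) (1 + 0 - 0 + s) * Tperm g"
  proof (rule Tcox_shift)
    fix i assume i: "1 \<le> i" "i < 1 + s"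
    show J_K: "i \<in> ?J \<longleftrightarrow> i + 0 - 0 \<in> ?K"
      using i pos_comb by (auto simp: J K dest: xsub)
    assume "i \<in> ?J"
    then have "i < s"
      using i cgens_subset [of xs] by (auto simp: J dest: ysub)
    then show "Tperm g * T i = T (i + 0 - 0) * Tperm g"
      by (intro Tperm_conj) (simp_all add: g_fix)
  qed simp
  have mid1: "Tperm g * Tcox ?J (Suc s) (Suc s + b) = Tcox ?K (Suc s + a - 0) (Suc s + a - 0 + b) * Tperm g"
  proof (rule Tcox_shift)
    fix i assume i: "Suc s \<le> i" "i < Suc s + b"
    have "i \<in> ?J \<longleftrightarrow> i < s + b"
      using i pos_comb by (auto simp: J x0 dest: xsub ysub)
    moreover have "i + a \<in> ?K \<longleftrightarrow> i < s + b"
      using i pos_comb by (auto simp: K x0 dest: xsub ysub)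
    ultimately show J_K: "i \<in> ?J \<longleftrightarrow> i + a - 0 \<in> ?K"
      by simp
    assume "i \<in> ?J"
    then have "i < s + b"
      using \<open>i \<in> ?J \<longleftrightarrow> i < s + b\<close> by simp
    then show "Tperm g * T i = T (i + a - 0) * Tperm g"
      using i by (intro Tperm_conj) (simp_all add: g block_swap_def)
  qed simp
  have mid2: "Tperm g * Tcox ?J (Suc s + b) (Suc s + b + a) = Tcox ?K (Suc s + b + 0 - b) (Suc s + b + 0 - b + a) * Tperm g"
  proof (rule Tcox_shift)
    fix i assume i: "Suc s + b \<le> i" "i < Suc s + b + a"
    have "i \<in> ?J \<longleftrightarrow> i < s + b + a"
      using i pos_comb by (auto simp: J x0 dest: xsub ysub)
    moreover have "i - b \<in> ?K \<longleftrightarrow> i < s + b + a"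
      using i pos_comb by (auto simp: K x0 dest: xsub ysub)
    ultimately show J_K: "i \<in> ?J \<longleftrightarrow> i + 0 - b \<in> ?K"
      by simp
    assume "i \<in> ?J"
    then have "i < s + b + a"
      using \<open>i \<in> ?J \<longleftrightarrow> i < s + b + a\<close> by simp
    then show "Tperm g * T i = T (i + 0 - b) * Tperm g"
      using i by (intro Tperm_conj) (auto simp add: g block_swap_def)
  qed simp
  have top: "Tperm g * Tcox ?J (Suc s + b + a) n = Tcox ?K (Suc s + b + a) n * Tperm g"
  proof (cases "Suc s + b + a \<le> n")
    case True
    have "Tperm g * Tcox ?J (Suc s + b + a) (Suc s + b + a + (n - (Suc s + b + a)))
      = Tcox ?K (Suc s + b + a + 0 - 0) (Suc s + b + a + 0 - 0 + (n - (Suc s + b + a))) * Tperm g"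
    proof (rule Tcox_shift)
      fix i assume i: "Suc s + b + a \<le> i"
      show "i \<in> ?J \<longleftrightarrow> i + 0 - 0 \<in> ?K"
        using i by (auto simp: J K)
      show "Tperm g * T i = T (i + 0 - 0) * Tperm g"
        using i by (intro Tperm_conj) (simp_all add: g_fix)
    qed simp
    then show ?thesis
      using True by simp
  qed (use le in simp)
  \<comment> \<open>If s + c + d = n, the cut points reach n + 1, one beyond the window; n not in
    \<open>L\<close> makes the additional factor 1.\<close>
  have cut: "Tcox L 1 n = Tcox L 1 (Suc s) * Tcox L (Suc s) (Suc s + c) * Tcox L (Suc s + c) (Suc s + c + d) * Tcox L (Suc s + c + d) n"
    if "s + c + d \<le> n" "n \<notin> L" for L c d
  proof -
    have "Tcox L 1 (Suc s + c) = Tcox L 1 (Suc s) * Tcox L (Suc s) (Suc s + c)"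
      "Tcox L 1 (Suc s + c + d) = Tcox L 1 (Suc s + c) * Tcox L (Suc s + c) (Suc s + c + d)"
      by (rule Tcox_split; simp)+
    moreover have "Tcox L 1 n = Tcox L 1 (Suc s + c + d) * Tcox L (Suc s + c + d) n"
    proof (cases "s + c + d = n")
      case True
      have "Tcox L 1 (Suc n) = Tcox L 1 n"
        using that(2) by (cases "n = 0") (simp_all add: Tcox_Suc)
      then show ?thesis
        using True by simp
    next
      case False
      then show ?thesis
        using that by (intro Tcox_split) simp_all
    qed
    ultimately show ?thesis
      by (simp only:)
  qed
  have nJ: "n \<notin> ?J" and nK: "n \<notin> ?K"
    using cgens_subset [of "xs @ a # b # ys"] cgens_subset [of "xs @ b # a # ys"] n by auto
  \<comment> \<open>The boundary index s + a is not in \<open>?K\<close>, so generators on its two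
    sides differ by at least two.\<close>
  have comm: "Tcox ?K (Suc s + a) (Suc s + a + b) * Tcox ?K (Suc s) (Suc s + a)
     = Tcox ?K (Suc s) (Suc s + a) * Tcox ?K (Suc s + a) (Suc s + a + b)"
  proof (rule Tcox_commute_far)
    fix i j assume i: "i \<in> ?K" "Suc s + a \<le> i" "i < Suc s + a + b" and j: "j \<in> ?K" "Suc s \<le> j" "j < Suc s + a"
    have "j \<noteq> s + a"
      using j pos_comb by (auto simp: K x0 dest: xsub ysub)
    then show "Suc i < j \<or> Suc j < i"
      using i j by auto
  qed
  have "Tperm g * Tcox ?J 1 n = Tcox ?K 1 n * Tperm g"
  proof -
    have 1: "Tperm g * Tcox ?J 1 (Suc s) = Tcox ?K 1 (Suc s) * Tperm g"
      using low by simp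
    have 2: "Tperm g * Tcox ?J (Suc s) (Suc s + b) = Tcox ?K (Suc s + a) (Suc s + a + b) * Tperm g"
      using mid1 by simp
    have 3: "Tperm g * Tcox ?J (Suc s + b) (Suc s + b + a) = Tcox ?K (Suc s) (Suc s + a) * Tperm g"
      using mid2 by simp
    have "Tperm g * Tcox ?J 1 n = Tcox ?K 1 (Suc s) * Tcox ?K (Suc s + a) (Suc s + a + b)
        * Tcox ?K (Suc s) (Suc s + a) * Tcox ?K (Suc s + b + a) n * Tperm g"
      using cut [of b a ?J] le nJ intertwine_mult [OF intertwine_mult [OF intertwine_mult [OF 1 2] 3] top] by (simp add: ac_simps(1-3))
    also have "\<dots> = Tcox ?K 1 (Suc s) * Tcox ?K (Suc s) (Suc s + a) * Tcox ?K (Suc s + a) (Suc s + a + b)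
        * Tcox ?K (Suc s + a + b) n * Tperm g"
      using comm by (simp add: mult.assoc add.commute add.left_commute)
    also have "\<dots> = Tcox ?K 1 n * Tperm g"
      using cut [of a b ?K] le nK by simp
    finally show ?thesis .
  qed
  moreover obtain h where h: "h \<in> Hsub n" "h * Tperm g = 1" "Tperm g * h = 1"
    using Tperm_invertible [OF in_Sym_mono [OF g(2) le]] by blast
  ultimately have "Tcox ?K 1 n = Tperm g * Tcox ?J 1 n * h"
    by (metis mult.assoc mult.right_neutral)
  then have "tau (z * Tcox ?K 1 n) = tau (z * (Tperm g * (Tcox ?J 1 n * h)))"
    by (simp add: mult.assoc)
  also have "\<dots> = tau (z * (Tcox ?J 1 n * h * Tperm g))"
    using g(2) le by (intro central_in_trace [OF z] Hsub_Tperm) (rule in_Sym_mono)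
  also have "\<dots> = tau (z * Tcox ?J 1 n)"
    by (simp add: mult.assoc h)
  finally show ?thesis by simp
qed

text \<open>The head of one list is moved to the front of the other past one entry at a time.
  \<open>P\<close> carries side conditions that survive rearrangement.\<close>

lemma swap_invariant_mset:
  assumes swap: "\<And>xs a b ys. P (xs @ a # b # ys) \<Longrightarrow> f (xs @ a # b # ys) = f (xs @ b # a # ys)"
    and P: "\<And>xs ys. mset xs = mset ys \<Longrightarrow> P xs \<Longrightarrow> P ys"
    and "mset xs = mset ys" "P xs"
  shows "f xs = f ys"
proof -
  have move: "f (p @ u @ a # v) = f (p @ a # u @ v)" if "P (p @ u @ a # v)" for p u a v
    using that
  proof (induction u arbitrary: v rule: rev_induct)
    case (snoc x u)
    have "f (p @ (u @ [x]) @ a # v) = f (p @ u @ a # x # v)"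
      using swap [of "p @ u" x a v] snoc.prems by simp
    also have "\<dots> = f (p @ a # u @ x # v)"
      using snoc.prems by (intro snoc.IH) (rule P [rotated], auto)
    finally show ?case by simp
  qed simp
  have "f (p @ xs) = f (p @ ys)" if "mset xs = mset ys" "P (p @ xs)" for p
    using that
  proof (induction xs arbitrary: ys p)
    case (Cons a xs)
    then have "a \<in> set ys"
      by (metis list.set_intros(1) mset_eq_setD)
    then obtain u v where ys: "ys = u @ a # v"
      by (meson split_list)
    have m: "mset xs = mset (u @ v)"
      using Cons.prems ys by simp
    have "f (p @ a # xs) = f ((p @ [a]) @ u @ v)"
      using Cons.IH [OF m, of "p @ [a]"] Cons.prems by simp
    also have "\<dots> = f (p @ ys)"
      unfolding ys using move [of p u a v] Cons.prems P [of "p @ a # xs" "p @ u @ a # v"] m by simp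
    finally show ?case .
  qed simp
  from this [of "[]"] show ?thesis
    using assms(3,4) by simp
qed

theorem tau_Tcox_mset_cong:
  assumes z: "central_in n z" and bs: "0 \<notin> set bs" "sum_list bs = n" "mset bs = mset bs'"
  shows "tau (z * Tcox (cgens bs) 1 n) = tau (z * Tcox (cgens bs') 1 n)"
proof (rule swap_invariant_mset [where P = "\<lambda>bs. 0 \<notin> set bs \<and> sum_list bs = n"])
  fix xs ys :: "nat list"
  assume "mset xs = mset ys" "0 \<notin> set xs \<and> sum_list xs = n"
  then show "0 \<notin> set ys \<and> sum_list ys = n"
    by (metis mset_eq_setD sum_mset_sum_list)
next
  fix xs a b ys
  assume "0 \<notin> set (xs @ a # b # ys) \<and> sum_list (xs @ a # b # ys) = n"
  then show "tau (z * Tcox (cgens (xs @ a # b # ys)) 1 n) = tau (z * Tcox (cgens (xs @ b # a # ys)) 1 n)"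
    by (intro tau_Tcox_swap [OF z]) auto
qed (use bs in auto)

section \<open>Cycle types and minimal length\<close>

lemma cox_cong: "(\<And>i. m \<le> i \<Longrightarrow> i < n \<Longrightarrow> i \<in> J \<longleftrightarrow> i \<in> K) \<Longrightarrow> cox J m n = cox K m n"
proof (induction n)
  case (Suc n)
  then show ?case
    by (cases "m \<le> n") (auto simp: cox_Suc)
qed simp

lemma apply_cox_block:
  assumes "1 \<le> t" "{Suc s..<s + t} \<subseteq> J" "s \<notin> J"
  shows "apply (cox J 1 (s + t)) x = (if x \<le> s then apply (cox J 1 s) x else if x < s + t then Suc x
    else if x = s + t then Suc s else x)"
  using assms
proof (induction t arbitrary: x rule: dec_induct)
  case base
  have "cox J 1 (s + 1) = cox J 1 s"
    using base(2) by (cases "s = 0") (simp_all add: cox_Suc)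
  moreover have "apply (cox J 1 s) x = x" if "s < x"
    using that by (intro in_Sym_fixes [OF in_Sym_cox]) auto
  ultimately show ?case
    by (auto simp: not_le)
next
  case (step t)
  then have J: "s + t \<in> J"
    by auto
  have eq: "cox J 1 (s + Suc t) = cox J 1 (s + t) * tr (s + t)"
    using J step.hyps by (simp add: cox_Suc)
  have IH: "apply (cox J 1 (s + t)) x = (if x \<le> s then apply (cox J 1 s) x else if x < s + t then Suc x
    else if x = s + t then Suc s else x)" for x
    using step.prems by (intro step.IH) auto
  show ?case
    unfolding eq apply_mult IH using step.hyps by (auto simp: apply_tr_eval)
qed

lemma permutation_apply: "permutation (apply w)"
  using finite_affected [of w] by (simp add: permutation affected.rep_eq)

lemma self_in_orbit: "x \<in> Orbits.orbit (apply w) x"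
  by (rule permutation_self_in_orbit [OF permutation_apply])

lemma orbit_block:
  assumes b: "1 \<le> b" and w: "\<And>x. s < x \<Longrightarrow> x \<le> s + b \<Longrightarrow> apply w x = (if x < s + b then Suc x else Suc s)"
    and x: "x \<in> {Suc s..s + b}"
  shows "Orbits.orbit (apply w) x = {Suc s..s + b}"
proof -
  have mem: "s + k \<in> Orbits.orbit (apply w) (Suc s)" if "1 \<le> k" "k \<le> b" for k
    using that
  proof (induction k rule: dec_induct)
    case base
    then show ?case
      using self_in_orbit [of "Suc s"] by simp
  next
    case (step k)
    then have "apply w (s + k) \<in> Orbits.orbit (apply w) (Suc s)"
      by (intro orbit.step) auto
    then show ?case
      using w [of "s + k"] step by simp
  qed
  have "{Suc s..s + b} \<subseteq> Orbits.orbit (apply w) (Suc s)"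
  proof
    fix y assume "y \<in> {Suc s..s + b}"
    then show "y \<in> Orbits.orbit (apply w) (Suc s)"
      using mem [of "y - s"] by auto
  qed
  moreover have "y \<in> {Suc s..s + b}" if "y \<in> Orbits.orbit (apply w) (Suc s)" for y
    using that by induction (use b w in \<open>auto split: if_splits\<close>)
  ultimately have eq: "Orbits.orbit (apply w) (Suc s) = {Suc s..s + b}"
    by blast
  then have "cyclic_on (apply w) {Suc s..s + b}"
    unfolding cyclic_on_def using b by (intro bexI [of _ "Suc s"]) auto
  then show ?thesis
    using x by (rule orbit_cyclic_eq3)
qed

lemma cycle_type_cox_cgens: "0 \<notin> set bs \<Longrightarrow> cycle_type (sum_list bs) (apply (cox (cgens bs) 1 (sum_list bs))) = mset bs"
proof (induction bs)
  case Nil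
  then show ?case by (simp add: cycle_type_def)
next
  case (Cons b bs)
  let ?s = "sum_list bs"
  let ?w = "cox (cgens bs) 1 ?s" and ?w' = "cox (cgens (b # bs)) 1 (?s + b)"
  have b: "1 \<le> b"
    using Cons.prems by auto
  have low: "cox (cgens (b # bs)) 1 ?s = ?w"
    by (rule cox_cong) auto
  have w': "apply ?w' x = (if x \<le> ?s then apply ?w x else if x < ?s + b then Suc x
      else if x = ?s + b then Suc ?s else x)" for x
    using apply_cox_block [OF b cgens_Cons_facts(1,2), of bs x] unfolding low .
  have e: "apply ?w' y = apply ?w y" if "y \<in> {1..?s}" for y
    using that unfolding w' by (simp del: cgens.simps)
  have st: "apply ?w y \<in> {1..?s}" if "y \<in> {1..?s}" for y
    by (rule in_Sym_apply [OF in_Sym_cox that]) simp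
  have o1: "Orbits.orbit (apply ?w') x = Orbits.orbit (apply ?w) x" if "x \<in> {1..?s}" for x
    using that
  proof (rule orbit_cong0)
    show "apply ?w' \<in> {1..?s} \<rightarrow> {1..?s}"
      by (rule funcsetI) (simp only: e st)
  qed (rule e)
  have o2: "Orbits.orbit (apply ?w') x = {Suc ?s..?s + b}" if "x \<in> {Suc ?s..?s + b}" for x
    by (rule orbit_block [OF b _ that]) (unfold w', simp)
  have split: "{1..?s + b} = {1..?s} \<union> {Suc ?s..?s + b}"
    by auto
  have "Orbits.orbit (apply ?w') ` {Suc ?s..?s + b} = {{Suc ?s..?s + b}}"
    using o2 b by (auto simp: image_def intro!: bexI [of _ "Suc ?s"])
  then have orb: "Orbits.orbit (apply ?w') ` {1..?s + b}
     = insert {Suc ?s..?s + b} (Orbits.orbit (apply ?w) ` {1..?s})"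
    unfolding split image_Un using o1 by simp
  have "{Suc ?s..?s + b} \<notin> Orbits.orbit (apply ?w) ` {1..?s}"
  proof
    assume "{Suc ?s..?s + b} \<in> Orbits.orbit (apply ?w) ` {1..?s}"
    then obtain x where x: "x \<in> {1..?s}" "{Suc ?s..?s + b} = Orbits.orbit (apply ?w) x"
      by blast
    have "x \<in> {Suc ?s..?s + b}"
      unfolding x(2) by (rule self_in_orbit)
    then show False
      using x(1) by simp
  qed
  then have "cycle_type (?s + b) (apply ?w') = add_mset b (cycle_type ?s (apply ?w))"
    unfolding cycle_type_def orb by (simp add: mset_set.insert_remove)
  then show ?case
    using Cons by (simp add: add.commute)
qed

lemma orbit_inverse_perm: "Orbits.orbit (apply (inverse w)) x = Orbits.orbit (apply w) x"
  unfolding apply_inverse by (rule orbit_inv_eq [OF permutation_apply])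

lemma cycle_type_inverse: "cycle_type n (apply (inverse w)) = cycle_type n (apply w)"
proof -
  have "Orbits.orbit (apply (inverse w)) = Orbits.orbit (apply w)"
    by (rule ext) (rule orbit_inverse_perm)
  then show ?thesis
    by (simp only: cycle_type_def)
qed

text \<open>The inverse appears because \<open>tau\<close> pairs a basis element with that of the
  inverse permutation; both permutations have the same orbits.\<close>

lemma modified_cycle_type_cox_cgens:
  assumes "0 \<notin> set bs" "sum_list bs = n"
  shows "modified_cycle_type n (apply (inverse (cox (cgens bs) 1 n))) = ctype bs"
  using cycle_type_cox_cgens [OF assms(1)] assms(2)
  by (simp add: modified_cycle_type_def cycle_type_inverse ctype_def mset_filter)

section \<open>Words, length and reduced expressions\<close>

definition gen_prod :: "nat list \<Rightarrow> nat perm" where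
  "gen_prod is = prod_list (map tr is)"

lemma gen_prod_simps [simp]: "gen_prod [] = 1" "gen_prod (i # is) = tr i * gen_prod is" "gen_prod (is @ js) = gen_prod is * gen_prod js"
  by (simp_all add: gen_prod_def)

lemma apply_gen_prod: "apply (gen_prod is) = word_perm is"
  by (induction "is") (simp_all add: word_perm_def apply_times apply_tr)

lemma inverse_gen_prod: "inverse (gen_prod is) = gen_prod (rev is)"
  by (induction "is") auto

lemma expresses_iff: "expresses n is (apply w) \<longleftrightarrow> set is \<subseteq> {1..<n} \<and> gen_prod is = w"
  by (simp add: expresses_def apply_inject flip: apply_gen_prod)

lemma cox_gen_prod: "cox J 1 n = gen_prod (filter (\<lambda>i. i \<in> J) [1..<n])"
proof (induction n)
  case (Suc n)
  then show ?case
    by (cases "n = 0") (auto simp: cox_Suc)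
qed simp

lemma inv_num_gen_prod_le: "inv_num (gen_prod is) \<le> length is"
proof (induction "is" rule: rev_induct)
  case (snoc i "is")
  have "inv_num (gen_prod is * tr i) \<le> Suc (inv_num (gen_prod is))"
    using inv_num_asc [of "gen_prod is" i] inv_num_right_descent [of "gen_prod is" i] by (cases "right_descent (gen_prod is) i") auto
  then show ?case
    using snoc by simp
qed simp

lemma exists_word:
  "in_Sym n w \<Longrightarrow> \<exists>is. set is \<subseteq> {1..<n} \<and> gen_prod is = w \<and> length is = inv_num w"
proof (induction w rule: in_Sym_induct)
  case one
  then show ?case
    by (intro exI [of _ "[]"]) simp
next
  case (step w i)
  then obtain "is" where "set is \<subseteq> {1..<n}" "gen_prod is = w" "length is = inv_num w"
    by blast
  then show ?case
    using step by (intro exI [of _ "is @ [i]"]) (simp add: inv_num_asc)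
qed

lemma perm_length_le: "set is \<subseteq> {1..<n} \<Longrightarrow> perm_length n (apply (gen_prod is)) \<le> length is"
  unfolding perm_length_def by (rule Least_le) (auto simp: expresses_iff)

lemma perm_length_attained:
  assumes "in_Sym n w"
  obtains "is" where "set is \<subseteq> {1..<n}" "gen_prod is = w" "length is = perm_length n (apply w)"
proof -
  have "\<exists>r is. expresses n is (apply w) \<and> length is = r"
    using exists_word [OF assms] by (auto simp: expresses_iff)
  then have "\<exists>is. expresses n is (apply w) \<and> length is = perm_length n (apply w)"
    unfolding perm_length_def by (rule LeastI_ex)
  then show ?thesis
    using that by (auto simp: expresses_iff)
qed

lemma perm_length_eq_inv_num:
  assumes "in_Sym n w"
  shows "perm_length n (apply w) = inv_num w"
proof (rule antisym)
  obtain "is" where "set is \<subseteq> {1..<n}" "gen_prod is = w" "length is = inv_num w"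
    using exists_word [OF assms] by blast
  then show "perm_length n (apply w) \<le> inv_num w"
    using perm_length_le [of "is" n] by simp
next
  obtain "is" where "set is \<subseteq> {1..<n}" "gen_prod is = w" "length is = perm_length n (apply w)"
    using perm_length_attained [OF assms] by blast
  then show "inv_num w \<le> perm_length n (apply w)"
    using inv_num_gen_prod_le [of "is"] by simp
qed

text \<open>A letter raises \<open>inv_num\<close> by at most one, so a word as long as the
  inversion number of its product ascends at every letter. This identifies \<open>hecke_T\<close>
  for whichever reduced expression was chosen.\<close>

lemma Tperm_reduced_word: "length is = inv_num (gen_prod is) \<Longrightarrow> prod_list (map T is) = Tperm (gen_prod is)"
proof (induction "is" rule: rev_induct)
  case (snoc i "is")
  have le: "inv_num (gen_prod is) \<le> length is"
    by (rule inv_num_gen_prod_le)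
  have asc: "\<not> right_descent (gen_prod is) i"
    using inv_num_right_descent [of "gen_prod is" i] snoc.prems le by auto
  then have "length is = inv_num (gen_prod is)"
    using snoc.prems by (simp add: inv_num_asc)
  then show ?case
    using snoc.IH asc by (simp add: Tperm_mult_T)
qed simp

lemma Tperm_reduced_expression:
  assumes "in_Sym n w" "reduced_expression n is (apply w)"
  shows "set is \<subseteq> {1..<n} \<and> prod_list (map T is) = Tperm w"
  using assms Tperm_reduced_word [of "is"]
  by (simp add: reduced_expression_def expresses_iff perm_length_eq_inv_num)

lemma exists_reduced_expression:
  assumes "in_Sym n w"
  shows "\<exists>is. reduced_expression n is (apply w)"
  using perm_length_attained [OF assms] by (metis expresses_iff reduced_expression_def)

lemma in_Sym_iff: "in_Sym n w \<longleftrightarrow> apply w \<in> Sym n"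
proof -
  have "\<exists>!x. apply w x = y" for y
    using bij_apply [of w] by (metis bij_pointE)
  then show ?thesis
    by (auto simp: in_Sym_def Sym_def affected.rep_eq permutes_def)
qed

lemma Sym_imp_perm:
  assumes "w \<in> Sym n"
  obtains p where "apply p = w" "in_Sym n p"
proof -
  have "{x. w x \<noteq> x} \<subseteq> {1..n}"
    using assms by (auto simp: Sym_def permutes_def)
  then have "apply (Perm w) = w"
    using assms by (intro Perm_inverse) (auto simp: Sym_def permutes_bij intro: finite_subset)
  then show ?thesis
    using that assms by (simp add: in_Sym_iff)
qed

text \<open>
  The number of generators outside the support of a word below a point is constant on the orbits,
  which bounds the number of orbits from below.
\<close>

lemma card_orbits_ge:
  assumes "set is \<subseteq> {1..<n}"
  shows "n \<le> card (Orbits.orbit (apply (gen_prod is)) ` {1..n}) + length is"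
proof -
  let ?K = "set is" and ?w = "apply (gen_prod is)"
  define h where "h x = card {i \<in> {1..<n} - ?K. i < x}" for x
  have h_tr: "h (apply (tr i) x) = h x" if "i \<in> ?K" for i x
  proof -
    have "{j \<in> {1..<n} - ?K. j < Suc i} = {j \<in> {1..<n} - ?K. j < i}"
      using that by (auto simp: less_Suc_eq)
    then show ?thesis
      by (auto simp: apply_tr_eval h_def)
  qed
  have "h (apply (gen_prod js) x) = h x" if "set js \<subseteq> ?K" for js x
    using that by (induction js) (auto simp: h_tr)
  then have h_w: "h (?w x) = h x" for x
    by simp
  have h_orbit: "h y = h x" if "y \<in> Orbits.orbit ?w x" for x y
    using that by induction (simp_all add: h_w)
  have eq: "h x = h y" if "Orbits.orbit ?w x = Orbits.orbit ?w y" for x y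
    using h_orbit [of x y] self_in_orbit [of x "gen_prod is"] that by simp
  have "card (h ` {1..n}) \<le> card (Orbits.orbit ?w ` {1..n})"
  proof -
    have "h ` {1..n} = (\<lambda>S. h (SOME x. Orbits.orbit ?w x = S)) ` (Orbits.orbit ?w ` {1..n})"
      unfolding image_image
    proof (rule image_cong)
      fix x
      have "Orbits.orbit ?w (SOME y. Orbits.orbit ?w y = Orbits.orbit ?w x) = Orbits.orbit ?w x"
        by (rule someI [of _ x]) simp
      from eq [OF this [symmetric]] show "h x = h (SOME y. Orbits.orbit ?w y = Orbits.orbit ?w x)" .
    qed simp
    then show ?thesis
      by (simp add: card_image_le)
  qed
  moreover have "card ({1..n} - Suc ` ?K) \<le> card (h ` {1..n})"
  proof -
    \<comment> \<open>The generator y - 1 is outside the support and lies below \<open>y\<close> but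
      not below \<open>x\<close>, so \<open>h\<close> has grown.\<close>
    have mono: "h x < h y" if xy: "x < y" "x \<in> {1..n}" "y \<in> {1..n} - Suc ` ?K" for x y
    proof -
      obtain z where z: "y = Suc z"
        using xy(1) by (cases y) auto
      have "z \<in> {i \<in> {1..<n} - ?K. i < y}" "z \<notin> {i \<in> {1..<n} - ?K. i < x}"
        using xy z by auto
      moreover have "{i \<in> {1..<n} - ?K. i < x} \<subseteq> {i \<in> {1..<n} - ?K. i < y}"
        using xy by auto
      ultimately have "{i \<in> {1..<n} - ?K. i < x} \<subset> {i \<in> {1..<n} - ?K. i < y}"
        by blast
      then show ?thesis
        unfolding h_def by (intro psubset_card_mono) auto
    qed
    have "inj_on h ({1..n} - Suc ` ?K)"
    proof (rule inj_onI)
      fix x y assume xy: "x \<in> {1..n} - Suc ` ?K" "y \<in> {1..n} - Suc ` ?K" "h x = h y"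
      then show "x = y"
        using mono [of x y] mono [of y x] by (cases x y rule: linorder_cases) auto
    qed
    then have "card ({1..n} - Suc ` ?K) = card (h ` ({1..n} - Suc ` ?K))"
      by (simp add: card_image)
    also have "\<dots> \<le> card (h ` {1..n})"
      by (intro card_mono) auto
    finally show ?thesis .
  qed
  moreover have "n - length is \<le> card ({1..n} - Suc ` ?K)"
  proof -
    have "card (Suc ` ?K) \<le> length is"
      by (metis List.finite_set card_image_le card_length order_trans)
    moreover have "card {1..n} - card (Suc ` ?K) \<le> card ({1..n} - Suc ` ?K)"
      by (rule diff_card_le_card_Diff) simp
    ultimately show ?thesis
      by simp
  qed
  ultimately show ?thesis
    by linarith
qed

lemma card_orbits_conj:
  assumes g: "g \<in> Sym n"
  shows "card (Orbits.orbit (g \<circ> w \<circ> inv_into UNIV g) ` {1..n}) \<le> card (Orbits.orbit w ` {1..n})"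
proof -
  let ?v = "g \<circ> w \<circ> inv_into UNIV g"
  have perm: "g permutes {1..n}"
    using g by (simp add: Sym_def)
  then have inv: "inv_into UNIV g (g x) = x" for x
    by (simp add: permutes_inverses)
  have pow: "(?v ^^ k) (g x) = g ((w ^^ k) x)" for k x
    by (induction k) (simp_all add: inv)
  have orb: "Orbits.orbit ?v (g x) = g ` Orbits.orbit w x" for x
    unfolding orbit_altdef pow by auto
  have "Orbits.orbit ?v ` {1..n} = Orbits.orbit ?v ` (g ` {1..n})"
    unfolding permutes_image [OF perm] by (rule refl)
  also have "\<dots> = (\<lambda>S. g ` S) ` (Orbits.orbit w ` {1..n})"
    by (simp add: image_image orb)
  finally show ?thesis
    by (simp add: card_image_le)
qed

lemma conj_class_Sym:
  assumes "w \<in> Sym n" "v \<in> conj_class n w"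
  shows "v \<in> Sym n"
  using assms by (auto simp: conj_class_def Sym_def intro!: permutes_compose permutes_inv)

text \<open>The n - card J blocks are the orbits, and conjugates have no more of them. A word of
  length r leaves at least n - r orbits, so every conjugate needs card J letters, and the Coxeter
  word has that many. Hence the vanishing condition on class elements applies at Coxeter
  elements.\<close>

lemma min_length_cox:
  assumes "J \<subseteq> {1..<n}"
  shows "min_length_in_class n (apply (inverse (cox J 1 n)))"
proof -
  let ?w = "apply (inverse (cox J 1 n))"
  obtain bs where bs: "0 \<notin> set bs" "sum_list bs = n" "cgens bs = J"
    using exists_composition [OF assms] by blast
  have "card (Orbits.orbit ?w ` {1..n}) = size (cycle_type n ?w)"
    by (simp add: cycle_type_def)
  also have "\<dots> = length bs"
    using cycle_type_cox_cgens [OF bs(1)] bs by (simp add: cycle_type_inverse)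
  finally have orb: "card (Orbits.orbit ?w ` {1..n}) = length bs" .
  have "card J + length bs = n"
  proof -
    have "sum_list (map (\<lambda>b. b - 1) bs) + length bs = sum_list bs" if "0 \<notin> set bs" for bs :: "nat list"
      using that by (induction bs) auto
    then show ?thesis
      using card_cgens [of bs] bs by simp
  qed
  moreover have "perm_length n ?w \<le> card J"
  proof -
    let ?is = "filter (\<lambda>i. i \<in> J) [1..<n]"
    have "length ?is = card J"
    proof -
      have "distinct ?is" "set ?is = J"
        using assms by auto
      then show ?thesis
        using distinct_card by fastforce
    qed
    moreover have "perm_length n (apply (gen_prod (rev ?is))) \<le> length (rev ?is)"
      by (rule perm_length_le) auto
    ultimately show ?thesis
      unfolding cox_gen_prod inverse_gen_prod by simp
  qed
  moreover have "n \<le> length bs + perm_length n v" if v: "v \<in> conj_class n ?w" for v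
  proof -
    have "?w \<in> Sym n"
      using in_Sym_cox [of 1 n J] by (simp flip: in_Sym_iff)
    then have "v \<in> Sym n"
      using v by (rule conj_class_Sym)
    then obtain p where p: "apply p = v" "in_Sym n p"
      by (rule Sym_imp_perm)
    obtain "is" where word: "set is \<subseteq> {1..<n}" "gen_prod is = p" "length is = perm_length n v"
      using perm_length_attained [OF p(2)] p(1) by metis
    have "card (Orbits.orbit v ` {1..n}) \<le> length bs"
      using v card_orbits_conj unfolding conj_class_def orb [symmetric] by blast
    then show ?thesis
      using card_orbits_ge [OF word(1)] word p by simp
  qed
  ultimately show ?thesis
    unfolding min_length_in_class_def by fastforce
qed

section \<open>Comparison with the presented algebra\<close>

abbreviation Tw :: "nat list \<Rightarrow> hecke_fin" where
  "Tw u \<equiv> prod_list (map T u)"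

definition free_eval :: "free_elem \<Rightarrow> hecke_fin" where
  "free_eval f = (\<Sum>u\<in>Poly_Mapping.keys f. scal (Poly_Mapping.lookup f u) * Tw u)"

lemma free_eval_superset:
  "finite A \<Longrightarrow> Poly_Mapping.keys f \<subseteq> A \<Longrightarrow> free_eval f = (\<Sum>u\<in>A. scal (Poly_Mapping.lookup f u) * Tw u)"
  unfolding free_eval_def by (rule sum.mono_neutral_left) (auto simp: in_keys_iff)

lemma free_eval_add: "free_eval (f + g) = free_eval f + free_eval g"
proof -
  let ?A = "Poly_Mapping.keys f \<union> Poly_Mapping.keys g"
  have "free_eval f = (\<Sum>u\<in>?A. scal (Poly_Mapping.lookup f u) * Tw u)"
    "free_eval g = (\<Sum>u\<in>?A. scal (Poly_Mapping.lookup g u) * Tw u)"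
    "free_eval (f + g) = (\<Sum>u\<in>?A. scal (Poly_Mapping.lookup (f + g) u) * Tw u)"
    using Poly_Mapping.keys_add [of f g] by (intro free_eval_superset; auto)+
  then show ?thesis
    by (simp add: lookup_add scal_add distrib_right sum.distrib)
qed

lemma free_eval_single: "free_eval (Poly_Mapping.single u c) = scal c * Tw u"
  by (subst free_eval_superset [of "{u}"]) auto

lemma free_eval_0 [simp]: "free_eval 0 = 0"
  by (simp add: free_eval_def)

lemma free_eval_uminus: "free_eval (- f) = - free_eval f"
  using free_eval_add [of f "- f"] by (simp add: add_eq_0_iff)

lemma free_eval_diff: "free_eval (f - g) = free_eval f - free_eval g"
  using free_eval_add [of f "- g"] by (simp add: free_eval_uminus)

lemma free_eval_sum: "free_eval (\<Sum>i\<in>I. f i) = (\<Sum>i\<in>I. free_eval (f i))"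
  by (induction I rule: infinite_finite_induct) (simp_all add: free_eval_add)

lemma free_expand: "f = (\<Sum>u\<in>Poly_Mapping.keys f. Poly_Mapping.single u (Poly_Mapping.lookup f u))"
  by (rule poly_mapping_eqI)
    (simp add: lookup_sum lookup_single when_def in_keys_iff if_distrib cong: if_cong)

lemma single_mult_single:
  "Poly_Mapping.single u c * Poly_Mapping.single v d = (Poly_Mapping.single (u @ v) (c * d) :: free_elem)"
  by (simp add: mult_single plus_list_def)

lemma free_eval_mult: "free_eval (f * g) = free_eval f * free_eval g"
proof -
  have "f * g = (\<Sum>u\<in>Poly_Mapping.keys f. Poly_Mapping.single u (Poly_Mapping.lookup f u))
      * (\<Sum>v\<in>Poly_Mapping.keys g. Poly_Mapping.single v (Poly_Mapping.lookup g v))"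
    by (rule arg_cong2 [where f = "(*)"]; rule free_expand)
  then have fg: "f * g = (\<Sum>u\<in>Poly_Mapping.keys f. \<Sum>v\<in>Poly_Mapping.keys g.
      Poly_Mapping.single (u @ v) (Poly_Mapping.lookup f u * Poly_Mapping.lookup g v))"
    by (simp only: sum_product single_mult_single)
  have tw: "scal (a * b) * Tw (u @ v) = scal a * Tw u * (scal b * Tw v)" for a b u v
    by (simp add: scal_mult mult.assoc mult_scal [of "Tw u"])
  show ?thesis
    unfolding fg free_eval_sum free_eval_single tw by (simp only: free_eval_def sum_product)
qed

lemma free_one: "(1 :: free_elem) = Poly_Mapping.single [] 1"
  by (simp flip: single_one add: zero_list_def)

lemma free_eval_1 [simp]: "free_eval 1 = 1"
  by (simp add: free_one free_eval_single)

lemma free_eval_gen [simp]: "free_eval (free_gen i) = T i"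
  by (simp add: free_gen_def free_eval_single)

lemma free_eval_scalar [simp]: "free_eval (free_scalar c) = scal c"
  by (simp add: free_scalar_def free_eval_single)

lemma free_alg_sel [simp]:
  "mult (free_alg n) = (*)" "one (free_alg n) = 1" "add (free_alg n) = (+)" "zero (free_alg n) = 0"
  by (simp_all add: free_alg_def)

lemma free_alg_inverse:
  assumes "x \<in> carrier (free_alg n)"
  shows "a_inv (free_alg n) x = - x"
proof -
  interpret ring "free_alg n"
    by (rule ring_free_alg)
  show ?thesis
    using minus_equality [of "- x" x] assms free_alg_uminus_closed [OF assms] by simp
qed

lemma free_eval_relators: "x \<in> hecke_relators n \<Longrightarrow> free_eval x = 0"
proof -
  have "T i * T j = T j * T i" if "\<bar>int i - int j\<bar> > 1" for i j
    using that by (intro T_commute) auto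
  then show "x \<in> hecke_relators n \<Longrightarrow> free_eval x = 0"
    by (auto simp: hecke_relators_def free_eval_diff free_eval_mult free_eval_add T_braid T_quad)
qed

text \<open>The elements of value zero form a two-sided ideal that contains the relators.\<close>

lemma free_eval_hecke_ideal:
  assumes "x \<in> hecke_ideal n"
  shows "free_eval x = 0"
proof -
  interpret ring "free_alg n"
    by (rule ring_free_alg)
  let ?K = "{x \<in> carrier (free_alg n). free_eval x = 0}"
  have "ideal ?K (free_alg n)"
  proof (rule idealI [OF ring_free_alg])
    show "subgroup ?K (add_monoid (free_alg n))"
    proof
      fix x assume x: "x \<in> ?K"
      then show "inv\<^bsub>add_monoid (free_alg n)\<^esub> x \<in> ?K"
        using free_alg_inverse [of x n] free_alg_uminus_closed [of x n]
        by (simp add: a_inv_def free_eval_uminus)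
    qed (auto simp: free_eval_add free_alg_add_closed, auto simp: free_alg_def)
  qed (auto simp: free_eval_mult free_alg_mult_closed)
  moreover have "hecke_relators n \<subseteq> ?K"
    using hecke_relators_carrier free_eval_relators by blast
  ultimately have "hecke_ideal n \<subseteq> ?K"
    unfolding hecke_ideal_def by (rule genideal_minimal)
  then show ?thesis
    using assms by blast
qed

text \<open>
  Every word is congruent to a combination of the normal forms \<open>u t\<close> with \<open>u\<close> a normal form for
  \<open>S\<^sub>n\<close> and \<open>t = s\<^sub>n s\<^sub>n\<^sub>-\<^sub>1 \<dots> s\<^sub>k\<close> a coset representative of \<open>S\<^sub>n\<close> in \<open>S\<^sub>n\<^sub>+\<^sub>1\<close>.
\<close>

primrec NF :: "nat \<Rightarrow> nat list set" where
  "NF 0 = {[]}"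
| "NF (Suc n) = {u @ rev [k..<Suc n] | u k. u \<in> NF n \<and> 1 \<le> k \<and> k \<le> Suc n}"

lemma NF_letters: "u \<in> NF n \<Longrightarrow> set u \<subseteq> {1..<n}"
  by (induction n arbitrary: u) fastforce+

lemma NF_SucI: "u \<in> NF n \<Longrightarrow> 1 \<le> k \<Longrightarrow> k \<le> Suc n \<Longrightarrow> u @ rev [k..<Suc n] \<in> NF (Suc n)"
  unfolding NF.simps by blast

lemma Nil_in_NF: "[] \<in> NF n"
proof (induction n)
  case (Suc n)
  from NF_SucI [OF this, of "Suc n"] show ?case by simp
qed simp

section \<open>Rewriting words to normal forms modulo the relations\<close>

context
  fixes N :: nat
begin

abbreviation "words_alg \<equiv> carrier (free_alg N)"
abbreviation "rel_ideal \<equiv> hecke_ideal N"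
abbreviation "word u \<equiv> (Poly_Mapping.single u 1 :: free_elem)"

lemma single_in_words_alg: "set u \<subseteq> {1..<N} \<Longrightarrow> Poly_Mapping.single u c \<in> words_alg"
  by (auto simp: free_alg_def)

lemma gen_in_words_alg: "1 \<le> i \<Longrightarrow> i < N \<Longrightarrow> free_gen i \<in> words_alg"
  unfolding free_gen_def by (rule single_in_words_alg) auto

lemma rel_ideal_0: "0 \<in> rel_ideal"
  using additive_subgroup.zero_closed [OF ideal.axioms(1) [OF ideal_hecke_ideal [of N]]] by simp

lemma rel_ideal_add: "x \<in> rel_ideal \<Longrightarrow> y \<in> rel_ideal \<Longrightarrow> x + y \<in> rel_ideal"
  using additive_subgroup.a_closed [OF ideal.axioms(1) [OF ideal_hecke_ideal [of N]]] by simp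

lemma rel_ideal_l: "x \<in> rel_ideal \<Longrightarrow> a \<in> words_alg \<Longrightarrow> a * x \<in> rel_ideal"
  using ideal.I_l_closed [OF ideal_hecke_ideal [of N]] by simp

lemma rel_ideal_r: "x \<in> rel_ideal \<Longrightarrow> a \<in> words_alg \<Longrightarrow> x * a \<in> rel_ideal"
  using ideal.I_r_closed [OF ideal_hecke_ideal [of N]] by simp

lemma rel_ideal_uminus: "x \<in> rel_ideal \<Longrightarrow> - x \<in> rel_ideal"
  using rel_ideal_l [of x "- 1"] free_alg_uminus_closed [OF free_alg_one_closed] by simp

definition cong_ideal :: "free_elem \<Rightarrow> free_elem \<Rightarrow> bool" where
  "cong_ideal x y \<longleftrightarrow> x - y \<in> rel_ideal"

lemma cong_ideal_refl: "cong_ideal x x"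
  by (simp add: cong_ideal_def rel_ideal_0)

lemma cong_ideal_trans [trans]: "cong_ideal x y \<Longrightarrow> cong_ideal y z \<Longrightarrow> cong_ideal x z"
  unfolding cong_ideal_def using rel_ideal_add by fastforce

lemma cong_ideal_eq_trans [trans]: "x = y \<Longrightarrow> cong_ideal y z \<Longrightarrow> cong_ideal x z" "cong_ideal x y \<Longrightarrow> y = z \<Longrightarrow> cong_ideal x z"
  by simp_all

lemma cong_ideal_l: "cong_ideal x y \<Longrightarrow> a \<in> words_alg \<Longrightarrow> cong_ideal (a * x) (a * y)"
  unfolding cong_ideal_def using rel_ideal_l [of "x - y" a] by (simp add: right_diff_distrib)

lemma cong_ideal_r: "cong_ideal x y \<Longrightarrow> a \<in> words_alg \<Longrightarrow> cong_ideal (x * a) (y * a)"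
  unfolding cong_ideal_def using rel_ideal_r [of "x - y" a] by (simp add: left_diff_distrib)

lemma word_append: "word (u @ v) = word u * word v"
  by (simp add: single_mult_single)

lemma relator_rel_ideal: "x \<in> hecke_relators N \<Longrightarrow> x \<in> rel_ideal"
  unfolding hecke_ideal_def
  using ring.genideal_self [OF ring_free_alg hecke_relators_carrier] by blast

lemma cong_ideal_braid:
  "1 \<le> i \<Longrightarrow> Suc i < N \<Longrightarrow> cong_ideal (word [Suc i, i, Suc i]) (word [i, Suc i, i])"
proof -
  assume "1 \<le> i" "Suc i < N"
  then have "word [i, Suc i, i] - word [Suc i, i, Suc i] \<in> rel_ideal"
    by (intro relator_rel_ideal) (auto simp: hecke_relators_def free_gen_def single_mult_single)
  from rel_ideal_uminus [OF this] show ?thesis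
    by (simp add: cong_ideal_def)
qed

lemma cong_ideal_commute:
  "1 \<le> i \<Longrightarrow> i < N \<Longrightarrow> 1 \<le> j \<Longrightarrow> j < N \<Longrightarrow> Suc i < j \<or> Suc j < i \<Longrightarrow> cong_ideal (word [i, j]) (word [j, i])"
  unfolding cong_ideal_def
proof (rule relator_rel_ideal)
  assume a: "1 \<le> i" "i < N" "1 \<le> j" "j < N" "Suc i < j \<or> Suc j < i"
  have "word [i, j] - word [j, i] = free_gen i * free_gen j - free_gen j * free_gen i"
    by (simp add: free_gen_def single_mult_single)
  moreover have "\<bar>int i - int j\<bar> > 1"
    using a(5) by auto
  ultimately show "word [i, j] - word [j, i] \<in> hecke_relators N"
    using a(1-4) unfolding hecke_relators_def by auto
qed

lemma cong_ideal_quad: "1 \<le> i \<Longrightarrow> i < N \<Longrightarrow> cong_ideal (word [i, i]) (1 + Poly_Mapping.single [i] xi)"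
  unfolding cong_ideal_def
  by (intro relator_rel_ideal) (auto simp: hecke_relators_def free_gen_def free_scalar_def single_mult_single)

lemma cong_ideal_commute_word:
  "set u \<subseteq> {1..<N} \<Longrightarrow> 1 \<le> j \<Longrightarrow> j < N \<Longrightarrow> (\<And>i. i \<in> set u \<Longrightarrow> Suc i < j \<or> Suc j < i) \<Longrightarrow>
    cong_ideal (word (u @ [j])) (word (j # u))"
proof (induction u)
  case Nil
  then show ?case by (simp add: cong_ideal_refl)
next
  case (Cons i u)
  have i: "1 \<le> i" "i < N" "set u \<subseteq> {1..<N}"
    using Cons.prems(1) by auto
  have "cong_ideal (word (u @ [j])) (word (j # u))"
    using Cons i by auto
  from cong_ideal_l [OF this single_in_words_alg [of "[i]" 1]] have "cong_ideal (word ([i] @ u @ [j])) (word ([i] @ j # u))"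
    using i by (simp only: word_append) (simp add: single_mult_single)
  moreover have "cong_ideal (word [i, j] * word u) (word [j, i] * word u)"
    using Cons.prems i by (intro cong_ideal_r cong_ideal_commute single_in_words_alg) auto
  then have "cong_ideal (word ([i] @ j # u)) (word (j # i # u))"
    by (simp add: single_mult_single)
  ultimately show ?case
    using cong_ideal_trans by fastforce
qed

inductive_set NF_span :: "nat \<Rightarrow> free_elem set" for n where
  ideal: "x \<in> rel_ideal \<Longrightarrow> x \<in> NF_span n"
| word: "u \<in> NF n \<Longrightarrow> Poly_Mapping.single u c \<in> NF_span n"
| add: "x \<in> NF_span n \<Longrightarrow> y \<in> NF_span n \<Longrightarrow> x + y \<in> NF_span n"

lemma NF_span_cong: "cong_ideal x y \<Longrightarrow> y \<in> NF_span n \<Longrightarrow> x \<in> NF_span n"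
  using NF_span.add [OF NF_span.ideal, of "x - y" y n] by (simp add: cong_ideal_def)

lemma NF_span_mult_coset:
  assumes "x \<in> NF_span n" "Suc n \<le> N" "1 \<le> k" "k \<le> Suc n"
  shows "x * word (rev [k..<Suc n]) \<in> NF_span (Suc n)"
  using assms(1)
proof induction
  case (ideal x)
  have "word (rev [k..<Suc n]) \<in> words_alg"
    using assms by (intro single_in_words_alg) auto
  then show ?case
    using ideal by (intro NF_span.ideal rel_ideal_r)
next
  case (word u c)
  have "u @ rev [k..<Suc n] \<in> NF (Suc n)"
    using word assms by auto
  from NF_span.word [OF this, of c] show ?case
    by (simp only: single_mult_single mult_1_right)
qed (auto simp: distrib_right intro: NF_span.add)

text \<open>In the induction step a letter j meets t = s_n ... s_k. For j < k - 1 it commutes with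
  t; j = k - 1 lengthens t; j = k calls for the quadratic relation; for j > k the braid relation
  turns t s_j into s_{j-1} t. In the outer cases a letter below n reaches \<open>u\<close>, where
  the induction hypothesis applies.\<close>

lemma NF_span_mult_gen:
  "n \<le> N \<Longrightarrow> x \<in> NF_span n \<Longrightarrow> 1 \<le> j \<Longrightarrow> j < n \<Longrightarrow> x * word [j] \<in> NF_span n"
proof (induction n arbitrary: x j)
  case (Suc n)
  from Suc.prems(2) show ?case
  proof induction
    case (ideal x)
    then show ?case
      using Suc.prems by (intro NF_span.ideal rel_ideal_r single_in_words_alg) auto
  next
    case (add x y)
    then show ?case
      by (simp add: distrib_right NF_span.add)
  next
    case (word w c)
    then obtain u k where w: "w = u @ rev [k..<Suc n]" and u: "u \<in> NF n" and k: "1 \<le> k" "k \<le> Suc n"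
      by auto
    have uN: "set u \<subseteq> {1..<N}"
      using NF_letters [OF u] Suc.prems(1) by auto
    let ?t = "rev [k..<Suc n]"
    have eq: "Poly_Mapping.single w c * word [j] = Poly_Mapping.single u c * word (?t @ [j])"
      by (simp add: w single_mult_single)
    have uC: "Poly_Mapping.single u c \<in> words_alg"
      using uN by (rule single_in_words_alg)
    have pull: "Poly_Mapping.single w c * word [j] \<in> NF_span (Suc n)"
      if i: "cong_ideal (word (?t @ [j])) (word (i # ?t))" "1 \<le> i" "i < n" for i
    proof (rule NF_span_cong)
      show "cong_ideal (Poly_Mapping.single w c * word [j]) (Poly_Mapping.single u c * word [i] * word ?t)"
        unfolding eq using cong_ideal_l [OF i(1) uC] by (simp add: single_mult_single)
      show "Poly_Mapping.single u c * word [i] * word ?t \<in> NF_span (Suc n)"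
        using Suc.IH [of "Poly_Mapping.single u c" i] u i Suc.prems(1) k
        by (intro NF_span_mult_coset NF_span.word) (auto intro: NF_span.word)
    qed
    consider "Suc j < k" | "Suc j = k" | "j = k" | "k < j"
      by linarith
    then show ?case
    proof cases
      case 1
      have "cong_ideal (word (?t @ [j])) (word (j # ?t))"
        using Suc.prems k 1 by (intro cong_ideal_commute_word) auto
      then show ?thesis
        using 1 k Suc.prems by (intro pull) auto
    next
      case 2
      then have "rev [j..<Suc n] = ?t @ [j]"
        using k by (simp add: upt_conv_Cons)
      then have "u @ ?t @ [j] \<in> NF (Suc n)"
        using NF_SucI [OF u, of j] Suc.prems 2 k by simp
      from NF_span.word [OF this, of c] show ?thesis
        unfolding eq by (simp add: single_mult_single)
    next
      case 3
      let ?t' = "rev [Suc k..<Suc n]"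
      have t: "?t = ?t' @ [k]"
        using 3 Suc.prems by (simp add: upt_conv_Cons)
      have "u @ ?t' \<in> NF (Suc n)" "u @ ?t \<in> NF (Suc n)"
        using u k 3 Suc.prems by (intro NF_SucI; simp)+
      then have "Poly_Mapping.single (u @ ?t') c + Poly_Mapping.single (u @ ?t) (c * xi) \<in> NF_span (Suc n)"
        by (intro NF_span.add NF_span.word)
      moreover have "cong_ideal (Poly_Mapping.single w c * word [j])
        (Poly_Mapping.single (u @ ?t') c + Poly_Mapping.single (u @ ?t) (c * xi))"
      proof -
        have "Poly_Mapping.single (u @ ?t') c \<in> words_alg"
          using uN Suc.prems(1) by (intro single_in_words_alg) auto
        moreover have "cong_ideal (word [k, k]) (1 + Poly_Mapping.single [k] xi)"
          using k 3 Suc.prems by (intro cong_ideal_quad) auto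
        ultimately have "cong_ideal (Poly_Mapping.single (u @ ?t') c * word [k, k])
            (Poly_Mapping.single (u @ ?t') c * (1 + Poly_Mapping.single [k] xi))"
          by (rule cong_ideal_l [rotated])
        moreover have "Poly_Mapping.single w c * word [j] = Poly_Mapping.single (u @ ?t') c * word [k, k]"
          unfolding w t using 3 by (simp add: single_mult_single)
        moreover have "Poly_Mapping.single (u @ ?t') c * (1 + Poly_Mapping.single [k] xi)
            = Poly_Mapping.single (u @ ?t') c + Poly_Mapping.single (u @ ?t) (c * xi)"
          unfolding t by (simp add: distrib_left single_mult_single)
        ultimately show ?thesis by simp
      qed
      ultimately show ?thesis
        using NF_span_cong by blast
    next
      case 4
      then obtain i where j: "j = Suc i" "k \<le> i" "1 \<le> i"
        using k by (cases j) auto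
      let ?A = "rev [Suc j..<Suc n]" and ?B = "rev [k..<i]"
      have "[k..<Suc n] = [k..<i] @ [i, j] @ [Suc j..<Suc n]"
        using j Suc.prems upt_add_eq_append [of k i "Suc n - i"] by (simp add: upt_conv_Cons)
      then have t: "?t = ?A @ [j, i] @ ?B"
        by simp
      have letters: "set ?A \<subseteq> {1..<N}" "set ?B \<subseteq> {1..<N}" "{i, j} \<subseteq> {1..<N}"
        using Suc.prems k j by auto
      have "cong_ideal (word (?t @ [j])) (word (i # ?t))"
      proof -
        have "word (?t @ [j]) = word (?A @ [j, i]) * word (?B @ [j])"
          by (simp add: t single_mult_single del: upt_Suc)
        also have "cong_ideal \<dots> (word (?A @ [j, i]) * word (j # ?B))"
          using letters j Suc.prems by (intro cong_ideal_l cong_ideal_commute_word single_in_words_alg) auto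
        also have "word (?A @ [j, i]) * word (j # ?B) = word ?A * (word [Suc i, i, Suc i] * word ?B)"
          by (simp add: j single_mult_single)
        also have "cong_ideal \<dots> (word ?A * (word [i, Suc i, i] * word ?B))"
          using letters j Suc.prems by (intro cong_ideal_l cong_ideal_r cong_ideal_braid single_in_words_alg) auto
        also have "\<dots> = word (?A @ [i]) * word ([j, i] @ ?B)"
          by (simp add: j single_mult_single)
        also have "cong_ideal \<dots> (word (i # ?A) * word ([j, i] @ ?B))"
          using letters j Suc.prems by (intro cong_ideal_r cong_ideal_commute_word single_in_words_alg) auto
        also have "\<dots> = word (i # ?t)"
          by (simp add: t single_mult_single del: upt_Suc)
        finally show ?thesis .
      qed
      then show ?thesis
        using j Suc.prems by (intro pull) auto
    qed
  qed
qed simp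

lemma single_in_NF_span: "set u \<subseteq> {1..<N} \<Longrightarrow> Poly_Mapping.single u c \<in> NF_span N"
proof (induction u rule: rev_induct)
  case Nil
  then show ?case
    by (intro NF_span.word Nil_in_NF)
next
  case (snoc j u)
  then have "Poly_Mapping.single u c * word [j] \<in> NF_span N"
    by (intro NF_span_mult_gen) auto
  then show ?case
    by (simp add: single_mult_single)
qed

lemma NF_span_sum: "(\<And>i. i \<in> A \<Longrightarrow> f i \<in> NF_span n) \<Longrightarrow> (\<Sum>i\<in>A. f i) \<in> NF_span n"
  by (induction A rule: infinite_finite_induct) (auto intro: NF_span.intros rel_ideal_0)

lemma NF_span_reduce: "x \<in> NF_span n \<Longrightarrow> \<exists>g. Poly_Mapping.keys g \<subseteq> NF n \<and> x - g \<in> rel_ideal"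
proof (induction rule: NF_span.induct)
  case (ideal x)
  then show ?case
    by (intro exI [of _ 0]) simp
next
  case (word u c)
  then show ?case
    by (intro exI [of _ "Poly_Mapping.single u c"]) (auto simp: rel_ideal_0)
next
  case (add x y)
  then obtain g h where g: "Poly_Mapping.keys g \<subseteq> NF n" "x - g \<in> rel_ideal"
    and h: "Poly_Mapping.keys h \<subseteq> NF n" "y - h \<in> rel_ideal"
    by blast
  have "(x - g) + (y - h) \<in> rel_ideal"
    using g h by (intro rel_ideal_add)
  moreover have "Poly_Mapping.keys (g + h) \<subseteq> NF n"
    using g h Poly_Mapping.keys_add [of g h] by blast
  ultimately show ?case
    by (intro exI [of _ "g + h"]) (simp add: algebra_simps)
qed

lemma words_alg_reduce: "f \<in> words_alg \<Longrightarrow> \<exists>g. Poly_Mapping.keys g \<subseteq> NF N \<and> f - g \<in> rel_ideal"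
proof (rule NF_span_reduce)
  assume "f \<in> words_alg"
  then have "set u \<subseteq> {1..<N}" if "u \<in> Poly_Mapping.keys f" for u
    using that by (simp add: free_alg_def)
  then show "f \<in> NF_span N"
    by (subst free_expand) (intro NF_span_sum single_in_NF_span)
qed

end

text \<open>The largest value n + 1 travels down with the letters, and each letter is an ascent
  because that value stands on its right. Its final position k recovers the coset representative,
  which separates normal forms.\<close>

lemma Tperm_coset:
  assumes "in_Sym n w" "1 \<le> k" "k \<le> Suc n"
  shows "Tperm w * Tw (rev [k..<Suc n]) = Tperm (w * gen_prod (rev [k..<Suc n]))
    \<and> apply (w * gen_prod (rev [k..<Suc n])) k = Suc n \<and> in_Sym (Suc n) (w * gen_prod (rev [k..<Suc n]))"
  using assms(3,2)
proof (induction k rule: inc_induct)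
  case base
  then show ?case
    using assms(1) in_Sym_fixes [OF assms(1), of "Suc n"] by (auto intro: in_Sym_mono)
next
  case (step k)
  let ?w = "w * gen_prod (rev [Suc k..<Suc n])"
  have IH: "Tperm w * Tw (rev [Suc k..<Suc n]) = Tperm ?w" "apply ?w (Suc k) = Suc n" "in_Sym (Suc n) ?w"
    using step.IH by simp_all
  have t: "rev [k..<Suc n] = rev [Suc k..<Suc n] @ [k]"
    using step.hyps by (simp add: upt_conv_Cons)
  have "apply ?w k \<in> {1..Suc n}"
    using step by (intro in_Sym_apply [OF IH(3)]) auto
  moreover have "apply ?w k \<noteq> apply ?w (Suc k)"
    by (simp add: apply_inj del: apply_mult)
  ultimately have "\<not> right_descent ?w k"
    unfolding right_descent_def IH(2) by auto
  then have "Tperm ?w * T k = Tperm (?w * tr k)"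
    by (rule Tperm_mult_T)
  then show ?case
    unfolding t using IH step by (simp add: mult.assoc [symmetric] del: apply_mult upt_Suc)
      (simp add: mult.assoc del: upt_Suc)
qed

lemma NF_Tperm: "u \<in> NF n \<Longrightarrow> Tw u = Tperm (gen_prod u) \<and> in_Sym n (gen_prod u)"
proof (induction n arbitrary: u)
  case (Suc n)
  then obtain v k where u: "u = v @ rev [k..<Suc n]" "v \<in> NF n" "1 \<le> k" "k \<le> Suc n"
    by auto
  then show ?case
    using Suc.IH [OF u(2)] Tperm_coset [of n "gen_prod v" k] by (simp del: upt_Suc)
qed simp

lemma gen_prod_inj_on_NF: "inj_on gen_prod (NF n)"
proof (induction n)
  case (Suc n)
  show ?case
  proof (rule inj_onI)
    fix u u' assume a: "u \<in> NF (Suc n)" "u' \<in> NF (Suc n)" and eq: "gen_prod u = gen_prod u'"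
    obtain v k where u: "u = v @ rev [k..<Suc n]" "v \<in> NF n" "1 \<le> k" "k \<le> Suc n"
      using a(1) by auto
    obtain v' k' where u': "u' = v' @ rev [k'..<Suc n]" "v' \<in> NF n" "1 \<le> k'" "k' \<le> Suc n"
      using a(2) by auto
    have "apply (gen_prod u) k = Suc n" "apply (gen_prod u') k' = Suc n"
      using Tperm_coset [of n "gen_prod v" k] Tperm_coset [of n "gen_prod v'" k'] NF_Tperm u u' by (simp_all del: upt_Suc)
    then have k: "k = k'"
      using eq by (metis apply_inj)
    then have "gen_prod v * gen_prod (rev [k..<Suc n]) = gen_prod v' * gen_prod (rev [k..<Suc n])"
      using eq u u' by (simp del: upt_Suc)
    then have "gen_prod v = gen_prod v'"
      by (simp only: perm.right_cancel)
    then show "u = u'"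
      using inj_onD [OF Suc.IH] u u' k by blast
  qed
qed simp

text \<open>Modulo the ideal only normal forms remain; distinct ones evaluate to distinct basis
  elements, so a vanishing value kills every coefficient.\<close>

lemma free_eval_kernel:
  assumes "f \<in> carrier (free_alg n)" "free_eval f = 0"
  shows "f \<in> hecke_ideal n"
proof -
  obtain g where g: "Poly_Mapping.keys g \<subseteq> NF n" "f - g \<in> hecke_ideal n"
    using words_alg_reduce [OF assms(1)] by blast
  have "free_eval g = 0"
    using free_eval_hecke_ideal [OF g(2)] assms(2) by (simp add: free_eval_diff)
  have "Poly_Mapping.lookup g u = 0" for u
  proof (cases "u \<in> Poly_Mapping.keys g")
    case True
    have "0 = coef (free_eval g) (gen_prod u)"
      by (simp add: \<open>free_eval g = 0\<close>)
    also have "\<dots> = (\<Sum>v\<in>Poly_Mapping.keys g. Poly_Mapping.lookup g v * (if u = v then 1 else 0))"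
      unfolding free_eval_def coef_sum
    proof (rule sum.cong)
      fix v assume "v \<in> Poly_Mapping.keys g"
      then have "gen_prod u = gen_prod v \<longleftrightarrow> u = v" "Tw v = Tperm (gen_prod v)"
        using True g(1) inj_onD [OF gen_prod_inj_on_NF [of n]] NF_Tperm by blast+
      then show "coef (scal (Poly_Mapping.lookup g v) * Tw v) (gen_prod u)
          = Poly_Mapping.lookup g v * (if u = v then 1 else 0)"
        by (simp add: coef_Tperm)
    qed simp
    also have "\<dots> = Poly_Mapping.lookup g u"
      using True by (simp add: if_distrib [of "(*) _"] cong: if_cong)
    finally show ?thesis by simp
  qed (simp add: in_keys_iff)
  then have "g = 0"
    by (intro poly_mapping_eqI) simp
  then show ?thesis
    using g by simp
qed

text \<open>Evaluation of a coset through an arbitrary representative, legitimate because the ideal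
  evaluates to zero; this is the embedding of the presented algebra into the model.\<close>

definition hecke_val :: "hecke_elem \<Rightarrow> hecke_fin" where
  "hecke_val X = free_eval (SOME f. f \<in> X)"

lemma hecke_class_iff:
  "x \<in> hecke_class n f \<longleftrightarrow> (\<exists>h\<in>hecke_ideal n. x = h + f)"
  by (auto simp: hecke_class_def a_r_coset_def')

lemma hecke_val_class: "hecke_val (hecke_class n f) = free_eval f"
proof -
  have "f \<in> hecke_class n f"
    using rel_ideal_0 [of n] by (auto simp: hecke_class_iff intro: bexI [of _ 0])
  then have "(SOME x. x \<in> hecke_class n f) \<in> hecke_class n f"
    by (rule someI)
  then show ?thesis
    unfolding hecke_val_def hecke_class_iff by (auto simp: free_eval_add free_eval_hecke_ideal)
qed

lemma carrier_hecke: "carrier (hecke n) = hecke_class n ` carrier (free_alg n)"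
  by (auto simp: hecke_def FactRing_def A_RCOSETS_def' hecke_class_def)

lemma hecke_class_hom: "hecke_class n \<in> ring_hom (free_alg n) (hecke n)"
  using ideal.rcos_ring_hom [OF ideal_hecke_ideal [of n]] by (simp add: hecke_class_def [abs_def] hecke_def)

lemma hecke_val_mult:
  assumes "X \<in> carrier (hecke n)" "Y \<in> carrier (hecke n)"
  shows "hecke_val (X \<otimes>\<^bsub>hecke n\<^esub> Y) = hecke_val X * hecke_val Y"
proof -
  obtain f g where "X = hecke_class n f" "Y = hecke_class n g" "f \<in> carrier (free_alg n)" "g \<in> carrier (free_alg n)"
    using assms unfolding carrier_hecke by blast
  then show ?thesis
    using ring_hom_mult [OF hecke_class_hom [of n], of f g, symmetric] by (simp add: hecke_val_class free_eval_mult)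
qed

lemma hecke_val_add:
  assumes "X \<in> carrier (hecke n)" "Y \<in> carrier (hecke n)"
  shows "hecke_val (X \<oplus>\<^bsub>hecke n\<^esub> Y) = hecke_val X + hecke_val Y"
proof -
  obtain f g where "X = hecke_class n f" "Y = hecke_class n g" "f \<in> carrier (free_alg n)" "g \<in> carrier (free_alg n)"
    using assms unfolding carrier_hecke by blast
  then show ?thesis
    using ring_hom_add [OF hecke_class_hom [of n], of f g, symmetric] by (simp add: hecke_val_class free_eval_add)
qed

lemma hecke_val_one: "hecke_val \<one>\<^bsub>hecke n\<^esub> = 1"
  using ring_hom_one [OF hecke_class_hom [of n]] hecke_val_class [of n 1] by simp

lemma hecke_val_zero: "hecke_val \<zero>\<^bsub>hecke n\<^esub> = 0"
proof -
  interpret ring "hecke n"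
    by (rule ring_hecke)
  show ?thesis
    using hecke_val_add [of "\<zero>\<^bsub>hecke n\<^esub>" n "\<zero>\<^bsub>hecke n\<^esub>"] by simp
qed

lemma hecke_val_minus:
  assumes "X \<in> carrier (hecke n)" "Y \<in> carrier (hecke n)"
  shows "hecke_val (X \<ominus>\<^bsub>hecke n\<^esub> Y) = hecke_val X - hecke_val Y"
proof -
  interpret ring "hecke n"
    by (rule ring_hecke)
  have "hecke_val (\<ominus>\<^bsub>hecke n\<^esub> Y) + hecke_val Y = 0"
    using hecke_val_add [of "\<ominus>\<^bsub>hecke n\<^esub> Y" n Y] assms(2) by (simp add: l_neg hecke_val_zero)
  then have "hecke_val (\<ominus>\<^bsub>hecke n\<^esub> Y) = - hecke_val Y"
    by (simp add: add_eq_0_iff2)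
  then show ?thesis
    using assms by (simp add: a_minus_def hecke_val_add)
qed

lemma hecke_finsum_closed:
  assumes "\<And>a. a \<in> A \<Longrightarrow> G a \<in> carrier (hecke n)"
  shows "finsum (hecke n) G A \<in> carrier (hecke n)"
proof -
  interpret ring "hecke n"
    by (rule ring_hecke)
  show ?thesis
    using assms by (intro finsum_closed) blast
qed

lemma hecke_val_finsum:
  assumes "finite A" "\<And>a. a \<in> A \<Longrightarrow> G a \<in> carrier (hecke n)"
  shows "hecke_val (finsum (hecke n) G A) = (\<Sum>a\<in>A. hecke_val (G a))"
proof -
  interpret ring "hecke n"
    by (rule ring_hecke)
  show ?thesis
    using assms
  proof (induction A)
    case (insert a A)
    then show ?case
      by (subst finsum_insert) (auto simp: hecke_val_add finsum_closed Pi_iff)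
  qed (simp add: hecke_val_zero)
qed

lemma hecke_val_inject:
  assumes "X \<in> carrier (hecke n)" "Y \<in> carrier (hecke n)" "hecke_val X = hecke_val Y"
  shows "X = Y"
proof -
  obtain f g where fg: "X = hecke_class n f" "Y = hecke_class n g" "f \<in> carrier (free_alg n)" "g \<in> carrier (free_alg n)"
    using assms unfolding carrier_hecke by blast
  have "f - g \<in> carrier (free_alg n)"
    using free_alg_add_closed [OF fg(3) free_alg_uminus_closed [OF fg(4)]] by simp
  then have fgI: "f - g \<in> hecke_ideal n"
    using assms(3) by (intro free_eval_kernel) (simp_all add: fg hecke_val_class free_eval_diff)
  then have mem: "h + (f - g) \<in> hecke_ideal n" "h - (f - g) \<in> hecke_ideal n" if "h \<in> hecke_ideal n" for h
    using rel_ideal_add [OF that fgI] rel_ideal_add [OF that rel_ideal_uminus [OF fgI]] by (simp_all only: add_uminus_conv_diff)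
  have eq: "h + f = (h + (f - g)) + g" "h + g = (h - (f - g)) + f" for h
    by simp_all
  have "x \<in> hecke_class n f \<longleftrightarrow> x \<in> hecke_class n g" for x
    unfolding hecke_class_iff using mem eq by metis
  then show ?thesis
    unfolding fg by blast
qed

lemma hecke_scalar_carrier: "hecke_class n (free_scalar c) \<in> carrier (hecke n)"
  unfolding carrier_hecke by (intro imageI) (auto simp: free_alg_def free_scalar_def)

lemma hecke_smult_carrier: "X \<in> carrier (hecke n) \<Longrightarrow> hecke_smult n c X \<in> carrier (hecke n)"
  unfolding hecke_smult_def using ring_hecke [of n] hecke_scalar_carrier
  by (simp add: ring.ring_simprules(5))

lemma hecke_val_smult: "X \<in> carrier (hecke n) \<Longrightarrow> hecke_val (hecke_smult n c X) = scal c * hecke_val X"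
  by (simp add: hecke_smult_def hecke_val_mult hecke_scalar_carrier hecke_val_class)

lemma hecke_gen_carrier: "1 \<le> i \<Longrightarrow> i < n \<Longrightarrow> hecke_gen n i \<in> carrier (hecke n)"
  unfolding carrier_hecke hecke_gen_def by (intro imageI gen_in_words_alg)

lemma hecke_val_gen: "hecke_val (hecke_gen n i) = T i"
  by (simp add: hecke_gen_def hecke_val_class)

lemma hecke_word:
  "set u \<subseteq> {1..<n} \<Longrightarrow> foldr (\<lambda>i z. hecke_gen n i \<otimes>\<^bsub>hecke n\<^esub> z) u \<one>\<^bsub>hecke n\<^esub> \<in> carrier (hecke n)
    \<and> hecke_val (foldr (\<lambda>i z. hecke_gen n i \<otimes>\<^bsub>hecke n\<^esub> z) u \<one>\<^bsub>hecke n\<^esub>) = Tw u"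
proof (induction u)
  case Nil
  then show ?case
    using ring_hecke [of n] by (simp add: hecke_val_one ring.ring_simprules(6))
next
  case (Cons i u)
  then have "hecke_gen n i \<in> carrier (hecke n)"
    by (intro hecke_gen_carrier) auto
  then show ?case
    using Cons ring_hecke [of n] by (simp add: hecke_val_mult hecke_val_gen ring.ring_simprules(5))
qed

lemma hecke_T_props:
  assumes "in_Sym n w"
  shows "hecke_T n (apply w) \<in> carrier (hecke n)" "hecke_val (hecke_T n (apply w)) = Tperm w"
proof -
  let ?u = "SOME is. reduced_expression n is (apply w)"
  have "reduced_expression n ?u (apply w)"
    using exists_reduced_expression [OF assms] by (rule someI_ex)
  then have "set ?u \<subseteq> {1..<n}" "Tw ?u = Tperm w"
    using Tperm_reduced_expression [OF assms] by blast+
  then show "hecke_T n (apply w) \<in> carrier (hecke n)" "hecke_val (hecke_T n (apply w)) = Tperm w"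
    using hecke_word [of ?u n] by (simp_all add: hecke_T_def)
qed

lemma Hsub_Tw: "set u \<subseteq> {1..<n} \<Longrightarrow> Tw u \<in> Hsub n"
  by (induction u) (auto intro: Hsub_T_mult)

lemma hecke_val_Hsub:
  assumes "X \<in> carrier (hecke n)"
  shows "hecke_val X \<in> Hsub n"
proof -
  obtain f where f: "X = hecke_class n f" "f \<in> carrier (free_alg n)"
    using assms unfolding carrier_hecke by blast
  then have "set u \<subseteq> {1..<n}" if "u \<in> Poly_Mapping.keys f" for u
    using that by (simp add: free_alg_def)
  then show ?thesis
    unfolding f(1) hecke_val_class free_eval_def by (intro Hsub_sum Hsub_scal Hsub_Tw)
qed

lemma finite_Sym: "finite (Sym n)"
  unfolding Sym_def by (rule finite_permutations) simp

lemma Sym_eq_image: "Sym n = apply ` {w. in_Sym n w}"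
  by (auto simp: in_Sym_iff elim: Sym_imp_perm)

lemma inj_apply: "inj apply"
  by (simp add: inj_def apply_inject)

lemma hecke_val_T_combination:
  shows "hecke_val (finsum (hecke n) (\<lambda>w. hecke_smult n (a w) (hecke_T n w)) (Sym n))
    = (\<Sum>w | in_Sym n w. scal (a (apply w)) * Tperm w)"
    and "finsum (hecke n) (\<lambda>w. hecke_smult n (a w) (hecke_T n w)) (Sym n) \<in> carrier (hecke n)"
proof -
  have c: "hecke_smult n (a w) (hecke_T n w) \<in> carrier (hecke n)" if "w \<in> Sym n" for w
    using that by (auto simp: Sym_eq_image intro: hecke_smult_carrier hecke_T_props)
  have "hecke_val (finsum (hecke n) (\<lambda>w. hecke_smult n (a w) (hecke_T n w)) (Sym n))
     = (\<Sum>w\<in>Sym n. hecke_val (hecke_smult n (a w) (hecke_T n w)))"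
    by (rule hecke_val_finsum [OF finite_Sym c])
  also have "\<dots> = (\<Sum>w | in_Sym n w. hecke_val (hecke_smult n (a (apply w)) (hecke_T n (apply w))))"
    unfolding Sym_eq_image by (subst sum.reindex) (auto intro: inj_on_subset [OF inj_apply])
  also have "\<dots> = (\<Sum>w | in_Sym n w. scal (a (apply w)) * Tperm w)"
    by (intro sum.cong) (auto simp: hecke_val_smult hecke_T_props)
  finally show "hecke_val (finsum (hecke n) (\<lambda>w. hecke_smult n (a w) (hecke_T n w)) (Sym n))
    = (\<Sum>w | in_Sym n w. scal (a (apply w)) * Tperm w)" .
  show "finsum (hecke n) (\<lambda>w. hecke_smult n (a w) (hecke_T n w)) (Sym n) \<in> carrier (hecke n)"
    by (rule hecke_finsum_closed [OF c])
qed

lemma finite_in_Sym: "finite {w. in_Sym n w}"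
proof (rule finite_imageD)
  show "finite (apply ` {w. in_Sym n w})"
    using finite_Sym [of n] by (simp add: Sym_eq_image)
qed (rule inj_on_subset [OF inj_apply], simp)

lemma Perm_apply: "Perm (apply w) = w"
  by (rule apply_inject [THEN iffD1]) (rule Perm_inverse, rule "apply")

text \<open>The coefficients of the value form one admissible family, and \<open>coef\<close>
  recovers any admissible family from the value. Existence and uniqueness for the definite
  description follow.\<close>

lemma T_coeff_eq:
  assumes X: "X \<in> carrier (hecke n)" and w: "in_Sym n w"
  shows "T_coeff n X (apply w) = coef (hecke_val X) w"
proof -
  let ?Q = "\<lambda>a. (\<forall>w. w \<notin> Sym n \<longrightarrow> a w = 0) \<and>
     X = finsum (hecke n) (\<lambda>w. hecke_smult n (a w) (hecke_T n w)) (Sym n)"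
  define a where "a v = (if v \<in> Sym n then coef (hecke_val X) (Perm v) else 0)" for v
  have a: "a (apply w) = coef (hecke_val X) w" if "in_Sym n w" for w
    using that by (simp add: a_def in_Sym_iff Perm_apply)
  have val: "b (apply w) = coef (hecke_val X) w" if "?Q b" "in_Sym n w" for b w
  proof -
    have "coef (hecke_val X) w = coef (\<Sum>w | in_Sym n w. scal (b (apply w)) * Tperm w) w"
      using that(1) hecke_val_T_combination(1) [of n b] by simp
    also have "\<dots> = b (apply w)"
      using that(2) by (simp add: coef_Tperm finite_in_Sym if_distrib [of "(*) _"] cong: if_cong)
    finally show ?thesis ..
  qed
  have "hecke_val X = (\<Sum>w | in_Sym n w. scal (a (apply w)) * Tperm w)"
  proof (rule hecke_fin_eqI)
    fix w
    show "coef (hecke_val X) w = coef (\<Sum>w | in_Sym n w. scal (a (apply w)) * Tperm w) w"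
      using hecke_val_Hsub [OF X]
      by (cases "in_Sym n w") (auto simp: Hsub_def coef_Tperm finite_in_Sym a if_distrib [of "(*) _"] cong: if_cong)
  qed
  then have "?Q a"
    using hecke_val_T_combination [of n a] X hecke_val_inject [of X n] by (auto simp: a_def)
  moreover have "b = a" if "?Q b" for b
  proof
    fix v
    show "b v = a v"
    proof (cases "v \<in> Sym n")
      case True
      then obtain p where "apply p = v" "in_Sym n p"
        by (rule Sym_imp_perm)
      then show ?thesis
        using val [OF that] val [OF \<open>?Q a\<close>] by metis
    next
      case False
      then show ?thesis
        using that by (simp add: a_def)
    qed
  qed
  ultimately have "(THE a. ?Q a) = a"
    by (rule the_equality)
  then show ?thesis
    using a [OF w] by (simp add: T_coeff_def)
qed

lemma finite_perm_class: "finite (perm_class n lam)"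
  using finite_Sym [of n] by (rule finite_subset [rotated]) (auto simp: perm_class_def)

lemma geck_rouquier_carrier: "is_geck_rouquier n lam z \<Longrightarrow> z \<in> carrier (hecke n)"
  by (simp add: is_geck_rouquier_def hecke_center_def)

lemma geck_rouquier_central:
  assumes "is_geck_rouquier n lam z"
  shows "central_in n (hecke_val z)"
proof (rule central_inI)
  have z: "z \<in> carrier (hecke n)"
    using assms by (rule geck_rouquier_carrier)
  then show "hecke_val z \<in> Hsub n"
    by (rule hecke_val_Hsub)
  fix i assume i: "1 \<le> i" "i < n"
  then have "z \<otimes>\<^bsub>hecke n\<^esub> hecke_gen n i = hecke_gen n i \<otimes>\<^bsub>hecke n\<^esub> z"
    using assms hecke_gen_carrier [OF i] by (simp add: is_geck_rouquier_def hecke_center_def)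
  from arg_cong [OF this, of hecke_val] show "T i * hecke_val z = hecke_val z * T i"
    using z hecke_gen_carrier [OF i] by (simp add: hecke_val_mult hecke_val_gen)
qed

text \<open>At \<open>w\<close> the class element has the same coefficient as the plain sum of the
  T_v over the class, and there the coefficient only records whether \<open>w\<close> belongs to the
  class.\<close>

lemma geck_rouquier_coeff:
  assumes gr: "is_geck_rouquier n lam z" and w: "in_Sym n w" "min_length_in_class n (apply w)"
  shows "coef (hecke_val z) w = of_bool (modified_cycle_type n (apply w) = lam)"
proof -
  let ?S = "finsum (hecke n) (hecke_T n) (perm_class n lam)"
  have z: "z \<in> carrier (hecke n)"
    using gr by (rule geck_rouquier_carrier)
  have c: "hecke_T n v \<in> carrier (hecke n)" if "v \<in> perm_class n lam" for v
    using that by (auto simp: perm_class_def Sym_eq_image intro: hecke_T_props)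
  have S: "?S \<in> carrier (hecke n)"
    by (rule hecke_finsum_closed [OF c])
  have D: "z \<ominus>\<^bsub>hecke n\<^esub> ?S \<in> carrier (hecke n)"
    using z S ring.ring_simprules(4) [OF ring_hecke] by blast
  have "T_coeff n (z \<ominus>\<^bsub>hecke n\<^esub> ?S) (apply w) = 0"
    using gr w unfolding is_geck_rouquier_def in_Sym_iff by blast
  then have "coef (hecke_val (z \<ominus>\<^bsub>hecke n\<^esub> ?S)) w = 0"
    by (simp add: T_coeff_eq [OF D w(1)])
  then have "coef (hecke_val z) w = (\<Sum>v\<in>perm_class n lam. coef (hecke_val (hecke_T n v)) w)"
    using z S by (simp add: hecke_val_minus hecke_val_finsum [OF finite_perm_class c])
  also have "\<dots> = (\<Sum>v\<in>perm_class n lam. if v = apply w then 1 else 0)"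
  proof (rule sum.cong)
    fix v assume "v \<in> perm_class n lam"
    then have "v \<in> Sym n"
      by (simp add: perm_class_def)
    then obtain p where "apply p = v" "in_Sym n p"
      by (rule Sym_imp_perm)
    then show "coef (hecke_val (hecke_T n v)) w = (if v = apply w then 1 else 0)"
      using hecke_T_props(2) [of n p] by (auto simp: coef_Tperm apply_inject)
  qed simp
  also have "\<dots> = of_bool (apply w \<in> perm_class n lam)"
    by (simp add: finite_perm_class)
  finally show ?thesis
    using w by (simp add: perm_class_def in_Sym_iff)
qed

section \<open>Expressing class elements by Jucys--Murphy elements\<close>

definition submodule :: "hecke_fin set \<Rightarrow> bool" where
  "submodule X \<longleftrightarrow> 0 \<in> X \<and> (\<forall>x\<in>X. \<forall>y\<in>X. x + y \<in> X) \<and> (\<forall>c. \<forall>x\<in>X. scal c * x \<in> X)"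

text \<open>The integer \<open>d\<close> may depend on \<open>m\<close>; it collects the
  denominators that arise from dividing by diagonal entries.\<close>

definition approx :: "hecke_fin set \<Rightarrow> nat \<Rightarrow> hecke_fin \<Rightarrow> bool" where
  "approx X m h \<longleftrightarrow> (\<exists>d::int. d \<noteq> 0 \<and> (\<exists>x\<in>X. \<exists>y. scal [:d:] * h = x + scal (xi ^ m) * y))"

lemma approxI: "d \<noteq> 0 \<Longrightarrow> x \<in> X \<Longrightarrow> scal [:d:] * h = x + scal (xi ^ m) * y \<Longrightarrow> approx X m h"
  unfolding approx_def by blast

lemma approxE:
  assumes "approx X m h"
  obtains d x y where "d \<noteq> 0" "x \<in> X" "scal [:d:] * h = x + scal (xi ^ m) * y"
  using assms unfolding approx_def by blast

text \<open>The elements a nonzero integer multiple of which is \<open>\<xi>\<close>-adically close to \<open>X\<close>.\<close>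

definition xi_closure :: "hecke_fin set \<Rightarrow> hecke_fin set" where
  "xi_closure X = {h. \<forall>m. approx X m h}"

lemma scal_scal: "scal a * (scal b * x) = scal (a * b) * x"
  by (simp add: scal_mult mult.assoc)

lemma approx_add:
  assumes "submodule X" "approx X m h" "approx X m h'"
  shows "approx X m (h + h')"
proof -
  obtain d x y where d: "d \<noteq> 0" "x \<in> X" "scal [:d:] * h = x + scal (xi ^ m) * y"
    using assms(2) by (auto simp: approx_def)
  obtain d' x' y' where d': "d' \<noteq> 0" "x' \<in> X" "scal [:d':] * h' = x' + scal (xi ^ m) * y'"
    using assms(3) by (auto simp: approx_def)
  have "scal [:d * d':] * (h + h') = scal [:d':] * (scal [:d:] * h) + scal [:d:] * (scal [:d':] * h')"
    by (simp add: scal_scal distrib_left mult.commute)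
  also have "\<dots> = (scal [:d':] * x + scal [:d:] * x') + scal (xi ^ m) * (scal [:d':] * y + scal [:d:] * y')"
    unfolding d d' by (simp add: distrib_left scal_scal mult.commute add_ac)
  finally have "scal [:d * d':] * (h + h') = (scal [:d':] * x + scal [:d:] * x') + scal (xi ^ m) * (scal [:d':] * y + scal [:d:] * y')" .
  moreover have "scal [:d':] * x + scal [:d:] * x' \<in> X"
    using assms(1) d d' by (auto simp: submodule_def)
  ultimately show ?thesis
    unfolding approx_def using d d' by (intro exI [of _ "d * d'"]) auto
qed

lemma approx_scal:
  assumes "submodule X" "approx X m h"
  shows "approx X m (scal c * h)"
proof -
  obtain d x y where d: "d \<noteq> 0" "x \<in> X" "scal [:d:] * h = x + scal (xi ^ m) * y"
    using assms(2) by (auto simp: approx_def)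
  have "scal [:d:] * (scal c * h) = scal c * (scal [:d:] * h)"
    by (simp add: scal_scal mult.commute)
  also have "\<dots> = scal c * x + scal (xi ^ m) * (scal c * y)"
    unfolding d by (simp add: distrib_left scal_scal mult.commute)
  finally show ?thesis
    using d assms(1) by (intro approxI) (auto simp: submodule_def)
qed

lemma approx_xi:
  assumes "submodule X" "approx X m h"
  shows "approx X (Suc m) (scal xi * h)"
proof -
  obtain d x y where d: "d \<noteq> 0" "x \<in> X" "scal [:d:] * h = x + scal (xi ^ m) * y"
    using assms(2) by (auto simp: approx_def)
  have "scal [:d:] * (scal xi * h) = scal xi * (scal [:d:] * h)"
    by (simp add: scal_scal mult.commute)
  also have "\<dots> = scal xi * x + scal (xi ^ Suc m) * y"
    unfolding d by (simp add: distrib_left scal_scal)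
  finally show ?thesis
    using d assms(1) by (intro approxI) (auto simp: submodule_def)
qed

lemma approx_divide:
  assumes "approx X m (scal [:a:] * h)" "a \<noteq> 0"
  shows "approx X m h"
proof -
  obtain d x y where d: "d \<noteq> 0" "x \<in> X" "scal [:d:] * (scal [:a:] * h) = x + scal (xi ^ m) * y"
    using assms(1) by (auto simp: approx_def)
  then show ?thesis
    using assms(2) by (intro approxI [of "a * d" x]) (auto simp: scal_scal)
qed

lemma approx_mem: "x \<in> X \<Longrightarrow> approx X m x"
  unfolding approx_def by (intro exI [of _ 1] conjI bexI [of _ x] exI [of _ 0]) (simp_all flip: one_pCons)

lemma approx_0: "submodule X \<Longrightarrow> approx X 0 h"
  unfolding approx_def submodule_def
  by (intro exI [of _ 1] conjI bexI [of _ 0] exI [of _ h]) (simp_all flip: one_pCons)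

lemma approx_sum:
  assumes "submodule X" "\<And>i. i \<in> A \<Longrightarrow> approx X m (f i)"
  shows "approx X m (\<Sum>i\<in>A. f i)"
proof -
  have "approx X m 0"
    using assms(1) by (intro approx_mem) (simp add: submodule_def)
  then show ?thesis
    using assms by (induction A rule: infinite_finite_induct) (auto intro: approx_add)
qed

lemma approx_diff: "submodule X \<Longrightarrow> approx X m h \<Longrightarrow> approx X m h' \<Longrightarrow> approx X m (h - h')"
  using approx_add [of X m h "scal (- 1) * h'"] approx_scal [of X m h' "- 1"] by (simp add: scal_minus)

lemma xi_closure_mem: "x \<in> X \<Longrightarrow> x \<in> xi_closure X"
  by (simp add: xi_closure_def approx_mem)

lemma xi_closure_add: "submodule X \<Longrightarrow> x \<in> xi_closure X \<Longrightarrow> y \<in> xi_closure X \<Longrightarrow> x + y \<in> xi_closure X"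
  by (simp add: xi_closure_def approx_add)

lemma xi_closure_diff: "submodule X \<Longrightarrow> x \<in> xi_closure X \<Longrightarrow> y \<in> xi_closure X \<Longrightarrow> x - y \<in> xi_closure X"
  by (simp add: xi_closure_def approx_diff)

lemma xi_closure_scal: "submodule X \<Longrightarrow> x \<in> xi_closure X \<Longrightarrow> scal c * x \<in> xi_closure X"
  by (simp add: xi_closure_def approx_scal)

lemma xi_closure_sum: "submodule X \<Longrightarrow> (\<And>i. i \<in> A \<Longrightarrow> f i \<in> xi_closure X) \<Longrightarrow> (\<Sum>i\<in>A. f i) \<in> xi_closure X"
  by (simp add: xi_closure_def approx_sum)

lemma xi_closure_mono: "X \<subseteq> Y \<Longrightarrow> x \<in> xi_closure X \<Longrightarrow> x \<in> xi_closure Y"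
  unfolding xi_closure_def approx_def by blast

lemma xi_closure_mult:
  assumes "h \<in> xi_closure X" "h' \<in> xi_closure Y" "\<And>x y. x \<in> X \<Longrightarrow> y \<in> Y \<Longrightarrow> x * y \<in> Z"
  shows "h * h' \<in> xi_closure Z"
proof -
  have "approx Z m (h * h')" for m
  proof -
    have "approx X m h" "approx Y m h'"
      using assms(1,2) by (simp_all add: xi_closure_def)
    from approxE [OF this(1)] obtain d x u where d: "d \<noteq> 0" "x \<in> X" "scal [:d:] * h = x + scal (xi ^ m) * u"
      by blast
    from approxE [OF \<open>approx Y m h'\<close>] obtain d' y v
      where d': "d' \<noteq> 0" "y \<in> Y" "scal [:d':] * h' = y + scal (xi ^ m) * v"
      by blast
    let ?q = "scal (xi ^ m)"
    have "scal [:d * d':] * (h * h') = (scal [:d:] * h) * (scal [:d':] * h')"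
      using mult_scal [of h "[:d':]" h'] by (simp add: scal_scal mult.assoc mult.commute [of d])
    also have "\<dots> = x * y + (x * (?q * v) + ?q * (u * (y + ?q * v)))"
      unfolding d d' by (simp add: distrib_left distrib_right mult.assoc add_ac)
    also have "\<dots> = x * y + ?q * (x * v + u * (y + ?q * v))"
      unfolding mult_scal [of x] by (simp only: distrib_left)
    finally have "scal [:d * d':] * (h * h') = x * y + ?q * (x * v + u * (y + ?q * v))" .
    moreover have "x * y \<in> Z"
      using d d' assms(3) by blast
    ultimately show ?thesis
      unfolding approx_def using d d' by (intro exI [of _ "d * d'"]) auto
  qed
  then show ?thesis
    by (simp add: xi_closure_def)
qed

lemma xi_power: "xi ^ m = monom 1 m"
  by (induction m) (simp_all add: xi_def monom_Suc flip: one_pCons)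

text \<open>Precision i + 1 determines the coefficient of \<xi>^i, where the nonzero integer
  \<open>d\<close> cancels.\<close>

lemma xi_closure_vanish:
  assumes h: "h \<in> xi_closure X" and van: "\<And>x. x \<in> X \<Longrightarrow> tau (x * g) = 0"
  shows "tau (h * g) = 0"
proof (rule poly_eqI)
  fix i
  obtain d x y where d: "d \<noteq> 0" "x \<in> X" "scal [:d:] * h = x + scal (xi ^ Suc i) * y"
    using h unfolding xi_closure_def approx_def by blast
  have "[:d:] * tau (h * g) = tau (scal [:d:] * h * g)"
    by (simp add: mult.assoc)
  also have "\<dots> = xi ^ Suc i * tau (y * g)"
    unfolding d using van [OF d(2)] by (simp add: distrib_right mult.assoc)
  finally have "coeff ([:d:] * tau (h * g)) i = coeff (xi ^ Suc i * tau (y * g)) i"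
    by simp
  then show "coeff (tau (h * g)) i = coeff 0 i"
    using d(1) unfolding xi_power coeff_monom_mult by simp
qed

lemma poly_split_xi: "\<exists>q. p = [:poly p 0:] + xi * q" for p :: "int poly"
  by (cases p) (auto simp: xi_def)

text \<open>A system of relations that is triangular modulo \<open>\<xi>\<close> can be inverted \<open>\<xi>\<close>-adically.\<close>

lemma xi_closure_triangular:
  fixes u :: "'a \<Rightarrow> hecke_fin" and l :: "'a \<Rightarrow> nat" and t :: "'a \<Rightarrow> 'a \<Rightarrow> int poly"
  assumes X: "submodule X" and fin: "finite A"
    and rel: "\<And>a. a \<in> A \<Longrightarrow> (\<Sum>b\<in>A. scal (t a b) * u b) \<in> xi_closure X"
    and tri: "\<And>a b. a \<in> A \<Longrightarrow> b \<in> A \<Longrightarrow> poly (t a b) 0 \<noteq> 0 \<Longrightarrow> b = a \<or> l b < l a"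
    and diag: "\<And>a. a \<in> A \<Longrightarrow> poly (t a a) 0 \<noteq> 0"
    and a: "a \<in> A"
  shows "u a \<in> xi_closure X"
proof -
  have "\<forall>a\<in>A. approx X m (u a)" for m
  proof (induction m)
    case 0
    then show ?case
      using approx_0 [OF X] by blast
  next
    case (Suc m)
    \<comment> \<open>Entries divisible by \<xi> gain one power of precision from the outer
      induction on \<open>m\<close>; the remaining off-diagonal entries belong to smaller
      \<open>l\<close>, where the inner induction applies.\<close>
    have xi: "approx X (Suc m) (scal (xi * q) * u b)" if "b \<in> A" for q b
      using approx_scal [OF X approx_xi [OF X], of m "u b" q] Suc that by (simp add: scal_scal mult.commute)
    have "approx X (Suc m) (u a)" if "a \<in> A" for a
      using that
    proof (induction "l a" arbitrary: a rule: less_induct)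
      case less
      obtain q where q: "t a a = [:poly (t a a) 0:] + xi * q"
        using poly_split_xi by blast
      have "approx X (Suc m) (scal (t a b) * u b)" if b: "b \<in> A - {a}" for b
      proof (cases "poly (t a b) 0 = 0")
        case True
        then obtain q where "t a b = xi * q"
          using poly_split_xi [of "t a b"] by auto
        then show ?thesis
          using xi b by simp
      next
        case False
        then show ?thesis
          using tri [of a b] less b by (intro approx_scal [OF X]) auto
      qed
      then have rest: "approx X (Suc m) (\<Sum>b\<in>A - {a}. scal (t a b) * u b)"
        by (rule approx_sum [OF X])
      have "scal [:poly (t a a) 0:] * u a = scal (t a a) * u a - scal (xi * q) * u a"
        by (subst q) (simp add: scal_add distrib_right)
      also have "scal (t a a) * u a = (\<Sum>b\<in>A. scal (t a b) * u b) - (\<Sum>b\<in>A - {a}. scal (t a b) * u b)"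
        using fin less.prems by (simp add: sum.remove [of A a])
      finally have "scal [:poly (t a a) 0:] * u a
        = (\<Sum>b\<in>A. scal (t a b) * u b) - (\<Sum>b\<in>A - {a}. scal (t a b) * u b) - scal (xi * q) * u a" .
      moreover have "approx X (Suc m) \<dots>"
        using rel [OF less.prems] rest xi [OF less.prems] by (intro approx_diff [OF X]) (simp_all add: xi_closure_def)
      ultimately show ?case
        using diag [OF less.prems] approx_divide by metis
    qed
    then show ?case by blast
  qed
  then show ?thesis
    using a by (simp add: xi_closure_def)
qed

section \<open>Filtrations for the degree bound and for stability\<close>

lemma submodule_JMdeg: "submodule (JMdeg n r)"
  unfolding submodule_def using JMdeg_zero JMdeg_add JMdeg_scal by blast

text \<open>The second summand may have full degree r, but at Coxeter elements inside S_n it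
  vanishes like a polynomial of lower degree. The changes from level n to n + 1 fall into this
  class.\<close>

definition JMdeg_top :: "nat \<Rightarrow> nat \<Rightarrow> hecke_fin set" where
  "JMdeg_top n r = {x + JM (Suc n) * y | x y. x \<in> JMdeg (Suc n) r \<and> y \<in> JMdeg (Suc n) r}"

lemma JMdeg_top_I: "x \<in> JMdeg (Suc n) r \<Longrightarrow> y \<in> JMdeg (Suc n) r \<Longrightarrow> x + JM (Suc n) * y \<in> JMdeg_top n r"
  unfolding JMdeg_top_def by blast

lemma JMdeg_top_I1: "x \<in> JMdeg (Suc n) r \<Longrightarrow> x \<in> JMdeg_top n r"
  using JMdeg_top_I [OF _ JMdeg_zero] by simp

lemma JMdeg_top_I2: "y \<in> JMdeg (Suc n) r \<Longrightarrow> JM (Suc n) * y \<in> JMdeg_top n r"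
  using JMdeg_top_I [OF JMdeg_zero] by fastforce

lemma JMdeg_top_add: "v \<in> JMdeg_top n r \<Longrightarrow> w \<in> JMdeg_top n r \<Longrightarrow> v + w \<in> JMdeg_top n r"
proof -
  assume "v \<in> JMdeg_top n r" "w \<in> JMdeg_top n r"
  then obtain x y x' y' where "v = x + JM (Suc n) * y" "w = x' + JM (Suc n) * y'"
    and "x \<in> JMdeg (Suc n) r" "y \<in> JMdeg (Suc n) r" "x' \<in> JMdeg (Suc n) r" "y' \<in> JMdeg (Suc n) r"
    by (auto simp: JMdeg_top_def)
  then show ?thesis
    using JMdeg_top_I [of "x + x'" n r "y + y'"] by (simp add: JMdeg_add distrib_left add_ac)
qed

lemma JMdeg_top_JMdeg:
  assumes "w \<in> JMdeg_top n r" "x \<in> JMdeg (Suc n) (Suc a)"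
  shows "w * x \<in> JMdeg_top n (r + a)" "x * w \<in> JMdeg_top n (r + a)"
proof -
  obtain u v where w: "w = u + JM (Suc n) * v" "u \<in> JMdeg (Suc n) r" "v \<in> JMdeg (Suc n) r"
    using assms(1) by (auto simp: JMdeg_top_def)
  then show 1: "w * x \<in> JMdeg_top n (r + a)"
    using JMdeg_mult [OF w(2) assms(2)] JMdeg_mult [OF w(3) assms(2)] JMdeg_top_I [of "u * x" n "r + a" "v * x"]
    by (simp add: distrib_right mult.assoc)
  have "x * w = w * x"
    using JMdeg_commute [OF assms(2) w(2)] JMdeg_commute [OF assms(2) w(3)] JMdeg_commute_JM [OF assms(2), of "Suc n"]
    unfolding w(1) distrib_left distrib_right by (metis mult.assoc)
  with 1 show "x * w \<in> JMdeg_top n (r + a)"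
    by simp
qed

lemma submodule_JMdeg_top: "submodule (JMdeg_top n r)"
  unfolding submodule_def
proof (intro conjI ballI allI)
  show "0 \<in> JMdeg_top n r"
    by (intro JMdeg_top_I1 JMdeg_zero)
next
  fix c x assume "x \<in> JMdeg_top n r"
  moreover have "scal c \<in> JMdeg (Suc n) (Suc 0)"
    using JMdeg_scal [OF JMdeg_one [of "Suc n" 0], of c] by simp
  ultimately show "scal c * x \<in> JMdeg_top n r"
    using JMdeg_top_JMdeg(2) by fastforce
qed (rule JMdeg_top_add)

lemma JMdeg_top_vanish:
  assumes "w \<in> JMdeg_top n r" "J \<subseteq> {1..<n}" "r \<le> card J"
  shows "tau (w * Tcox J 1 (Suc n)) = 0"
proof -
  obtain x y where w: "w = x + JM (Suc n) * y" "x \<in> JMdeg (Suc n) r" "y \<in> JMdeg (Suc n) r"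
    using assms(1) by (auto simp: JMdeg_top_def)
  have "J \<subseteq> {1..<Suc n}"
    using assms(2) by auto
  then have "tau (x * Tcox J 1 (Suc n)) = 0"
    using w(2) assms(3) by (intro JMdeg_vanish)
  moreover have "tau (JM (Suc n) * y * Tcox J 1 (Suc n)) = 0"
    using w(3) assms(2,3) by (rule JM_JMdeg_vanish)
  ultimately show ?thesis
    by (simp add: w(1) distrib_right)
qed

text \<open>Each power sum grows by L_{n+1}^k, a multiple of L_{n+1} because k > 0.\<close>

lemma psums_Suc_diff:
  assumes n: "1 \<le> n" and ks: "0 \<notin> set ks"
  shows "psums (Suc n) ks - psums n ks \<in> JMdeg_top n (sum_list ks)"
  using ks
proof (induction ks)
  case Nil
  then show ?case
    by (simp add: psums_def JMdeg_top_I1 JMdeg_zero)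
next
  case (Cons k ks)
  then obtain k' where k: "k = Suc k'"
    by (cases k) auto
  let ?P = "psums n ks" and ?P' = "psums (Suc n) ks" and ?p = "psum n k"
  \<comment> \<open>Telescoping: p' P' - p P = p (P' - P) + (p' - p) P', where p' - p is the k-th
    power of L_{n+1}.\<close>
  have "psums (Suc n) (k # ks) - psums n (k # ks) = ?p * (?P' - ?P) + JM (Suc n) * (JM (Suc n) ^ k' * ?P')"
    by (simp add: psums_def psum_def k algebra_simps)
  moreover have "?p * (?P' - ?P) \<in> JMdeg_top n (sum_list ks + k)"
  proof (rule JMdeg_top_JMdeg(2))
    show "?P' - ?P \<in> JMdeg_top n (sum_list ks)"
      using Cons by simp
    show "?p \<in> JMdeg (Suc n) (Suc k)"
      unfolding psum_def by (intro JMdeg_sum JMdeg_JM_power) auto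
  qed
  moreover have "JM (Suc n) * (JM (Suc n) ^ k' * ?P') \<in> JMdeg_top n (sum_list ks + k)"
  proof (rule JMdeg_top_I2)
    show "JM (Suc n) ^ k' * ?P' \<in> JMdeg (Suc n) (sum_list ks + k)"
      using JMdeg_mult [OF JMdeg_JM_power [of "Suc n" "Suc n" k'] psums_JMdeg [of "Suc n" ks]] by (simp add: k add_ac)
  qed
  ultimately show ?case
    using JMdeg_top_add by (simp add: add.commute)
qed

text \<open>The canonical composition of \<open>n\<close> of type \<open>\<rho>\<close>; its generators do not depend on \<open>n\<close>.\<close>

definition parts :: "ptn \<Rightarrow> nat list" where
  "parts \<rho> = sorted_list_of_multiset \<rho>"

definition comp_of :: "nat \<Rightarrow> ptn \<Rightarrow> nat list" where
  "comp_of n \<rho> = replicate (n - (\<Sum>\<^sub># \<rho> + size \<rho>)) 1 @ map Suc (parts \<rho>)"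

definition gens :: "ptn \<Rightarrow> nat set" where
  "gens \<rho> = cgens (map Suc (parts \<rho>))"

lemma mset_parts [simp]: "mset (parts \<rho>) = \<rho>"
  by (simp add: parts_def)

lemma sum_list_parts [simp]: "sum_list (parts \<rho>) = \<Sum>\<^sub># \<rho>"
  by (metis mset_parts sum_mset_sum_list)

lemma length_parts [simp]: "length (parts \<rho>) = size \<rho>"
  by (metis mset_parts size_mset)

lemma set_parts [simp]: "set (parts \<rho>) = set_mset \<rho>"
  by (simp add: parts_def)

lemma sum_list_map_Suc: "sum_list (map Suc xs) = sum_list xs + length xs"
  by (induction xs) auto

lemma comp_of_zero: "0 \<notin> set (comp_of n \<rho>)"
  by (auto simp: comp_of_def)

lemma comp_of_sum: "\<rho> \<in> ptns n \<Longrightarrow> sum_list (comp_of n \<rho>) = n"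
  by (simp add: comp_of_def ptns_def sum_list_map_Suc sum_list_replicate)

lemma comp_of_cgens: "cgens (comp_of n \<rho>) = gens \<rho>"
proof -
  have "cgens (replicate m 1 @ bs) = cgens bs" for m bs
    by (induction m) auto
  then show ?thesis
    by (simp add: comp_of_def gens_def)
qed

lemma comp_of_filter:
  "0 \<notin># \<rho> \<Longrightarrow> map (\<lambda>b. b - 1) (filter (\<lambda>b. 1 < b) (comp_of n \<rho>)) = parts \<rho>"
proof -
  assume "0 \<notin># \<rho>"
  then have "0 \<notin> set (parts \<rho>)"
    by simp
  moreover have "map (\<lambda>b. b - 1) (filter (\<lambda>b. 1 < b) (map Suc xs)) = xs" if "0 \<notin> set xs" for xs :: "nat list"
    using that by (induction xs) auto
  moreover have "filter (\<lambda>b. 1 < b) (replicate m (1::nat)) = []" for m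
    by simp
  ultimately show ?thesis
    by (simp add: comp_of_def)
qed

lemma ptns_zero: "\<rho> \<in> ptns n \<Longrightarrow> 0 \<notin># \<rho>"
  by (simp add: ptns_def)

lemma comp_of_type: "\<rho> \<in> ptns n \<Longrightarrow> ctype (comp_of n \<rho>) = \<rho>"
  using comp_of_filter [OF ptns_zero] by (simp add: ctype_def)

lemma card_gens: "0 \<notin># \<rho> \<Longrightarrow> card (gens \<rho>) = \<Sum>\<^sub># \<rho>"
  unfolding gens_def card_cgens by (simp add: comp_def)

lemma gens_subset: "\<rho> \<in> ptns n \<Longrightarrow> gens \<rho> \<subseteq> {1..<n}"
  using cgens_subset [of "comp_of n \<rho>"] by (simp add: comp_of_sum comp_of_cgens)

lemma mset_composition:
  assumes "0 \<notin> set bs"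
  shows "\<Sum>\<^sub># (ctype bs) + size (ctype bs) \<le> sum_list bs
    \<and> mset bs = replicate_mset (sum_list bs - (\<Sum>\<^sub># (ctype bs) + size (ctype bs))) 1 + image_mset Suc (ctype bs)"
  using assms
proof (induction bs)
  case (Cons b bs)
  then have IH: "\<Sum>\<^sub># (ctype bs) + size (ctype bs) \<le> sum_list bs"
    "mset bs = replicate_mset (sum_list bs - (\<Sum>\<^sub># (ctype bs) + size (ctype bs))) 1 + image_mset Suc (ctype bs)"
    by auto
  show ?case
  proof (cases "1 < b")
    case True
    have "b + sum_list bs - (b - 1 + \<Sum>\<^sub># (ctype bs) + Suc (size (ctype bs)))
        = sum_list bs - (\<Sum>\<^sub># (ctype bs) + size (ctype bs))"
      using True by simp
    moreover have "mset (b # bs) = add_mset b (mset bs)"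
      by simp
    ultimately show ?thesis
      using IH True by (simp add: ctype_Cons)
  next
    case False
    then have "b = 1"
      using Cons.prems by (cases b) auto
    moreover have "Suc (sum_list bs) - (\<Sum>\<^sub># (ctype bs) + size (ctype bs))
        = Suc (sum_list bs - (\<Sum>\<^sub># (ctype bs) + size (ctype bs)))"
      using IH(1) by simp
    moreover have "mset (b # bs) = add_mset b (mset bs)"
      by simp
    ultimately show ?thesis
      using IH by (simp add: ctype_Cons)
  qed
qed simp

lemma ctype_ptns: "0 \<notin> set bs \<Longrightarrow> sum_list bs = n \<Longrightarrow> ctype bs \<in> ptns n"
  using mset_composition [of bs] by (auto simp: ptns_def ctype_def)

lemma mset_comp_of_type:
  assumes "0 \<notin> set bs" "sum_list bs = n"
  shows "mset (comp_of n (ctype bs)) = mset bs"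
  using mset_composition [OF assms(1)] assms(2) by (simp add: comp_of_def)

lemma finite_ptns: "finite (ptns n)"
proof (rule finite_subset)
  show "ptns n \<subseteq> mset ` {xs. set xs \<subseteq> {..n} \<and> length xs \<le> n}"
  proof
    fix \<rho> assume \<rho>: "\<rho> \<in> ptns n"
    have "x \<le> n" if "x \<in># \<rho>" for x
    proof -
      have "x \<le> \<Sum>\<^sub># \<rho>"
        using that by (metis sum_mset.remove le_add1)
      then show ?thesis
        using \<rho> by (simp add: ptns_def)
    qed
    then have "parts \<rho> \<in> {xs. set xs \<subseteq> {..n} \<and> length xs \<le> n}"
      using \<rho> by (auto simp: ptns_def)
    then show "\<rho> \<in> mset ` {xs. set xs \<subseteq> {..n} \<and> length xs \<le> n}"
      by (rule image_eqI [rotated]) simp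
  qed
qed (simp add: finite_lists_length_le)

lemma ptns_Suc: "\<rho> \<in> ptns n \<Longrightarrow> \<rho> \<in> ptns (Suc n)"
  by (simp add: ptns_def)

lemma central_in_scal: "central_in n x \<Longrightarrow> central_in n (scal c * x)"
  by (auto simp: central_in_def Hsub_scal mult.assoc mult_scal)

lemma central_in_add: "central_in n x \<Longrightarrow> central_in n y \<Longrightarrow> central_in n (x + y)"
  by (auto simp: central_in_def Hsub_add distrib_left distrib_right)

lemma central_in_diff: "central_in n x \<Longrightarrow> central_in n y \<Longrightarrow> central_in n (x - y)"
  by (auto simp: central_in_def Hsub_diff left_diff_distrib right_diff_distrib)

lemma central_in_sum: "(\<And>i. i \<in> A \<Longrightarrow> central_in n (f i)) \<Longrightarrow> central_in n (\<Sum>i\<in>A. f i)"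
proof (induction A rule: infinite_finite_induct)
  case (insert x F)
  then show ?case
    by (auto intro: central_in_add)
qed (simp_all add: central_in_def)

text \<open>The coordinate functional of the class element of type \<rho>. Since
  \<open>gens \<rho>\<close> does not depend on n, the same pairing can be evaluated at neighbouring
  levels.\<close>

definition theta :: "nat \<Rightarrow> ptn \<Rightarrow> hecke_fin \<Rightarrow> int poly" where
  "theta n \<rho> z = tau (z * Tcox (gens \<rho>) 1 n)"

lemma theta_Suc: "\<rho> \<in> ptns n \<Longrightarrow> 1 \<le> n \<Longrightarrow> theta (Suc n) \<rho> z = theta n \<rho> z"
  using gens_subset [of \<rho> n] by (auto simp: theta_def Tcox_Suc)

text \<open>The interface between the presented algebra and the model; the second assumption is the
  minimal-length condition evaluated at Coxeter elements.\<close>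

locale class_elements =
  fixes \<gamma> :: "nat \<Rightarrow> ptn \<Rightarrow> hecke_fin"
  assumes central: "1 \<le> n \<Longrightarrow> \<rho> \<in> ptns n \<Longrightarrow> central_in n (\<gamma> n \<rho>)"
    and coeff_cox: "1 \<le> n \<Longrightarrow> \<rho> \<in> ptns n \<Longrightarrow> J \<subseteq> {1..<n} \<Longrightarrow>
      coef (\<gamma> n \<rho>) (inverse (cox J 1 n)) = of_bool (modified_cycle_type n (apply (inverse (cox J 1 n))) = \<rho>)"
begin

lemma tau_class:
  assumes "1 \<le> n" "\<rho> \<in> ptns n" "0 \<notin> set bs" "sum_list bs = n"
  shows "tau (\<gamma> n \<rho> * Tcox (cgens bs) 1 n) = of_bool (ctype bs = \<rho>)"
  using coeff_cox [OF assms(1,2), of "cgens bs"] cgens_subset [of bs] modified_cycle_type_cox_cgens [OF assms(3,4)] assms(4)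
  unfolding tau_mult_Tcox by simp

lemma theta_class:
  assumes "1 \<le> n" "\<rho> \<in> ptns n" "\<sigma> \<in> ptns n"
  shows "theta n \<sigma> (\<gamma> n \<rho>) = of_bool (\<sigma> = \<rho>)"
  using tau_class [OF assms(1,2) comp_of_zero comp_of_sum [OF assms(3)]]
  by (simp add: theta_def comp_of_cgens comp_of_type assms)

lemma theta_combination:
  assumes "1 \<le> n" "\<sigma> \<in> ptns n"
  shows "theta n \<sigma> (\<Sum>\<rho>\<in>ptns n. scal (c \<rho>) * \<gamma> n \<rho>) = c \<sigma>"
proof -
  have "theta n \<sigma> (\<Sum>\<rho>\<in>ptns n. scal (c \<rho>) * \<gamma> n \<rho>) = (\<Sum>\<rho>\<in>ptns n. c \<rho> * theta n \<sigma> (\<gamma> n \<rho>))"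
    by (simp add: theta_def sum_distrib_right mult.assoc)
  also have "\<dots> = (\<Sum>\<rho>\<in>ptns n. if \<rho> = \<sigma> then c \<rho> else 0)"
    using assms by (intro sum.cong) (auto simp: theta_class)
  also have "\<dots> = c \<sigma>"
    using assms by (simp add: finite_ptns)
  finally show ?thesis .
qed

text \<open>Both sides are central with equal coordinates. Rearranging blocks reduces any Coxeter
  element to the canonical one of its type, and a central element vanishing at all of them is
  zero.\<close>

lemma central_expand:
  assumes n: "1 \<le> n" and z: "central_in n z"
  shows "z = (\<Sum>\<rho>\<in>ptns n. scal (theta n \<rho> z) * \<gamma> n \<rho>)"
proof -
  let ?z = "\<Sum>\<rho>\<in>ptns n. scal (theta n \<rho> z) * \<gamma> n \<rho>"
  have z': "central_in n ?z"
    using n by (intro central_in_sum central_in_scal central)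
  have "z - ?z = 0"
  proof (rule central_eq_0I [OF central_in_diff [OF z z'] n])
    fix K assume "K \<subseteq> {1..<n}"
    then obtain bs where bs: "0 \<notin> set bs" "sum_list bs = n" "cgens bs = K"
      using exists_composition by blast
    let ?\<sigma> = "ctype bs"
    have \<sigma>: "?\<sigma> \<in> ptns n"
      using bs by (intro ctype_ptns)
    have eq: "tau (y * Tcox K 1 n) = theta n ?\<sigma> y" if "central_in n y" for y
      using tau_Tcox_mset_cong [OF that comp_of_zero comp_of_sum [OF \<sigma>] mset_comp_of_type [OF bs(1,2)]]
      by (simp add: theta_def comp_of_cgens bs(3))
    show "tau ((z - ?z) * Tcox K 1 n) = 0"
      using eq [OF z] eq [OF z'] theta_combination [OF n \<sigma>, of "\<lambda>\<rho>. theta n \<rho> z"]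
      by (simp add: left_diff_distrib)
  qed
  then show ?thesis by simp
qed

lemma theta_psums_tri:
  assumes "\<rho> \<in> ptns n" "0 \<notin># lam" "\<Sum>\<^sub># \<rho> = \<Sum>\<^sub># lam" "poly (theta n \<rho> (psums n (parts lam))) 0 \<noteq> 0"
  shows "\<rho> = lam \<or> size \<rho> < size lam"
  using psums_leading [OF comp_of_zero, of "parts lam" n \<rho>] assms
  by (simp add: comp_of_sum comp_of_cgens comp_of_type card_gens ptns_zero theta_def disj_commute)

lemma theta_psums_diag:
  assumes "\<rho> \<in> ptns n"
  shows "poly (theta n \<rho> (psums n (parts \<rho>))) 0 \<noteq> 0"
  using psums_leading_diag [OF comp_of_zero, of n \<rho>] assms comp_of_filter [OF ptns_zero [OF assms], of n]
  by (simp add: comp_of_sum comp_of_cgens theta_def)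

lemma theta_vanish:
  assumes "\<rho> \<in> ptns n" "z \<in> xi_closure (JMdeg n r)" "r \<le> \<Sum>\<^sub># \<rho>"
  shows "theta n \<rho> z = 0"
  unfolding theta_def
proof (rule xi_closure_vanish [OF assms(2)])
  fix x assume "x \<in> JMdeg n r"
  then show "tau (x * Tcox (gens \<rho>) 1 n) = 0"
    using assms gens_subset [OF assms(1)] card_gens [OF ptns_zero [OF assms(1)]] by (intro JMdeg_vanish) auto
qed

text \<open>In the expansion of the product into class elements, types above r have coordinate zero
  by the degree bound and types below r are of lower degree by \<open>lower\<close>.\<close>

lemma psums_top_part:
  assumes n: "1 \<le> n" and r: "\<Sum>\<^sub># lam = r"
    and lower: "\<And>\<rho>. \<rho> \<in> ptns n \<Longrightarrow> \<Sum>\<^sub># \<rho> < r \<Longrightarrow> \<gamma> n \<rho> \<in> xi_closure (JMdeg n (Suc (\<Sum>\<^sub># \<rho>)))"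
  shows "psums n (parts lam) - (\<Sum>\<rho>\<in>{\<rho>\<in>ptns n. \<Sum>\<^sub># \<rho> = r}. scal (theta n \<rho> (psums n (parts lam))) * \<gamma> n \<rho>)
    \<in> xi_closure (JMdeg n r)"
proof -
  let ?p = "psums n (parts lam)"
  let ?f = "\<lambda>\<rho>. scal (theta n \<rho> ?p) * \<gamma> n \<rho>"
  have "?p \<in> JMdeg n (Suc r)"
    using psums_JMdeg [OF n, of "parts lam"] r by simp
  then have zero: "?f \<rho> = 0" if "\<rho> \<in> ptns n" "r < \<Sum>\<^sub># \<rho>" for \<rho>
    using theta_vanish [OF that(1) xi_closure_mem, of ?p "Suc r"] that(2) by simp
  have "?p = sum ?f (ptns n)"
    by (rule central_expand [OF n central_psums])
  also have "\<dots> = sum ?f {\<rho>\<in>ptns n. \<Sum>\<^sub># \<rho> = r} + sum ?f (ptns n - {\<rho>\<in>ptns n. \<Sum>\<^sub># \<rho> = r})"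
    by (simp add: sum.subset_diff [of "{\<rho>\<in>ptns n. \<Sum>\<^sub># \<rho> = r}" "ptns n"] finite_ptns add.commute)
  also have "sum ?f (ptns n - {\<rho>\<in>ptns n. \<Sum>\<^sub># \<rho> = r}) = sum ?f {\<rho>\<in>ptns n. \<Sum>\<^sub># \<rho> < r}"
  proof (rule sum.mono_neutral_right)
    show "\<forall>\<rho>\<in>ptns n - {\<rho>\<in>ptns n. \<Sum>\<^sub># \<rho> = r} - {\<rho>\<in>ptns n. \<Sum>\<^sub># \<rho> < r}. ?f \<rho> = 0"
    proof
      fix \<rho> assume "\<rho> \<in> ptns n - {\<rho>\<in>ptns n. \<Sum>\<^sub># \<rho> = r} - {\<rho>\<in>ptns n. \<Sum>\<^sub># \<rho> < r}"
      then show "?f \<rho> = 0"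
        by (intro zero) auto
    qed
  qed (auto simp: finite_ptns)
  finally have "?p - sum ?f {\<rho>\<in>ptns n. \<Sum>\<^sub># \<rho> = r} = sum ?f {\<rho>\<in>ptns n. \<Sum>\<^sub># \<rho> < r}"
    by (simp add: algebra_simps)
  also have "\<dots> \<in> xi_closure (JMdeg n r)"
  proof (intro xi_closure_sum xi_closure_scal submodule_JMdeg)
    fix \<rho> assume \<rho>: "\<rho> \<in> {\<rho>\<in>ptns n. \<Sum>\<^sub># \<rho> < r}"
    have "JMdeg n (Suc (\<Sum>\<^sub># \<rho>)) \<subseteq> JMdeg n r"
      using \<rho> by (auto intro: JMdeg_mono)
    then show "\<gamma> n \<rho> \<in> xi_closure (JMdeg n r)"
      using lower [of \<rho>] \<rho> xi_closure_mono by blast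
  qed
  finally show ?thesis .
qed

text \<open>With the lower types known, the power sum products of a given degree form a linear
  system in the class elements of that degree, triangular modulo \<xi> by number of parts.\<close>

lemma class_xi_closure_JMdeg: "1 \<le> n \<Longrightarrow> lam \<in> ptns n \<Longrightarrow> \<gamma> n lam \<in> xi_closure (JMdeg n (Suc (\<Sum>\<^sub># lam)))"
proof (induction "\<Sum>\<^sub># lam" arbitrary: lam rule: less_induct)
  case less
  let ?r = "\<Sum>\<^sub># lam"
  let ?A = "{\<rho>\<in>ptns n. \<Sum>\<^sub># \<rho> = ?r}"
  show ?case
  proof (rule xi_closure_triangular [where A = ?A and u = "\<gamma> n" and l = size
        and t = "\<lambda>a b. theta n b (psums n (parts a))"])
    fix a assume a: "a \<in> ?A"
    have "psums n (parts a) - (\<Sum>b\<in>?A. scal (theta n b (psums n (parts a))) * \<gamma> n b) \<in> xi_closure (JMdeg n ?r)"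
      using a less by (intro psums_top_part) auto
    moreover have "JMdeg n ?r \<subseteq> JMdeg n (Suc ?r)"
      by (auto intro: JMdeg_mono)
    ultimately have 1: "psums n (parts a) - (\<Sum>b\<in>?A. scal (theta n b (psums n (parts a))) * \<gamma> n b) \<in> xi_closure (JMdeg n (Suc ?r))"
      using xi_closure_mono by blast
    have 2: "psums n (parts a) \<in> xi_closure (JMdeg n (Suc ?r))"
      using psums_JMdeg [OF less.prems(1), of "parts a"] a by (intro xi_closure_mem) simp
    have "psums n (parts a) - (psums n (parts a) - (\<Sum>b\<in>?A. scal (theta n b (psums n (parts a))) * \<gamma> n b))
        \<in> xi_closure (JMdeg n (Suc ?r))"
      by (rule xi_closure_diff [OF submodule_JMdeg 2 1])
    then show "(\<Sum>b\<in>?A. scal (theta n b (psums n (parts a))) * \<gamma> n b) \<in> xi_closure (JMdeg n (Suc ?r))"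
      by (simp only: diff_diff_eq2 add_diff_cancel_left')
  next
    fix a b assume "a \<in> ?A" "b \<in> ?A" "poly (theta n b (psums n (parts a))) 0 \<noteq> 0"
    then show "b = a \<or> size b < size a"
      using theta_psums_tri [of b n a] ptns_zero by auto
  qed (use less.prems in \<open>auto simp: finite_ptns theta_psums_diag submodule_JMdeg\<close>)
qed

lemma theta_product_vanish:
  assumes n: "1 \<le> n" and "lam \<in> ptns n" "\<mu> \<in> ptns n" "\<nu> \<in> ptns n"
    and "\<Sum>\<^sub># lam + \<Sum>\<^sub># \<mu> < \<Sum>\<^sub># \<nu>"
  shows "theta n \<nu> (\<gamma> n lam * \<gamma> n \<mu>) = 0"
proof (rule theta_vanish)
  show "\<gamma> n lam * \<gamma> n \<mu> \<in> xi_closure (JMdeg n (Suc (\<Sum>\<^sub># lam + \<Sum>\<^sub># \<mu>)))"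
  proof (rule xi_closure_mult [OF class_xi_closure_JMdeg class_xi_closure_JMdeg])
    fix x y assume "x \<in> JMdeg n (Suc (\<Sum>\<^sub># lam))" "y \<in> JMdeg n (Suc (\<Sum>\<^sub># \<mu>))"
    from JMdeg_mult [OF this] show "x * y \<in> JMdeg n (Suc (\<Sum>\<^sub># lam + \<Sum>\<^sub># \<mu>))"
      by simp
  qed (use assms in auto)
qed (use assms in auto)

text \<open>The value 0 for types that do not fit into n lets the systems at n and n + 1 be
  subtracted over one index set.\<close>

definition class0 :: "nat \<Rightarrow> ptn \<Rightarrow> hecke_fin" where
  "class0 n \<rho> = (if \<rho> \<in> ptns n then \<gamma> n \<rho> else 0)"

text \<open>The triangular system at n + 1 is applied to the differences. On types fitting into n
  its matrix agrees with that at n, so the system yields the growth of a power sum product up to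
  lower degree.\<close>

lemma class_Suc_xi_closure:
  assumes n: "1 \<le> n" and lam: "lam \<in> ptns (Suc n)"
  shows "\<gamma> (Suc n) lam - class0 n lam \<in> xi_closure (JMdeg_top n (\<Sum>\<^sub># lam))"
proof -
  let ?r = "\<Sum>\<^sub># lam"
  let ?A = "{\<rho>\<in>ptns (Suc n). \<Sum>\<^sub># \<rho> = ?r}" and ?B = "{\<rho>\<in>ptns n. \<Sum>\<^sub># \<rho> = ?r}"
  have n1: "1 \<le> Suc n"
    by simp
  show ?thesis
  proof (rule xi_closure_triangular [where A = ?A and u = "\<lambda>\<rho>. \<gamma> (Suc n) \<rho> - class0 n \<rho>" and l = size
        and t = "\<lambda>a b. theta (Suc n) b (psums (Suc n) (parts a))"])
    fix a assume a: "a \<in> ?A"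
    let ?p = "psums n (parts a)" and ?p' = "psums (Suc n) (parts a)"
    let ?S = "\<Sum>b\<in>?B. scal (theta n b ?p) * \<gamma> n b" and ?S' = "\<Sum>b\<in>?A. scal (theta (Suc n) b ?p') * \<gamma> (Suc n) b"
    have dp: "?p' - ?p \<in> JMdeg_top n ?r"
      using psums_Suc_diff [OF n, of "parts a"] a ptns_zero [of a "Suc n"] by simp
    have "(\<Sum>b\<in>?A. scal (theta (Suc n) b ?p') * class0 n b) = (\<Sum>b\<in>?B. scal (theta (Suc n) b ?p') * class0 n b)"
      by (intro sum.mono_neutral_right) (auto simp: finite_ptns class0_def ptns_Suc)
    also have "\<dots> = ?S"
    proof (rule sum.cong)
      fix b assume b: "b \<in> ?B"
      \<comment> \<open>The growth of the power sums is invisible at Coxeter elements inside S_n, so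
        both levels have the same matrix entry.\<close>
      have "theta (Suc n) b (?p' - ?p) = 0"
        unfolding theta_def
        using JMdeg_top_vanish [OF dp gens_subset] b card_gens [OF ptns_zero] by simp
      then have "theta (Suc n) b ?p' = theta n b ?p"
        using theta_Suc [of b n ?p] b n by (simp add: theta_def left_diff_distrib)
      then show "scal (theta (Suc n) b ?p') * class0 n b = scal (theta n b ?p) * \<gamma> n b"
        using b by (simp add: class0_def)
    qed simp
    finally have "(\<Sum>b\<in>?A. scal (theta (Suc n) b ?p') * (\<gamma> (Suc n) b - class0 n b)) = ?S' - ?S"
      by (simp add: right_diff_distrib sum_subtractf)
    also have "\<dots> = (?p' - ?p) - (?p' - ?S') + (?p - ?S)"
      by simp
    also have "\<dots> \<in> xi_closure (JMdeg_top n ?r)"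
    proof -
      have "?p' - ?p \<in> xi_closure (JMdeg_top n ?r)"
        using dp by (rule xi_closure_mem)
      moreover have "JMdeg (Suc n) ?r \<subseteq> JMdeg_top n ?r" "JMdeg n ?r \<subseteq> JMdeg_top n ?r"
        by (auto intro!: JMdeg_top_I1 intro: JMdeg_mono [of _ n])
      moreover have "?p' - ?S' \<in> xi_closure (JMdeg (Suc n) ?r)"
        using a class_xi_closure_JMdeg by (intro psums_top_part) auto
      moreover have "?p - ?S \<in> xi_closure (JMdeg n ?r)"
        using a n class_xi_closure_JMdeg by (intro psums_top_part) auto
      ultimately have "?p' - ?S' \<in> xi_closure (JMdeg_top n ?r)" "?p - ?S \<in> xi_closure (JMdeg_top n ?r)"
        using xi_closure_mono by blast+
      with \<open>?p' - ?p \<in> xi_closure (JMdeg_top n ?r)\<close> show ?thesis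
        by (rule xi_closure_add [OF submodule_JMdeg_top xi_closure_diff [OF submodule_JMdeg_top]])
    qed
    finally show "(\<Sum>b\<in>?A. scal (theta (Suc n) b ?p') * (\<gamma> (Suc n) b - class0 n b)) \<in> xi_closure (JMdeg_top n ?r)" .
  next
    fix a b assume "a \<in> ?A" "b \<in> ?A" "poly (theta (Suc n) b (psums (Suc n) (parts a))) 0 \<noteq> 0"
    then show "b = a \<or> size b < size a"
      using theta_psums_tri [of b "Suc n" a] ptns_zero by auto
  qed (use lam in \<open>auto simp: finite_ptns theta_psums_diag submodule_JMdeg_top\<close>)
qed

text \<open>By the product rule the change is l' (m' - m) + (l' - l) m. Each summand has one factor
  in \<open>JMdeg_top\<close>, and the degrees add up to that of \<nu>, where such terms
  vanish.\<close>

lemma theta_product_Suc: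
  assumes n: "1 \<le> n" and lam: "lam \<in> ptns n" and \<mu>: "\<mu> \<in> ptns n" and \<nu>: "\<nu> \<in> ptns n"
    and deg: "\<Sum>\<^sub># \<nu> = \<Sum>\<^sub># lam + \<Sum>\<^sub># \<mu>"
  shows "theta (Suc n) \<nu> (\<gamma> (Suc n) lam * \<gamma> (Suc n) \<mu>) = theta n \<nu> (\<gamma> n lam * \<gamma> n \<mu>)"
proof -
  let ?l = "\<gamma> n lam" and ?l' = "\<gamma> (Suc n) lam" and ?m = "\<gamma> n \<mu>" and ?m' = "\<gamma> (Suc n) \<mu>"
  have dl: "?l' - ?l \<in> xi_closure (JMdeg_top n (\<Sum>\<^sub># lam))" and dm: "?m' - ?m \<in> xi_closure (JMdeg_top n (\<Sum>\<^sub># \<mu>))"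
    using class_Suc_xi_closure [OF n ptns_Suc] lam \<mu> by (simp_all add: class0_def)
  have l': "?l' \<in> xi_closure (JMdeg (Suc n) (Suc (\<Sum>\<^sub># lam)))"
    using lam by (intro class_xi_closure_JMdeg ptns_Suc) simp
  have "JMdeg n (Suc (\<Sum>\<^sub># \<mu>)) \<subseteq> JMdeg (Suc n) (Suc (\<Sum>\<^sub># \<mu>))"
    by (auto intro: JMdeg_mono)
  then have m: "?m \<in> xi_closure (JMdeg (Suc n) (Suc (\<Sum>\<^sub># \<mu>)))"
    using class_xi_closure_JMdeg [OF n \<mu>] xi_closure_mono by blast
  have "?l' * (?m' - ?m) \<in> xi_closure (JMdeg_top n (\<Sum>\<^sub># \<nu>))"
    using JMdeg_top_JMdeg(2) by (intro xi_closure_mult [OF l' dm]) (auto simp: deg add.commute)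
  moreover have "(?l' - ?l) * ?m \<in> xi_closure (JMdeg_top n (\<Sum>\<^sub># \<nu>))"
    using JMdeg_top_JMdeg(1) by (intro xi_closure_mult [OF dl m]) (auto simp: deg)
  ultimately have "?l' * (?m' - ?m) + (?l' - ?l) * ?m \<in> xi_closure (JMdeg_top n (\<Sum>\<^sub># \<nu>))"
    by (intro xi_closure_add submodule_JMdeg_top)
  then have "?l' * ?m' - ?l * ?m \<in> xi_closure (JMdeg_top n (\<Sum>\<^sub># \<nu>))"
    by (simp add: algebra_simps)
  then have "theta (Suc n) \<nu> (?l' * ?m' - ?l * ?m) = 0"
    unfolding theta_def
    by (rule xi_closure_vanish) (use JMdeg_top_vanish [OF _ gens_subset [OF \<nu>]] card_gens [OF ptns_zero [OF \<nu>]] in auto)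
  then show ?thesis
    using theta_Suc [OF \<nu> n, of "?l * ?m"] by (simp add: theta_def left_diff_distrib)
qed

end

section \<open>Positivity and parity\<close>

definition pos_parity :: "bool \<Rightarrow> int poly \<Rightarrow> bool" where
  "pos_parity q p \<longleftrightarrow> (\<forall>i. coeff p i \<ge> 0 \<and> (coeff p i \<noteq> 0 \<longrightarrow> odd i = q))"

lemma pos_parity_0 [simp]: "pos_parity q 0"
  by (simp add: pos_parity_def)

lemma pos_parity_1 [simp]: "pos_parity False 1"
  by (simp add: pos_parity_def one_pCons coeff_pCons split: nat.splits)

lemma pos_parity_add: "pos_parity q a \<Longrightarrow> pos_parity q b \<Longrightarrow> pos_parity q (a + b)"
  unfolding pos_parity_def
proof (intro allI conjI impI)
  assume a: "\<forall>i. 0 \<le> coeff a i \<and> (coeff a i \<noteq> 0 \<longrightarrow> odd i = q)"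
    and b: "\<forall>i. 0 \<le> coeff b i \<and> (coeff b i \<noteq> 0 \<longrightarrow> odd i = q)"
  fix i
  show "0 \<le> coeff (a + b) i"
    using a b by simp
  assume "coeff (a + b) i \<noteq> 0"
  then have "coeff a i \<noteq> 0 \<or> coeff b i \<noteq> 0"
    by auto
  then show "odd i = q"
    using a b by blast
qed

lemma pos_parity_sum: "(\<And>i. i \<in> A \<Longrightarrow> pos_parity q (f i)) \<Longrightarrow> pos_parity q (\<Sum>i\<in>A. f i)"
  by (induction A rule: infinite_finite_induct) (auto intro: pos_parity_add)

lemma pos_parity_mult:
  fixes a b :: "int poly"
  assumes "pos_parity p a" "pos_parity q b"
  shows "pos_parity (p \<noteq> q) (a * b)"
  unfolding pos_parity_def
proof (intro allI conjI impI)
  fix i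
  show "coeff (a * b) i \<ge> 0"
    unfolding coeff_mult using assms by (intro sum_nonneg) (simp add: pos_parity_def)
  assume "coeff (a * b) i \<noteq> 0"
  from this [unfolded coeff_mult] obtain j where "j \<in> {..i}" and j: "coeff a j * coeff b (i - j) \<noteq> 0"
    by (rule sum.not_neutral_contains_not_neutral)
  then have ji: "j \<le> i"
    by simp
  have "coeff a j \<noteq> 0" "coeff b (i - j) \<noteq> 0"
    using j by auto
  then have "odd j = p" "odd (i - j) = q"
    using assms unfolding pos_parity_def by blast+
  moreover have "odd i = (odd j \<noteq> odd (i - j))"
    using odd_add [of j "i - j"] ji by simp
  ultimately show "odd i = (p \<noteq> q)"
    by simp
qed

lemma pos_parity_xi: "pos_parity q a \<Longrightarrow> pos_parity (\<not> q) (xi * a)"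
proof -
  assume "pos_parity q a"
  moreover have "pos_parity True xi"
    by (simp add: pos_parity_def xi_def coeff_pCons split: nat.splits)
  ultimately have "pos_parity (True \<noteq> q) (xi * a)"
    by (rule pos_parity_mult [rotated])
  then show ?thesis by simp
qed

lemma pos_parity_even_odd:
  assumes "pos_parity q p" "p \<noteq> 0"
  shows "even_poly p \<longleftrightarrow> \<not> q" "odd_poly p \<longleftrightarrow> q"
proof -
  obtain i where "coeff p i \<noteq> 0"
    using assms(2) by (metis leading_coeff_neq_0)
  then show "even_poly p \<longleftrightarrow> \<not> q" "odd_poly p \<longleftrightarrow> q"
    using assms(1) by (auto simp: pos_parity_def even_poly_def odd_poly_def)
qed

lemma odd_inv_num_tr_mult: "odd (inv_num (tr i * w)) \<longleftrightarrow> \<not> odd (inv_num w)"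
proof (induction w rule: perm_asc_induct)
  case one
  then show ?case
    using odd_inv_num_mult_tr [of 1 i] by simp
next
  case (step w j)
  then show ?case
    using odd_inv_num_mult_tr [of "tr i * w" j] odd_inv_num_mult_tr [of w j] by (simp add: mult.assoc)
qed

lemma odd_inv_num_inverse: "odd (inv_num (inverse w)) \<longleftrightarrow> odd (inv_num w)"
proof (induction w rule: perm_asc_induct)
  case one
  have "inverse (1 :: nat perm) = 1"
    by (rule perm.inverse_neutral)
  then show ?case by simp
next
  case (step w i)
  then show ?case
    by (simp add: odd_inv_num_tr_mult odd_inv_num_mult_tr del: even_Suc)
qed

text \<open>A grading modulo 2 in which both \<open>T i\<close> and \<xi> are odd, respected by the
  quadratic relation: all terms have degree \<open>p\<close>, with nonnegative coefficients.\<close>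

definition pos_elt :: "bool \<Rightarrow> hecke_fin \<Rightarrow> bool" where
  "pos_elt p x \<longleftrightarrow> (\<forall>w. pos_parity (odd (inv_num w) \<noteq> p) (coef x w))"

lemma pos_elt_T_mult:
  assumes "pos_elt p x"
  shows "pos_elt (\<not> p) (T i * x)"
  unfolding pos_elt_def
proof
  fix w
  have "pos_parity (odd (inv_num w) \<noteq> (\<not> p)) (coef x (tr i * w))"
    using assms [unfolded pos_elt_def, rule_format, of "tr i * w"] unfolding odd_inv_num_tr_mult
    by (cases p) simp_all
  moreover have "pos_parity (odd (inv_num w) \<noteq> (\<not> p)) (xi * coef x w)"
    using pos_parity_xi [OF assms [unfolded pos_elt_def, rule_format, of w]] by (cases p) simp_all
  ultimately show "pos_parity (odd (inv_num w) \<noteq> (\<not> p)) (coef (T i * x) w)"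
    unfolding coef_T_mult by (auto intro: pos_parity_add)
qed

lemma pos_elt_Tperm_mult: "pos_elt p x \<Longrightarrow> pos_elt (odd (inv_num w) \<noteq> p) (Tperm w * x)"
proof (induction w arbitrary: p x rule: perm_asc_induct)
  case (step w i)
  have "pos_elt (odd (inv_num w) \<noteq> (\<not> p)) (Tperm w * (T i * x))"
    by (intro step(2) pos_elt_T_mult step(3))
  moreover have "Tperm w * (T i * x) = Tperm (w * tr i) * x"
    using step(1) by (simp flip: Tperm_mult_T mult.assoc)
  moreover have "(odd (inv_num w) \<noteq> (\<not> p)) = (odd (inv_num (w * tr i)) \<noteq> p)"
    unfolding odd_inv_num_mult_tr by blast
  ultimately show ?case
    by simp
qed simp

lemma pos_elt_mult:
  assumes "pos_elt p x" "pos_elt q y"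
  shows "pos_elt (p \<noteq> q) (x * y)"
  unfolding pos_elt_def
proof
  fix w
  have "coef (x * y) w = (\<Sum>v | coef x v \<noteq> 0. coef x v * coef (Tperm v * y) w)"
    by (subst hecke_fin_expand [of x]) (simp add: sum_distrib_right mult.assoc)
  also have "pos_parity (odd (inv_num w) \<noteq> (p \<noteq> q)) \<dots>"
  proof (rule pos_parity_sum)
    fix v
    have "pos_parity ((odd (inv_num v) \<noteq> p) \<noteq> (odd (inv_num w) \<noteq> (odd (inv_num v) \<noteq> q))) (coef x v * coef (Tperm v * y) w)"
      using assms(1) pos_elt_Tperm_mult [OF assms(2), of v] by (intro pos_parity_mult) (auto simp: pos_elt_def)
    moreover have "((odd (inv_num v) \<noteq> p) \<noteq> (odd (inv_num w) \<noteq> (odd (inv_num v) \<noteq> q)))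
        = (odd (inv_num w) \<noteq> (p \<noteq> q))"
      by blast
    ultimately show "pos_parity (odd (inv_num w) \<noteq> (p \<noteq> q)) (coef x v * coef (Tperm v * y) w)"
      by simp
  qed
  finally show "pos_parity (odd (inv_num w) \<noteq> (p \<noteq> q)) (coef (x * y) w)" .
qed

lemma odd_inv_num_cox: "finite J \<Longrightarrow> J \<subseteq> {1..<n} \<Longrightarrow> odd (inv_num (cox J 1 n)) \<longleftrightarrow> odd (card J)"
proof -
  assume J: "finite J" "J \<subseteq> {1..<n}"
  have "odd (inv_num (gen_prod u)) \<longleftrightarrow> odd (length u)" for u
    by (induction u) (simp_all add: odd_inv_num_tr_mult)
  moreover have "length (filter (\<lambda>i. i \<in> J) [1..<n]) = card J"
  proof -
    have "set (filter (\<lambda>i. i \<in> J) [1..<n]) = J"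
      using J by auto
    then show ?thesis
      using distinct_card [of "filter (\<lambda>i. i \<in> J) [1..<n]"] by simp
  qed
  ultimately show ?thesis
    unfolding cox_gen_prod by simp
qed

text \<open>After the trace reduction only values at Coxeter elements matter. They are 0 or 1, and 1
  occurs only at length |lam|, which has the required parity.\<close>

lemma (in class_elements) class_pos_elt:
  assumes n: "1 \<le> n" and lam: "lam \<in> ptns n"
  shows "pos_elt (odd (\<Sum>\<^sub># lam)) (\<gamma> n lam)"
  unfolding pos_elt_def
proof
  fix w
  show "pos_parity (odd (inv_num w) \<noteq> odd (\<Sum>\<^sub># lam)) (coef (\<gamma> n lam) w)"
  proof (cases "in_Sym n w")
    case False
    then have "coef (\<gamma> n lam) w = 0"
      using central [OF n lam] unfolding central_in_def Hsub_def by blast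
    then show ?thesis
      by simp
  next
    case True
    have "pos_parity (odd (inv_num (inverse w)) \<noteq> odd (\<Sum>\<^sub># lam)) (coef (\<gamma> n lam) (inverse (inverse w)))"
    proof (rule central_coeff_reduction [OF central [OF n lam] n, where Q = "\<lambda>p. pos_parity (p \<noteq> odd (\<Sum>\<^sub># lam))"])
      fix K assume K: "K \<subseteq> {1..<n}"
      then obtain bs where bs: "0 \<notin> set bs" "sum_list bs = n" "cgens bs = K"
        using exists_composition by blast
      have "tau (\<gamma> n lam * Tcox K 1 n) = of_bool (ctype bs = lam)"
        using tau_class [OF n lam bs(1,2)] bs(3) by simp
      moreover have "card K = \<Sum>\<^sub># lam" if "ctype bs = lam"
        using sum_ctype [of bs] that bs(3) by simp
      ultimately show "pos_parity (odd (card K) \<noteq> odd (\<Sum>\<^sub># lam)) (tau (\<gamma> n lam * Tcox K 1 n))"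
        by (cases "ctype bs = lam") simp_all
    next
      fix p a assume "pos_parity (p \<noteq> odd (\<Sum>\<^sub># lam)) a"
      from pos_parity_xi [OF this] show "pos_parity ((\<not> p) \<noteq> odd (\<Sum>\<^sub># lam)) (xi * a)"
        by (cases p) simp_all
    qed (use True in \<open>simp_all add: pos_parity_add\<close>)
    then show ?thesis
      by (simp add: odd_inv_num_inverse)
  qed
qed

lemma (in class_elements) theta_product_pos_parity:
  assumes "1 \<le> n" "lam \<in> ptns n" "\<mu> \<in> ptns n" "\<nu> \<in> ptns n"
  shows "pos_parity (odd (\<Sum>\<^sub># \<nu>) \<noteq> (odd (\<Sum>\<^sub># lam) \<noteq> odd (\<Sum>\<^sub># \<mu>))) (theta n \<nu> (\<gamma> n lam * \<gamma> n \<mu>))"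
proof -
  have elt: "pos_elt (odd (\<Sum>\<^sub># lam) \<noteq> odd (\<Sum>\<^sub># \<mu>)) (\<gamma> n lam * \<gamma> n \<mu>)"
    using assms by (intro pos_elt_mult class_pos_elt)
  have odd: "odd (inv_num (inverse (cox (gens \<nu>) 1 n))) = odd (\<Sum>\<^sub># \<nu>)"
    using odd_inv_num_cox [of "gens \<nu>" n] gens_subset [OF assms(4)] card_gens [OF ptns_zero [OF assms(4)]]
    by (simp add: odd_inv_num_inverse gens_def)
  from elt [unfolded pos_elt_def, rule_format, of "inverse (cox (gens \<nu>) 1 n)"] show ?thesis
    unfolding theta_def tau_mult_Tcox odd .
qed

section \<open>Structure constants of the presented algebra\<close>

theorem theorem1p1:
  fixes \<Gamma> :: "nat \<Rightarrow> ptn \<Rightarrow> hecke_elem"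
    and k :: "nat \<Rightarrow> ptn \<Rightarrow> ptn \<Rightarrow> ptn \<Rightarrow> int poly"
  assumes class_elements:
      "\<And>n lam. n \<ge> 1 \<Longrightarrow> lam \<in> ptns n \<Longrightarrow> is_geck_rouquier n lam (\<Gamma> n lam)"
    and structure_constants:
      "\<And>n lam \<mu>. n \<ge> 1 \<Longrightarrow> lam \<in> ptns n \<Longrightarrow> \<mu> \<in> ptns n \<Longrightarrow>
         \<Gamma> n lam \<otimes>\<^bsub>hecke n\<^esub> \<Gamma> n \<mu> =
           finsum (hecke n) (\<lambda>\<nu>. hecke_smult n (k n lam \<mu> \<nu>) (\<Gamma> n \<nu>)) (ptns n)"
  shows
    "(\<forall>n lam \<mu> \<nu>. n \<ge> 1 \<longrightarrow> lam \<in> ptns n \<longrightarrow> \<mu> \<in> ptns n \<longrightarrow> \<nu> \<in> ptns n \<longrightarrow>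
       (\<forall>i. coeff (k n lam \<mu> \<nu>) i \<ge> 0) \<and>
       (k n lam \<mu> \<nu> \<noteq> 0 \<longrightarrow>
         (even_poly (k n lam \<mu> \<nu>) \<longleftrightarrow> even (int (\<Sum>\<^sub># lam) + int (\<Sum>\<^sub># \<mu>) - int (\<Sum>\<^sub># \<nu>))) \<and>
         (odd_poly (k n lam \<mu> \<nu>) \<longleftrightarrow> odd (int (\<Sum>\<^sub># lam) + int (\<Sum>\<^sub># \<mu>) - int (\<Sum>\<^sub># \<nu>))))) \<and>
     (\<forall>n lam \<mu> \<nu>. n \<ge> 1 \<longrightarrow> lam \<in> ptns n \<longrightarrow> \<mu> \<in> ptns n \<longrightarrow> \<nu> \<in> ptns n \<longrightarrow>
       \<not> \<Sum>\<^sub># \<nu> \<le> \<Sum>\<^sub># lam + \<Sum>\<^sub># \<mu> \<longrightarrow> k n lam \<mu> \<nu> = 0) \<and>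
     (\<forall>n m lam \<mu> \<nu>. n \<ge> 1 \<longrightarrow> m \<ge> 1 \<longrightarrow>
       lam \<in> ptns n \<longrightarrow> \<mu> \<in> ptns n \<longrightarrow> \<nu> \<in> ptns n \<longrightarrow>
       lam \<in> ptns m \<longrightarrow> \<mu> \<in> ptns m \<longrightarrow> \<nu> \<in> ptns m \<longrightarrow>
       \<Sum>\<^sub># \<nu> = \<Sum>\<^sub># lam + \<Sum>\<^sub># \<mu> \<longrightarrow> k n lam \<mu> \<nu> = k m lam \<mu> \<nu>)"
proof -
  define \<gamma> where "\<gamma> n \<rho> = hecke_val (\<Gamma> n \<rho>)" for n \<rho>
  interpret class_elements \<gamma>
  proof
    fix n \<rho> assume n: "1 \<le> n" and \<rho>: "\<rho> \<in> ptns n"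
    show "central_in n (\<gamma> n \<rho>)"
      unfolding \<gamma>_def by (rule geck_rouquier_central [OF class_elements [OF n \<rho>]])
    fix J assume "J \<subseteq> {1..<n}"
    then show "coef (\<gamma> n \<rho>) (inverse (cox J 1 n))
        = of_bool (modified_cycle_type n (apply (inverse (cox J 1 n))) = \<rho>)"
      unfolding \<gamma>_def
      by (intro geck_rouquier_coeff [OF class_elements [OF n \<rho>]] min_length_cox) (simp_all add: in_Sym_cox)
  qed
  \<comment> \<open>The coordinate functional applied to the transported expansion of the product
    isolates one structure constant.\<close>
  have k: "theta n \<nu> (\<gamma> n lam * \<gamma> n \<mu>) = k n lam \<mu> \<nu>"
    if n: "1 \<le> n" and p: "lam \<in> ptns n" "\<mu> \<in> ptns n" "\<nu> \<in> ptns n" for n lam \<mu> \<nu>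
  proof -
    have c: "\<Gamma> n \<rho> \<in> carrier (hecke n)" if "\<rho> \<in> ptns n" for \<rho>
      using class_elements [OF n that] by (rule geck_rouquier_carrier)
    have "\<gamma> n lam * \<gamma> n \<mu> = hecke_val (\<Gamma> n lam \<otimes>\<^bsub>hecke n\<^esub> \<Gamma> n \<mu>)"
      by (simp add: \<gamma>_def hecke_val_mult [OF c c] p)
    also have "\<dots> = (\<Sum>\<rho>\<in>ptns n. hecke_val (hecke_smult n (k n lam \<mu> \<rho>) (\<Gamma> n \<rho>)))"
      unfolding structure_constants [OF n p(1,2)]
      by (intro hecke_val_finsum finite_ptns hecke_smult_carrier c)
    also have "\<dots> = (\<Sum>\<rho>\<in>ptns n. scal (k n lam \<mu> \<rho>) * \<gamma> n \<rho>)"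
      by (intro sum.cong) (simp_all add: hecke_val_smult c \<gamma>_def)
    finally show ?thesis
      using theta_combination [OF n p(3)] by simp
  qed
  have parity: "pos_parity (odd (\<Sum>\<^sub># \<nu>) \<noteq> (odd (\<Sum>\<^sub># lam) \<noteq> odd (\<Sum>\<^sub># \<mu>))) (k n lam \<mu> \<nu>)"
    if "1 \<le> n" "lam \<in> ptns n" "\<mu> \<in> ptns n" "\<nu> \<in> ptns n" for n lam \<mu> \<nu>
    using theta_product_pos_parity [OF that] by (simp only: k [OF that])
  have degree: "odd (int a + int b - int c) \<longleftrightarrow> (odd c \<noteq> (odd a \<noteq> odd b))" for a b c :: nat
    by auto
  \<comment> \<open>Stability is climbed one level at a time; partitions fitting into n fit into all
    larger levels.\<close>
  have stable: "k m lam \<mu> \<nu> = k n lam \<mu> \<nu>"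
    if "1 \<le> n" "lam \<in> ptns n" "\<mu> \<in> ptns n" "\<nu> \<in> ptns n" "\<Sum>\<^sub># \<nu> = \<Sum>\<^sub># lam + \<Sum>\<^sub># \<mu>" "n \<le> m"
    for n m lam \<mu> \<nu>
    using that(6)
  proof (induction m rule: dec_induct)
    case (step m)
    have p: "1 \<le> m" "lam \<in> ptns m" "\<mu> \<in> ptns m" "\<nu> \<in> ptns m"
      using that step.hyps by (auto simp: ptns_def)
    then have "k (Suc m) lam \<mu> \<nu> = k m lam \<mu> \<nu>"
      using theta_product_Suc [OF p that(5)] k [OF p] k [of "Suc m" lam \<mu> \<nu>] by (simp add: ptns_Suc)
    with step.IH show ?case by simp
  qed simp
  show ?thesis
  proof (intro conjI allI impI)
    fix n lam \<mu> \<nu> i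
    assume p: "1 \<le> n" "lam \<in> ptns n" "\<mu> \<in> ptns n" "\<nu> \<in> ptns n"
    show "0 \<le> coeff (k n lam \<mu> \<nu>) i"
      using parity [OF p] by (simp add: pos_parity_def)
    assume "k n lam \<mu> \<nu> \<noteq> 0"
    note parity' = pos_parity_even_odd [OF parity [OF p] this]
    show "even_poly (k n lam \<mu> \<nu>) \<longleftrightarrow> even (int (\<Sum>\<^sub># lam) + int (\<Sum>\<^sub># \<mu>) - int (\<Sum>\<^sub># \<nu>))"
      using parity'(1) degree [of "\<Sum>\<^sub># lam" "\<Sum>\<^sub># \<mu>" "\<Sum>\<^sub># \<nu>"] by blast
    show "odd_poly (k n lam \<mu> \<nu>) \<longleftrightarrow> odd (int (\<Sum>\<^sub># lam) + int (\<Sum>\<^sub># \<mu>) - int (\<Sum>\<^sub># \<nu>))"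
      using parity'(2) degree [of "\<Sum>\<^sub># lam" "\<Sum>\<^sub># \<mu>" "\<Sum>\<^sub># \<nu>"] by blast
  next
    fix n lam \<mu> \<nu>
    assume p: "1 \<le> n" "lam \<in> ptns n" "\<mu> \<in> ptns n" "\<nu> \<in> ptns n"
      and "\<not> \<Sum>\<^sub># \<nu> \<le> \<Sum>\<^sub># lam + \<Sum>\<^sub># \<mu>"
    then have "theta n \<nu> (\<gamma> n lam * \<gamma> n \<mu>) = 0"
      by (intro theta_product_vanish [OF p]) simp
    then show "k n lam \<mu> \<nu> = 0"
      by (simp only: k [OF p])
  next
    fix n m lam \<mu> \<nu>
    assume a: "1 \<le> n" "1 \<le> m" "lam \<in> ptns n" "\<mu> \<in> ptns n" "\<nu> \<in> ptns n"
      "lam \<in> ptns m" "\<mu> \<in> ptns m" "\<nu> \<in> ptns m" "\<Sum>\<^sub># \<nu> = \<Sum>\<^sub># lam + \<Sum>\<^sub># \<mu>"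
    show "k n lam \<mu> \<nu> = k m lam \<mu> \<nu>"
    proof (cases "n \<le> m")
      case True
      then show ?thesis
        by (rule stable [OF a(1,3-5,9), symmetric])
    next
      case False
      then show ?thesis
        by (intro stable [OF a(2,6-9)]) simp
    qed
  qed
qed

end
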